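(* Let $\sigma$ be non-decreasing and continuous for $r\ge R$ (not necessarily piecewise constant). For $s\in\mathbb C$ (for which the coefficients below are defined) let the sesquilinear form $a_\sigma^s(\cdot,\cdot)$ be defined by $$a_\sigma^s(u,u^\dagger):=\langle\mathbf A_\sigma\nabla u,\nabla u^\dagger\rangle+s^2\langle\tilde d_\sigma d_\sigma u,u^\dagger\rangle,\qquad u,u^\dagger\in H^1(\mathbb R^2).$$ Then there exists $s_0\in\mathbb C^+$ such that the Riesz representation $\mathcal A_\sigma(s_0)\in\mathcal L(H^1(\mathbb R^2))$ of $a_\sigma^{s_0}(\cdot,\cdot)$ is not Fredholm. As a corollary, the essential spectrum of $\mathcal A_\sigma(\cdot)$ in $\mathbb C^+$ (i.e. the set of $s\in\mathbb C^+$ where $\mathcal A_\sigma(s)$ is not Fredholm) is non-empty.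
   Context: $\mathbb C^+=\{s\in\mathbb C:\operatorname{Re}s>0\}$. $\mathbf A\in\mathbb R^{2\times2}$ is symmetric positive definite, normalized without loss of generality so that $\mathbf A^{-1}=\operatorname{diag}(\lambda_{\max},\lambda_{\min})$ with $\lambda_{\max}\ge\lambda_{\min}>0$. $R>0$ is the radius at which the perfectly matched layer (PML) starts. The absorption parameter $\sigma\in L^\infty(\mathbb R^+)$ satisfies $\sigma(r)=0$ for $r<R$ and $\sigma(r)>0$ for $r>R$. Put $\tilde\sigma(r)=r^{-1}\int_R^r\sigma(r')\,dr'$ for $r>R$, $\tilde\sigma(r)=0$ for $r\le R$, and $d_\sigma(s,\mathbf x)=1+s^{-1}\sigma(\|\mathbf x\|)$, $\tilde d_\sigma(s,\mathbf x)=1+s^{-1}\tilde\sigma(\|\mathbf x\|)$. With $\Pi_\parallel(\mathbf x),\Pi_\perp(\mathbf x)$ the orthogonal projections onto $\operatorname{span}\{\mathbf x\}$ and its orthogonal complement, set $$\mathbf J_\sigma(s,\mathbf x)=d_\sigma\Pi_\parallel+\tilde d_\sigma\Pi_\perp,\qquad \mathbf A_\sigma(s,\mathbf x)=\mathbf J_\sigma^{-1}\mathbf A\,\mathbf J_\sigma^{-\top}\det\mathbf J_\sigma .$$ $\langle u,u^\dagger\rangle=\int_{\mathbb R^2}u\,\overline{u^\dagger}\,d\mathbf x$ (and analogously for vector fields). The Riesz representation $\mathcal A_\sigma(s)$ is defined by $\langle\mathcal A_\sigma(s)u,u^\dagger\rangle_{H^1(\mathbb R^2)}=a_\sigma^s(u,u^\dagger)$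 for all $u,u^\dagger\in H^1(\mathbb R^2)$.
   Formalization: The formal theorem additionally assumes λ_max ≠ λ_min; for λ_max = λ_min (A a multiple of the identity) the claim is false, e.g. A = I and σ = 1 for r ≥ R = 1, where the operator is Fredholm for every s with Re s > 0. *)

theory Defs
  imports "HOL-Analysis.Analysis" "HOL-Computational_Algebra.Polynomial"
begin

section \<open>Test functions and the fundamental lemma of the calculus of variations\<close>


definition partial_deriv :: "'n \<Rightarrow> (real^'n \<Rightarrow> real) \<Rightarrow> real^'n \<Rightarrow> real" where
  "partial_deriv i \<phi> x = frechet_derivative \<phi> (at x) (axis i 1)"

primrec Ck :: "nat \<Rightarrow> (real^'n \<Rightarrow> real) \<Rightarrow> bool" where
  "Ck 0 \<phi> \<longleftrightarrow> continuous_on UNIV \<phi>"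
| "Ck (Suc k) \<phi> \<longleftrightarrow> (\<forall>x. \<phi> differentiable (at x)) \<and> (\<forall>i. Ck k (partial_deriv i \<phi>))"

definition test_function :: "(real^'n \<Rightarrow> real) \<Rightarrow> bool" where
  "test_function \<phi> \<longleftrightarrow> (\<forall>k. Ck k \<phi>) \<and> compact (closure {x. \<phi> x \<noteq> 0})"

lemma Ck_SucI:
  assumes "\<And>x. (\<phi> has_derivative D x) (at x)" and "\<And>i. Ck k (\<lambda>x. D x (axis i 1))"
  shows "Ck (Suc k) \<phi>"
proof -
  have "partial_deriv i \<phi> = (\<lambda>x. D x (axis i 1))" for i
    using frechet_derivative_at[OF assms(1)] by (auto simp: partial_deriv_def fun_eq_iff)
  then show ?thesis using assms by (auto simp: differentiable_def)
qed

lemma Ck_Suc_derivE: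
  assumes "Ck (Suc k) \<phi>"
  shows "(\<phi> has_derivative frechet_derivative \<phi> (at x)) (at x)"
  using assms frechet_derivative_works by auto

lemma Ck_Suc_partial: "Ck (Suc k) \<phi> \<Longrightarrow> Ck k (\<lambda>x. frechet_derivative \<phi> (at x) (axis i 1))"
  by (auto simp: partial_deriv_def[abs_def])

lemma Ck_mono_Suc: "Ck (Suc k) \<phi> \<Longrightarrow> Ck k \<phi>"
proof (induction k arbitrary: \<phi>)
  case 0
  then show ?case
    by (auto simp: continuous_on_eq_continuous_at differentiable_imp_continuous_within)
qed auto

lemma Ck_continuous: "Ck k \<phi> \<Longrightarrow> continuous_on UNIV \<phi>"
proof (induction k)
  case (Suc k) then show ?case using Ck_mono_Suc by blast
qed simp

lemma Ck_const: "Ck k (\<lambda>x. c)"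
proof (induction k arbitrary: c)
  case (Suc k)
  show ?case by (rule Ck_SucI[where D="\<lambda>x h. 0"]) (auto simp: Suc)
qed simp

lemma Ck_add: "Ck k f \<Longrightarrow> Ck k g \<Longrightarrow> Ck k (\<lambda>x. f x + g x)"
proof (induction k arbitrary: f g)
  case (Suc k)
  show ?case
    by (rule Ck_SucI[OF has_derivative_add[OF Ck_Suc_derivE[OF Suc.prems(1)] Ck_Suc_derivE[OF Suc.prems(2)]]])
      (intro Suc.IH Ck_Suc_partial Suc.prems)
qed (auto intro!: continuous_intros)

lemma Ck_mult: "Ck k f \<Longrightarrow> Ck k g \<Longrightarrow> Ck k (\<lambda>x. f x * g x)"
proof (induction k arbitrary: f g)
  case (Suc k)
  show ?case
    by (rule Ck_SucI[OF has_derivative_mult[OF Ck_Suc_derivE[OF Suc.prems(1)] Ck_Suc_derivE[OF Suc.prems(2)]]])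
      (intro Suc.IH Ck_add Ck_Suc_partial Suc.prems Ck_mono_Suc)
qed (auto intro!: continuous_intros)

lemma Ck_prod: "finite I \<Longrightarrow> (\<And>i. i \<in> I \<Longrightarrow> Ck k (f i)) \<Longrightarrow> Ck k (\<lambda>x. \<Prod>i\<in>I. f i x)"
  by (induction I rule: finite_induct) (auto intro: Ck_mult Ck_const)

text \<open>
  The functions \<open>p (1/t) exp (-1/t)\<close> on the positive half-line, extended by zero, are closed
  under differentiation; products of them give smooth bumps increasing to box indicators.
\<close>

definition flat_fun :: "real poly \<Rightarrow> real \<Rightarrow> real" where
  "flat_fun p t = (if t > 0 then poly p (inverse t) * exp (- inverse t) else 0)"

lemma poly_exp_tendsto_0: "((\<lambda>x::real. poly p x * exp (- x)) \<longlongrightarrow> 0) at_top"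
proof -
  have "((\<lambda>x. \<Sum>i\<le>degree p. coeff p i * (x ^ i / exp x)) \<longlongrightarrow> (\<Sum>i\<le>degree p. coeff p i * 0)) at_top"
    by (intro tendsto_intros tendsto_power_div_exp_0)
  moreover have "(\<lambda>x::real. poly p x * exp (- x)) = (\<lambda>x. \<Sum>i\<le>degree p. coeff p i * (x ^ i / exp x))"
    by (auto simp: poly_altdef exp_minus field_simps sum_distrib_right sum_divide_distrib fun_eq_iff)
  ultimately show ?thesis by simp
qed

definition flat_deriv :: "real poly \<Rightarrow> real poly" where
  "flat_deriv p = monom 1 2 * (p - pderiv p)"

lemma flat_fun_deriv: "(flat_fun p has_real_derivative flat_fun (flat_deriv p) t) (at t)"
proof -
  consider "t > 0" | "t < 0" | "t = 0" by linarith
  then show ?thesis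
  proof cases
    case 1
    have "((\<lambda>t. poly p (inverse t) * exp (- inverse t)) has_real_derivative flat_fun (flat_deriv p) t) (at t)"
      using 1
      by (auto intro!: derivative_eq_intros DERIV_chain'[of inverse _ _ _ "poly p"] poly_DERIV
          simp: flat_fun_def flat_deriv_def poly_monom field_simps power2_eq_square)
    then show ?thesis
      by (rule has_field_derivative_transform_within_open[of _ _ _ "{0<..}"]) (use 1 in \<open>auto simp: flat_fun_def\<close>)
  next
    case 2
    have "((\<lambda>t. 0) has_real_derivative flat_fun (flat_deriv p) t) (at t)"
      using 2 by (auto simp: flat_fun_def)
    then show ?thesis
      by (rule has_field_derivative_transform_within_open[of _ _ _ "{..<0}"]) (use 2 in \<open>auto simp: flat_fun_def\<close>)
  next
    case 3
    have "((\<lambda>h. flat_fun p h / h) \<longlongrightarrow> 0) (at_right 0)"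
    proof -
      have "((\<lambda>h. poly (pCons 0 p) (inverse h) * exp (- inverse h)) \<longlongrightarrow> 0) (at_right (0::real))"
        by (rule filterlim_compose[OF poly_exp_tendsto_0 filterlim_inverse_at_top_right])
      then show ?thesis
        by (rule Lim_transform_eventually)
          (auto simp: eventually_at_filter flat_fun_def field_simps)
    qed
    moreover have "((\<lambda>h. flat_fun p h / h) \<longlongrightarrow> 0) (at_left 0)"
      by (rule tendsto_eventually) (auto simp: eventually_at_filter flat_fun_def)
    ultimately have "((\<lambda>h. flat_fun p h / h) \<longlongrightarrow> 0) (at 0)"
      by (simp add: filterlim_split_at)
    then show ?thesis
      using 3 by (simp add: DERIV_def flat_fun_def)
  qed
qed

lemma Ck_flat_fun:
  "Ck k (\<lambda>x::real^'n::finite. flat_fun p (c * x $ i + d))"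
proof (induction k arbitrary: p)
  case 0
  have "continuous_on UNIV (flat_fun p)"
    using flat_fun_deriv DERIV_isCont continuous_at_imp_continuous_on by blast
  then show ?case
    by (auto intro!: continuous_on_compose2[of UNIV "flat_fun p"] continuous_intros)
next
  case (Suc k)
  have "((\<lambda>x::real^'n. flat_fun p (c * x $ i + d)) has_derivative
      (\<lambda>h. c * h $ i * flat_fun (flat_deriv p) (c * x $ i + d))) (at x)" for x
  proof -
    have 1: "((\<lambda>x::real^'n. c * x $ i + d) has_derivative (\<lambda>h. c * h $ i)) (at x)"
      by (auto intro!: derivative_eq_intros bounded_linear.has_derivative[OF bounded_linear_vec_nth])
    show ?thesis
      using has_derivative_compose[OF 1 flat_fun_deriv[unfolded has_field_derivative_def]]
      by (simp add: mult.commute)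
  qed
  then show ?case
    by (rule Ck_SucI) (rule Ck_mult[OF Ck_const Suc.IH])
qed

definition box_bump :: "real^'n \<Rightarrow> real^'n \<Rightarrow> nat \<Rightarrow> real^'n \<Rightarrow> real" where
  "box_bump a b n x = (\<Prod>i\<in>UNIV. flat_fun 1 (real n * x $ i + (- real n * a $ i)) *
      flat_fun 1 (- real n * x $ i + real n * b $ i))"

lemma flat_fun_1: "0 \<le> flat_fun 1 t" "flat_fun 1 t \<le> 1" "t \<le> 0 \<Longrightarrow> flat_fun 1 t = 0"
  by (auto simp: flat_fun_def)

lemma box_bump_outside:
  assumes "x \<notin> box a b" shows "box_bump a b n x = 0"
proof -
  obtain i where "x $ i \<le> a $ i \<or> x $ i \<ge> b $ i"
    using assms by (auto simp: mem_box_cart not_less)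
  then have "real n * x $ i + (- real n * a $ i) \<le> 0 \<or> - real n * x $ i + real n * b $ i \<le> 0"
    by (auto intro: mult_left_mono)
  then have "flat_fun 1 (real n * x $ i + (- real n * a $ i)) * flat_fun 1 (- real n * x $ i + real n * b $ i) = 0"
    using flat_fun_1(3) by auto
  then show ?thesis unfolding box_bump_def by (intro prod_zero) auto
qed

lemma box_bump_bounds: "0 \<le> box_bump a b n x" "box_bump a b n x \<le> 1"
  unfolding box_bump_def
  by (auto intro!: prod_nonneg prod_le_1 mult_le_one flat_fun_1 mult_nonneg_nonneg)

lemma test_function_box_bump: "test_function (box_bump a b n)"
proof -
  have "Ck k (box_bump a b n)" for k
    unfolding box_bump_def[abs_def] by (rule Ck_prod[OF _ Ck_mult[OF Ck_flat_fun Ck_flat_fun]]) auto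
  moreover have "{x. box_bump a b n x \<noteq> 0} \<subseteq> box a b"
    using box_bump_outside by blast
  then have "bounded {x. box_bump a b n x \<noteq> 0}"
    using bounded_box bounded_subset by blast
  ultimately show ?thesis by (auto simp: test_function_def compact_closure)
qed

lemma box_bump_tendsto:
  assumes "x \<in> box a b" shows "(\<lambda>n. box_bump a b n x) \<longlonglongrightarrow> 1"
proof -
  have lim: "(\<lambda>n. flat_fun 1 (real n * c)) \<longlonglongrightarrow> 1" if "c > 0" for c :: real
  proof -
    have "(\<lambda>n. exp (- (inverse c * inverse (real n)))) \<longlonglongrightarrow> exp (- (inverse c * 0))"
      by (intro tendsto_intros lim_inverse_n)
    then have "(\<lambda>n. exp (- (inverse c * inverse (real n)))) \<longlonglongrightarrow> 1" by simp
    then show ?thesis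
    proof (rule Lim_transform_eventually)
      show "\<forall>\<^sub>F n in sequentially. exp (- (inverse c * inverse (real n))) = flat_fun 1 (real n * c)"
        using eventually_gt_at_top[of 0] by eventually_elim (use that in \<open>auto simp: flat_fun_def mult.commute\<close>)
    qed
  qed
  have "(\<lambda>n. \<Prod>i\<in>UNIV. flat_fun 1 (real n * (x $ i - a $ i)) * flat_fun 1 (real n * (b $ i - x $ i)))
    \<longlonglongrightarrow> (\<Prod>i\<in>(UNIV::'a set). 1 * 1)"
    by (intro tendsto_prod tendsto_mult lim) (use assms in \<open>auto simp: mem_box_cart\<close>)
  then show ?thesis by (simp add: box_bump_def algebra_simps)
qed

definition sq_integrable :: "(real^'n \<Rightarrow> 'b::real_normed_vector) \<Rightarrow> bool" where
  "sq_integrable u \<longleftrightarrow> u \<in> borel_measurable lborel \<and> integrable lborel (\<lambda>x. (norm (u x))\<^sup>2)"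

lemma sq_integrable_bounded_mult:
  fixes u :: "real^'n \<Rightarrow> complex"
  assumes "sq_integrable u" "\<phi> \<in> borel_measurable lborel" "bounded S" "S \<in> sets lborel"
    "\<And>x. \<bar>\<phi> x\<bar> \<le> B * indicat_real S x"
  shows "integrable lborel (\<lambda>x. u x * complex_of_real (\<phi> x))"
proof (rule Bochner_Integration.integrable_bound)
  have [measurable]: "u \<in> borel_measurable lborel" "\<phi> \<in> borel_measurable lborel"
    using assms by (auto simp: sq_integrable_def)
  have "emeasure lborel S < \<infinity>" using emeasure_bounded_finite[OF assms(3)] by simp
  then have "integrable lborel (indicat_real S)" using assms(4) by simp
  then show "integrable lborel (\<lambda>x. (norm (u x))\<^sup>2 + B\<^sup>2 * indicat_real S x)"
    using assms(1) by (auto simp: sq_integrable_def)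
  show "(\<lambda>x. u x * complex_of_real (\<phi> x)) \<in> borel_measurable lborel" by measurable
  have "norm (u x * complex_of_real (\<phi> x)) \<le> (norm (u x))\<^sup>2 + B\<^sup>2 * indicat_real S x" for x
  proof -
    have a: "\<bar>\<phi> x\<bar>\<^sup>2 \<le> (B * indicat_real S x)\<^sup>2" by (rule power_mono[OF assms(5)]) simp
    have "2 * (norm (u x) * \<bar>\<phi> x\<bar>) \<le> (norm (u x))\<^sup>2 + \<bar>\<phi> x\<bar>\<^sup>2"
      using sum_squares_bound[of "norm (u x)" "\<bar>\<phi> x\<bar>"] by simp
    moreover have "0 \<le> norm (u x) * \<bar>\<phi> x\<bar>" by simp
    moreover have "(B * indicat_real S x)\<^sup>2 = B\<^sup>2 * indicat_real S x"
      by (simp add: indicator_def)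
    ultimately have "norm (u x) * \<bar>\<phi> x\<bar> \<le> (norm (u x))\<^sup>2 + B\<^sup>2 * indicat_real S x"
      using a by linarith
    then show ?thesis by (simp add: norm_mult)
  qed
  then show "AE x in lborel. norm (u x * complex_of_real (\<phi> x)) \<le> norm ((norm (u x))\<^sup>2 + B\<^sup>2 * indicat_real S x)"
    by (intro AE_I2) (metis abs_ge_self order_trans real_norm_def)
qed

lemma fundamental_lemma:
  fixes f :: "real^'n \<Rightarrow> complex"
  assumes f: "sq_integrable f"
    and 0: "\<And>\<phi>. test_function \<phi> \<Longrightarrow> (LINT x|lborel. f x * complex_of_real (\<phi> x)) = 0"
  shows "AE x in lborel. f x = 0"
proof -
  have fm[measurable]: "f \<in> borel_measurable lborel" using f by (simp add: sq_integrable_def)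
  have box0: "(LINT x|lborel. f x * complex_of_real (indicat_real (box a b) x)) = 0" for a b
  proof -
    have "(\<lambda>n. LINT x|lborel. f x * complex_of_real (box_bump a b n x)) \<longlonglongrightarrow>
       (LINT x|lborel. f x * complex_of_real (indicat_real (box a b) x))"
    proof (rule integral_dominated_convergence[where w="\<lambda>x. norm (f x * complex_of_real (indicat_real (box a b) x))"])
      show "(\<lambda>x. f x * complex_of_real (box_bump a b n x)) \<in> borel_measurable lborel" for n
      proof -
        have "continuous_on UNIV (box_bump a b n)"
          using test_function_box_bump[of a b n] unfolding test_function_def by (metis Ck.simps(1))
        then have [measurable]: "box_bump a b n \<in> borel_measurable lborel"
          by (simp add: borel_measurable_continuous_onI)
        show ?thesis by measurable
      qed
      show "integrable lborel (\<lambda>x. norm (f x * complex_of_real (indicat_real (box a b) x)))"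
        by (intro integrable_norm sq_integrable_bounded_mult[OF f, where S="box a b" and B=1])
          (auto simp: bounded_box)
      show "AE x in lborel. norm (f x * complex_of_real (box_bump a b n x))
         \<le> norm (f x * complex_of_real (indicat_real (box a b) x))" for n
      proof (rule AE_I2)
        fix x
        show "norm (f x * complex_of_real (box_bump a b n x))
          \<le> norm (f x * complex_of_real (indicat_real (box a b) x))"
          using box_bump_bounds[of a b n x] box_bump_outside[of x a b n]
          by (cases "x \<in> box a b") (simp_all add: norm_mult mult_left_le)
      qed
      show "AE x in lborel. (\<lambda>n. f x * complex_of_real (box_bump a b n x)) \<longlonglongrightarrow>
          f x * complex_of_real (indicat_real (box a b) x)"
      proof (intro AE_I2 tendsto_intros)
        fix x
        show "(\<lambda>n. box_bump a b n x) \<longlonglongrightarrow> indicat_real (box a b) x"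
          using box_bump_tendsto[of x a b] box_bump_outside[of x a b]
          by (cases "x \<in> box a b") auto
      qed
    qed (measurable)
    then show ?thesis by (simp add: 0[OF test_function_box_bump] LIMSEQ_const_iff)
  qed
  have key: "AE x in lborel. f x * complex_of_real (indicat_real (box c d) x) = 0" for c d
  proof -
    define g where "g = (\<lambda>x. f x * complex_of_real (indicat_real (box c d) x))"
    have gi: "integrable lborel g"
      unfolding g_def by (rule sq_integrable_bounded_mult[OF f, where S="box c d" and B=1])
        (auto simp: bounded_box)
    have si: "set_integrable lborel A g" if "A \<in> sets lborel" for A
      using gi that by (simp add: set_integrable_def integrable_mult_indicator)
    have ist: "Int_stable (range (\<lambda>(a,b). box a b :: (real^'n) set))"
      unfolding Int_stable_def by (auto simp: box_Int_box)
    have sb: "range (\<lambda>(a,b). box a b :: (real^'n) set) \<subseteq> Pow UNIV" by simp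
    have z: "(LINT x:A|lborel. g x) = 0" if A: "A \<in> sigma_sets UNIV (range (\<lambda>(a,b). box a b :: (real^'n) set))" for A
      using ist sb A
    proof (induction rule: sigma_sets_induct_disjoint)
      fix A :: "(real^'n) set" assume "A \<in> range (\<lambda>(a,b). box a b)"
      then obtain a b where A: "A = box a b" by auto
      obtain a' b' where ab: "box a b \<inter> box c d = (box a' b' :: (real^'n) set)"
        by (rule that[OF box_Int_box])
      have "indicator A x *\<^sub>R g x = f x * complex_of_real (indicat_real (box a' b') x)" for x
        unfolding g_def A ab[symmetric]
        by (cases "x \<in> box a b"; cases "x \<in> box c d") simp_all
      then show "(LINT x:A|lborel. g x) = 0"
        using box0[of a' b'] by (simp add: set_lebesgue_integral_def)
    next
      fix A assume A: "A \<in> sigma_sets UNIV (range (\<lambda>(a,b). box a b :: (real^'n) set))"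
        and Z: "(LINT x:A|lborel. g x) = 0"
      have Am: "A \<in> sets lborel" using A by (simp add: borel_eq_box sets_measure_of)
      have "(LINT x:UNIV|lborel. g x) = 0"
        using box0[of c d] by (simp add: set_lebesgue_integral_def g_def)
      moreover have "(LINT x:A \<union> (UNIV - A)|lborel. g x) = (LINT x:A|lborel. g x) + (LINT x:UNIV - A|lborel. g x)"
        by (rule set_integral_Un) (use Am in \<open>auto intro!: si\<close>)
      ultimately show "(LINT x:UNIV - A|lborel. g x) = 0" using Z by simp
    next
      fix A :: "nat \<Rightarrow> (real^'n) set"
      assume d: "disjoint_family A" and A: "range A \<subseteq> sigma_sets UNIV (range (\<lambda>(a,b). box a b))"
        and Z: "\<And>i. (LINT x:A i|lborel. g x) = 0"
      have Am: "A i \<in> sets lborel" for i using A by (auto simp: borel_eq_box sets_measure_of)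
      have "(LINT x:(\<Union>i. A i)|lborel. g x) = (\<Sum>i. (LINT x:(A i)|lborel. g x))"
        by (rule lebesgue_integral_countable_add)
          (use Am d in \<open>auto intro!: si simp: disjoint_family_on_def\<close>)
      then show "(LINT x:(\<Union>i. A i)|lborel. g x) = 0" using Z by simp
    qed (auto simp: set_lebesgue_integral_def)
    have z': "(LINT x:A|lborel. g x) = 0" if "A \<in> sets lborel" for A
      using z[of A] that by (simp add: borel_eq_box sets_measure_of)
    have zRe: "(LINT x:A|lborel. Re (g x)) = 0" and zIm: "(LINT x:A|lborel. Im (g x)) = 0"
      if "A \<in> sets lborel" for A
      using integral_Re[OF si[OF that, unfolded set_integrable_def]]
        integral_Im[OF si[OF that, unfolded set_integrable_def]] z'[OF that]
      by (simp_all add: set_lebesgue_integral_def)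
    have "AE x in lborel. Re (g x) = 0"
      by (rule density_unique_real[OF integrable_Re[OF gi] integrable_zero]) (simp add: zRe)
    moreover have "AE x in lborel. Im (g x) = 0"
      by (rule density_unique_real[OF integrable_Im[OF gi] integrable_zero]) (simp add: zIm)
    ultimately show ?thesis
      by eventually_elim (simp add: complex_eq_iff g_def)
  qed
  have "AE x in lborel. \<forall>n::nat. f x * complex_of_real (indicat_real (box (\<chi> i. - real n) (\<chi> i. real n)) x) = 0"
    unfolding AE_all_countable using key by blast
  then show ?thesis
  proof eventually_elim
    case (elim x)
    obtain n where n: "norm x < real n" using reals_Archimedean2 by blast
    then have "\<bar>x $ i\<bar> < real n" for i using component_le_norm_cart[of x i] by linarith
    then have "x \<in> box (\<chi> i. - real n) (\<chi> i. real n)"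
      by (simp add: mem_box_cart abs_less_iff minus_less_iff)
    then show "f x = 0" using elim[rule_format, of n] by simp
  qed
qed

section \<open>The complex Sobolev space H1\<close>


text \<open>
  Integration by parts against real-valued test functions; complex-valued ones give the
  same notion by linearity.
\<close>

definition weak_gradient :: "(real^'n \<Rightarrow> complex) \<Rightarrow> (real^'n \<Rightarrow> complex^'n) \<Rightarrow> bool" where
  "weak_gradient u g \<longleftrightarrow> (\<forall>\<phi> i. test_function \<phi> \<longrightarrow>
     (LINT x|lborel. u x * complex_of_real (partial_deriv i \<phi> x)) =
     - (LINT x|lborel. g x $ i * complex_of_real (\<phi> x)))"

definition H1_fun :: "(real^'n \<Rightarrow> complex) \<Rightarrow> bool" where
  "H1_fun u \<longleftrightarrow> sq_integrable u \<and> (\<exists>g. sq_integrable g \<and> weak_gradient u g)"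

text \<open>The choice is unique up to null sets, see \<open>weak_gradient_unique\<close> below.\<close>

definition grad_fun :: "(real^'n \<Rightarrow> complex) \<Rightarrow> real^'n \<Rightarrow> complex^'n" where
  "grad_fun u = (SOME g. sq_integrable g \<and> weak_gradient u g)"

definition cdot :: "complex^'n \<Rightarrow> complex^'n \<Rightarrow> complex" where
  "cdot v w = (\<Sum>i\<in>UNIV. v $ i * cnj (w $ i))"

definition H1_cinner_fun :: "(real^'n \<Rightarrow> complex) \<Rightarrow> (real^'n \<Rightarrow> complex) \<Rightarrow> complex" where
  "H1_cinner_fun u v = (LINT x|lborel. u x * cnj (v x)) +
     (LINT x|lborel. cdot (grad_fun u x) (grad_fun v x))"

lemma test_function_bounded:
  assumes "test_function \<phi>"
  obtains B S where "bounded S" "S \<in> sets lborel" "\<phi> \<in> borel_measurable lborel"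
    "\<And>x. \<bar>\<phi> x\<bar> \<le> B * indicat_real S x"
proof -
  let ?S = "closure {x. \<phi> x \<noteq> 0}"
  have c: "continuous_on UNIV \<phi>" using assms unfolding test_function_def by (metis Ck.simps(1))
  have K: "compact ?S" using assms by (simp add: test_function_def)
  have "bounded (\<phi> ` ?S)"
    by (intro compact_imp_bounded compact_continuous_image[OF _ K] continuous_on_subset[OF c]) auto
  then obtain B where B: "\<And>x. x \<in> ?S \<Longrightarrow> \<bar>\<phi> x\<bar> \<le> B" by (auto simp: bounded_iff)
  have "\<bar>\<phi> x\<bar> \<le> B * indicat_real ?S x" for x
    using B[of x] closure_subset[of "{x. \<phi> x \<noteq> 0}"] by (cases "x \<in> ?S") auto
  then show ?thesis
    using that[of ?S B] K c compact_imp_bounded by (auto simp: borel_measurable_continuous_onI)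
qed

lemma test_function_partial_deriv:
  assumes "test_function \<phi>" shows "test_function (partial_deriv i \<phi>)"
proof -
  have "Ck k (partial_deriv i \<phi>)" for k
    using assms unfolding test_function_def by (metis Ck.simps(2))
  moreover have "{x. partial_deriv i \<phi> x \<noteq> 0} \<subseteq> closure {x. \<phi> x \<noteq> 0}"
  proof (rule subsetI, rule ccontr)
    fix x assume x: "x \<in> {x. partial_deriv i \<phi> x \<noteq> 0}" "x \<notin> closure {x. \<phi> x \<noteq> 0}"
    have "((\<lambda>x. 0::real) has_derivative (\<lambda>h. 0)) (at x)" by simp
    then have "(\<phi> has_derivative (\<lambda>h. 0)) (at x)"
    proof (rule has_derivative_transform_within_open[where s="- closure {x. \<phi> x \<noteq> 0}"])
      show "\<And>y. y \<in> - closure {x. \<phi> x \<noteq> 0} \<Longrightarrow> 0 = \<phi> y"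
        using closure_subset[of "{x. \<phi> x \<noteq> 0}"] by auto
    qed (use x in auto)
    then have "frechet_derivative \<phi> (at x) = (\<lambda>h. 0)" by (metis frechet_derivative_at)
    then show False using x by (simp add: partial_deriv_def)
  qed
  then have "closure {x. partial_deriv i \<phi> x \<noteq> 0} \<subseteq> closure {x. \<phi> x \<noteq> 0}"
    by (simp add: closure_minimal)
  then have "compact (closure {x. partial_deriv i \<phi> x \<noteq> 0})"
    using assms unfolding test_function_def compact_eq_bounded_closed
    by (metis bounded_subset closed_closure)
  ultimately show ?thesis by (simp add: test_function_def)
qed

lemma test_mult_integrable:
  assumes "sq_integrable u" "test_function \<phi>"
  shows "integrable lborel (\<lambda>x. u x * complex_of_real (\<phi> x))"
  using test_function_bounded[OF assms(2)] sq_integrable_bounded_mult[OF assms(1)] by metis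

lemma sq_integrable_dominated:
  assumes "sq_integrable u" "v \<in> borel_measurable lborel" "\<And>x. norm (v x) \<le> C * norm (u x)"
  shows "sq_integrable v"
  unfolding sq_integrable_def
proof
  have "integrable lborel (\<lambda>x. C\<^sup>2 * (norm (u x))\<^sup>2)"
    using assms(1) by (simp add: sq_integrable_def)
  then show "integrable lborel (\<lambda>x. (norm (v x))\<^sup>2)"
  proof (rule Bochner_Integration.integrable_bound)
    show "(\<lambda>x. (norm (v x))\<^sup>2) \<in> borel_measurable lborel" using assms(2) by measurable
    have "(norm (v x))\<^sup>2 \<le> C\<^sup>2 * (norm (u x))\<^sup>2" for x
      using power_mono[OF assms(3), of x 2] by (simp add: power_mult_distrib)
    then show "AE x in lborel. norm ((norm (v x))\<^sup>2) \<le> norm (C\<^sup>2 * (norm (u x))\<^sup>2)" by simp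
  qed
qed fact

lemma sq_integrable_add:
  fixes u v :: "real^'n \<Rightarrow> 'b::{real_normed_vector, second_countable_topology}"
  assumes "sq_integrable u" "sq_integrable v"
  shows "sq_integrable (\<lambda>x. u x + v x)"
  unfolding sq_integrable_def
proof
  have [measurable]: "u \<in> borel_measurable lborel" "v \<in> borel_measurable lborel"
    using assms by (auto simp: sq_integrable_def)
  show "(\<lambda>x. u x + v x) \<in> borel_measurable lborel" by measurable
  have "integrable lborel (\<lambda>x. 2 * (norm (u x))\<^sup>2 + 2 * (norm (v x))\<^sup>2)"
    using assms by (simp add: sq_integrable_def)
  then show "integrable lborel (\<lambda>x. (norm (u x + v x))\<^sup>2)"
  proof (rule Bochner_Integration.integrable_bound)
    show "(\<lambda>x. (norm (u x + v x))\<^sup>2) \<in> borel_measurable lborel" by measurable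
    have "(norm (u x + v x))\<^sup>2 \<le> 2 * (norm (u x))\<^sup>2 + 2 * (norm (v x))\<^sup>2" for x
      using power_mono[OF norm_triangle_ineq, of "u x" "v x" 2]
        sum_squares_bound[of "norm (u x)" "norm (v x)"]
      by (simp add: power2_sum)
    then show "AE x in lborel. norm ((norm (u x + v x))\<^sup>2) \<le> norm (2 * (norm (u x))\<^sup>2 + 2 * (norm (v x))\<^sup>2)"
      by simp
  qed
qed

lemma sq_integrable_scaleC:
  assumes "sq_integrable (u :: real^'n \<Rightarrow> complex)" shows "sq_integrable (\<lambda>x. c * u x)"
  by (rule sq_integrable_dominated[OF assms, where C="norm c"])
    (use assms in \<open>auto simp: sq_integrable_def norm_mult\<close>)

lemma measurable_vec_nth: "(g :: real^'m \<Rightarrow> complex^'n) \<in> borel_measurable lborel \<Longrightarrow> (\<lambda>x. g x $ i) \<in> borel_measurable lborel"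
  by (rule borel_measurable_continuous_on[where f="\<lambda>y. y $ i"]) (auto intro!: continuous_intros)

lemma measurable_vec_lambda: "(\<And>i. (\<lambda>x. g i x) \<in> borel_measurable lborel) \<Longrightarrow>
   (\<lambda>x::real^'m. (\<chi> i. g i x) :: complex^'n) \<in> borel_measurable lborel"
  by (subst borel_measurable_euclidean_space)
    (auto simp: Basis_vec_def inner_axis intro!: borel_measurable_inner)

lemma sq_integrable_vec_scaleC:
  fixes g :: "real^'m \<Rightarrow> complex^'n"
  assumes "sq_integrable g" shows "sq_integrable (\<lambda>x. c *s g x)"
proof (rule sq_integrable_dominated[OF assms])
  show "(\<lambda>x. c *s g x) \<in> borel_measurable lborel"
    unfolding vector_scalar_mult_def
    using assms by (intro measurable_vec_lambda borel_measurable_times measurable_vec_nth) (auto simp: sq_integrable_def)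
  show "norm (c *s g x) \<le> norm c * norm (g x)" for x
    unfolding norm_vec_def vector_smult_component norm_mult
    by (simp add: L2_set_right_distrib)
qed

lemma sq_integrable_nth:
  fixes g :: "real^'m \<Rightarrow> complex^'n"
  assumes "sq_integrable g" shows "sq_integrable (\<lambda>x. g x $ i)"
  by (rule sq_integrable_dominated[OF assms, where C=1])
    (use assms in \<open>auto simp: sq_integrable_def Finite_Cartesian_Product.norm_nth_le
      intro!: measurable_vec_nth[unfolded measurable_lborel2]\<close>)

lemma mult_cnj_integrable:
  assumes "sq_integrable u" "sq_integrable v"
  shows "integrable lborel (\<lambda>x. u x * cnj (v x))"
proof (rule Bochner_Integration.integrable_bound)
  have [measurable]: "u \<in> borel_measurable lborel" "v \<in> borel_measurable lborel"
    using assms by (auto simp: sq_integrable_def)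
  show "integrable lborel (\<lambda>x. (norm (u x))\<^sup>2 + (norm (v x))\<^sup>2)"
    using assms by (simp add: sq_integrable_def)
  have [measurable]: "(\<lambda>x. cnj (v x)) \<in> borel_measurable lborel"
    by (rule borel_measurable_continuous_on[where f=cnj]) (auto intro!: continuous_intros)
  show "(\<lambda>x. u x * cnj (v x)) \<in> borel_measurable lborel" by measurable
  have "norm (u x) * norm (v x) \<le> (norm (u x))\<^sup>2 + (norm (v x))\<^sup>2" for x
    using sum_squares_bound[of "norm (u x)" "norm (v x)"] mult_nonneg_nonneg[of "norm (u x)" "norm (v x)"]
    by (simp del: mult_nonneg_nonneg)
  then show "AE x in lborel. norm (u x * cnj (v x)) \<le> norm ((norm (u x))\<^sup>2 + (norm (v x))\<^sup>2)"
    by (simp add: norm_mult)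
qed

lemma cdot_integrable:
  fixes g h :: "real^'m \<Rightarrow> complex^'n"
  assumes "sq_integrable g" "sq_integrable h"
  shows "integrable lborel (\<lambda>x. cdot (g x) (h x))"
  unfolding cdot_def
  by (intro Bochner_Integration.integrable_sum mult_cnj_integrable sq_integrable_nth assms)

lemma weak_gradient_cong_AE:
  assumes "sq_integrable u" "sq_integrable v" "AE x in lborel. u x = v x"
  shows "weak_gradient u = weak_gradient v"
proof -
  have "(LINT x|lborel. u x * complex_of_real (partial_deriv i \<phi> x)) =
      (LINT x|lborel. v x * complex_of_real (partial_deriv i \<phi> x))" if "test_function \<phi>" for \<phi> i
  proof (rule integral_cong_AE)
    show "AE x in lborel. u x * complex_of_real (partial_deriv i \<phi> x) = v x * complex_of_real (partial_deriv i \<phi> x)"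
      using assms(3) by eventually_elim simp
  qed (intro borel_measurable_integrable test_mult_integrable test_function_partial_deriv that assms)+
  then show ?thesis by (auto simp: weak_gradient_def fun_eq_iff)
qed

lemma weak_gradient_unique:
  assumes "weak_gradient u g" "weak_gradient u h" "sq_integrable g" "sq_integrable h"
  shows "AE x in lborel. g x = h x"
proof -
  have "AE x in lborel. g x $ i + (-1) * h x $ i = 0" for i
  proof (rule fundamental_lemma)
    show "sq_integrable (\<lambda>x. g x $ i + (-1) * h x $ i)"
      by (intro sq_integrable_add sq_integrable_scaleC sq_integrable_nth assms)
    fix \<phi> :: "real^'a \<Rightarrow> real" assume t: "test_function \<phi>"
    have "(LINT x|lborel. (g x $ i + (-1) * h x $ i) * complex_of_real (\<phi> x)) =
      (LINT x|lborel. g x $ i * complex_of_real (\<phi> x)) - (LINT x|lborel. h x $ i * complex_of_real (\<phi> x))"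
      using Bochner_Integration.integral_diff[OF test_mult_integrable[OF sq_integrable_nth[OF assms(3)] t] 
          test_mult_integrable[OF sq_integrable_nth[OF assms(4)] t], of i i]
      by (simp add: algebra_simps)
    also have "\<dots> = 0"
      using assms(1)[unfolded weak_gradient_def, rule_format, OF t, of i]
        assms(2)[unfolded weak_gradient_def, rule_format, OF t, of i] by simp
    finally show "(LINT x|lborel. (g x $ i + (-1) * h x $ i) * complex_of_real (\<phi> x)) = 0" .
  qed
  then have "AE x in lborel. \<forall>i\<in>UNIV. g x $ i + (-1) * h x $ i = 0"
    by (intro AE_finite_allI) simp_all
  then show ?thesis by eventually_elim (simp add: vec_eq_iff)
qed

lemma weak_gradient_add:
  assumes "weak_gradient u g" "weak_gradient v h"
    "sq_integrable u" "sq_integrable v" "sq_integrable g" "sq_integrable h"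
  shows "weak_gradient (\<lambda>x. u x + v x) (\<lambda>x. g x + h x)"
  unfolding weak_gradient_def
proof (intro allI impI)
  fix \<phi> :: "real^'a \<Rightarrow> real" and i assume t: "test_function \<phi>"
  note t' = test_function_partial_deriv[OF t, of i]
  have "(LINT x|lborel. (u x + v x) * complex_of_real (partial_deriv i \<phi> x)) =
     (LINT x|lborel. u x * complex_of_real (partial_deriv i \<phi> x)) + (LINT x|lborel. v x * complex_of_real (partial_deriv i \<phi> x))"
    unfolding distrib_right
    by (rule Bochner_Integration.integral_add) (intro test_mult_integrable assms t')+
  moreover have "(LINT x|lborel. (g x + h x) $ i * complex_of_real (\<phi> x)) =
     (LINT x|lborel. g x $ i * complex_of_real (\<phi> x)) + (LINT x|lborel. h x $ i * complex_of_real (\<phi> x))"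
    unfolding vector_add_component distrib_right
    by (rule Bochner_Integration.integral_add) (intro test_mult_integrable sq_integrable_nth assms t)+
  ultimately show "(LINT x|lborel. (u x + v x) * complex_of_real (partial_deriv i \<phi> x)) =
      - (LINT x|lborel. (g x + h x) $ i * complex_of_real (\<phi> x))"
    using assms(1,2) t by (simp add: weak_gradient_def)
qed

lemma weak_gradient_scaleC:
  assumes "weak_gradient u g"
  shows "weak_gradient (\<lambda>x. c * u x) (\<lambda>x. c *s g x)"
  using assms by (simp add: weak_gradient_def mult.assoc)

lemma grad_fun:
  assumes "H1_fun u" shows "sq_integrable (grad_fun u)" "weak_gradient u (grad_fun u)"
  using someI_ex[of "\<lambda>g. sq_integrable g \<and> weak_gradient u g"] assms
  by (auto simp: H1_fun_def grad_fun_def)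

lemma H1_fun_sq: "H1_fun u \<Longrightarrow> sq_integrable u"
  by (simp add: H1_fun_def)

lemma grad_fun_unique:
  assumes "H1_fun u" "sq_integrable g" "weak_gradient u g"
  shows "AE x in lborel. grad_fun u x = g x"
  using weak_gradient_unique grad_fun assms by blast

lemma H1_funI: "sq_integrable u \<Longrightarrow> sq_integrable g \<Longrightarrow> weak_gradient u g \<Longrightarrow> H1_fun u"
  by (auto simp: H1_fun_def)

lemma H1_fun_add: assumes "H1_fun u" "H1_fun v" shows "H1_fun (\<lambda>x. u x + v x)"
  using assms
  by (intro H1_funI[OF sq_integrable_add sq_integrable_add weak_gradient_add,
        where g1="grad_fun u" and h1="grad_fun v"]) (simp_all add: grad_fun H1_fun_sq)

lemma H1_fun_scaleC: assumes "H1_fun u" shows "H1_fun (\<lambda>x. c * u x)"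
  using assms
  by (intro H1_funI[OF sq_integrable_scaleC sq_integrable_vec_scaleC weak_gradient_scaleC,
        where g1="grad_fun u"]) (simp_all add: grad_fun H1_fun_sq)

lemma H1_fun_0: "H1_fun (\<lambda>x. 0)"
proof -
  have "weak_gradient (\<lambda>x. 0) (\<lambda>x. 0 :: complex^'a)" by (simp add: weak_gradient_def)
  moreover have "sq_integrable (\<lambda>x::real^'a. 0::complex)" "sq_integrable (\<lambda>x::real^'a. 0::complex^'a)"
    by (simp_all add: sq_integrable_def)
  ultimately show ?thesis unfolding H1_fun_def by blast
qed

lemma grad_fun_add:
  assumes "H1_fun u" "H1_fun v"
  shows "AE x in lborel. grad_fun (\<lambda>x. u x + v x) x = grad_fun u x + grad_fun v x"
  by (rule grad_fun_unique[OF H1_fun_add sq_integrable_add weak_gradient_add])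
    (intro grad_fun assms H1_fun_sq)+

lemma grad_fun_scaleC:
  assumes "H1_fun u"
  shows "AE x in lborel. grad_fun (\<lambda>x. c * u x) x = c *s grad_fun u x"
  by (rule grad_fun_unique[OF H1_fun_scaleC sq_integrable_vec_scaleC weak_gradient_scaleC])
    (intro grad_fun assms)+

lemma grad_fun_cong_AE:
  assumes "H1_fun u" "H1_fun v" "AE x in lborel. u x = v x"
  shows "grad_fun u = grad_fun v"
  unfolding grad_fun_def weak_gradient_cong_AE[OF H1_fun_sq[OF assms(1)] H1_fun_sq[OF assms(2)] assms(3)] ..

lemma cinner_fun_cong_AE:
  assumes "H1_fun u" "H1_fun v" "AE x in lborel. u x = v x"
    "H1_fun u'" "H1_fun v'" "AE x in lborel. u' x = v' x"
  shows "H1_cinner_fun u u' = H1_cinner_fun v v'"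
proof -
  have "(LINT x|lborel. u x * cnj (u' x)) = (LINT x|lborel. v x * cnj (v' x))"
  proof (rule integral_cong_AE)
    show "AE x in lborel. u x * cnj (u' x) = v x * cnj (v' x)"
      using assms(3,6) by eventually_elim simp
  qed (intro borel_measurable_integrable mult_cnj_integrable assms(1,2,4,5)[THEN H1_fun_sq])+
  then show ?thesis
    by (simp add: H1_cinner_fun_def grad_fun_cong_AE[OF assms(1-3)] grad_fun_cong_AE[OF assms(4-6)])
qed

lemma cinner_fun_add:
  assumes "H1_fun u" "H1_fun v" "H1_fun w"
  shows "H1_cinner_fun (\<lambda>x. u x + v x) w = H1_cinner_fun u w + H1_cinner_fun v w"
proof -
  note sq = H1_fun_sq[OF assms(1)] H1_fun_sq[OF assms(2)] H1_fun_sq[OF assms(3)]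
  note gr = grad_fun(1)[OF assms(1)] grad_fun(1)[OF assms(2)] grad_fun(1)[OF assms(3)]
  have 1: "(LINT x|lborel. (u x + v x) * cnj (w x)) = (LINT x|lborel. u x * cnj (w x)) + (LINT x|lborel. v x * cnj (w x))"
    unfolding distrib_right by (intro Bochner_Integration.integral_add mult_cnj_integrable sq)
  have "(LINT x|lborel. cdot (grad_fun (\<lambda>x. u x + v x) x) (grad_fun w x)) =
        (LINT x|lborel. cdot (grad_fun u x) (grad_fun w x) + cdot (grad_fun v x) (grad_fun w x))"
  proof (rule integral_cong_AE)
    show "AE x in lborel. cdot (grad_fun (\<lambda>x. u x + v x) x) (grad_fun w x) =
         cdot (grad_fun u x) (grad_fun w x) + cdot (grad_fun v x) (grad_fun w x)"
      using grad_fun_add[OF assms(1,2)] by eventually_elim (simp add: cdot_def distrib_right sum.distrib)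
    show "(\<lambda>x. cdot (grad_fun (\<lambda>x. u x + v x) x) (grad_fun w x)) \<in> borel_measurable lborel"
      by (intro borel_measurable_integrable cdot_integrable grad_fun H1_fun_add assms)
    show "(\<lambda>x. cdot (grad_fun u x) (grad_fun w x) + cdot (grad_fun v x) (grad_fun w x)) \<in> borel_measurable lborel"
      by (intro borel_measurable_integrable Bochner_Integration.integrable_add cdot_integrable gr)
  qed
  also have "\<dots> = (LINT x|lborel. cdot (grad_fun u x) (grad_fun w x)) + (LINT x|lborel. cdot (grad_fun v x) (grad_fun w x))"
    by (intro Bochner_Integration.integral_add cdot_integrable gr)
  finally show ?thesis using 1 by (simp add: H1_cinner_fun_def)
qed

lemma cinner_fun_scaleC:
  assumes "H1_fun u" "H1_fun w"
  shows "H1_cinner_fun (\<lambda>x. c * u x) w = c * H1_cinner_fun u w"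
proof -
  note gr = grad_fun(1)[OF assms(1)] grad_fun(1)[OF assms(2)]
  have "(LINT x|lborel. cdot (grad_fun (\<lambda>x. c * u x) x) (grad_fun w x)) =
        (LINT x|lborel. c * cdot (grad_fun u x) (grad_fun w x))"
  proof (rule integral_cong_AE)
    show "AE x in lborel. cdot (grad_fun (\<lambda>x. c * u x) x) (grad_fun w x) = c * cdot (grad_fun u x) (grad_fun w x)"
      using grad_fun_scaleC[OF assms(1), of c]
      by eventually_elim (simp add: cdot_def sum_distrib_left mult.assoc)
    show "(\<lambda>x. cdot (grad_fun (\<lambda>x. c * u x) x) (grad_fun w x)) \<in> borel_measurable lborel"
      by (intro borel_measurable_integrable cdot_integrable grad_fun H1_fun_scaleC assms)
    show "(\<lambda>x. c * cdot (grad_fun u x) (grad_fun w x)) \<in> borel_measurable lborel"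
      by (intro borel_measurable_integrable integrable_mult_right cdot_integrable gr)
  qed
  then show ?thesis by (simp add: H1_cinner_fun_def mult.assoc distrib_left)
qed

lemma cinner_fun_commute: "H1_cinner_fun v u = cnj (H1_cinner_fun u v)"
  by (simp add: H1_cinner_fun_def cdot_def mult.commute flip: Bochner_Integration.integral_cnj)

lemma cdot_self: "cdot v v = complex_of_real ((norm v)\<^sup>2)"
  by (simp add: cdot_def norm_vec_def L2_set_def sum_nonneg complex_norm_square[symmetric])

lemma cinner_fun_self:
  "H1_cinner_fun u u = complex_of_real ((LINT x|lborel. (norm (u x))\<^sup>2) + (LINT x|lborel. (norm (grad_fun u x))\<^sup>2))"
  unfolding H1_cinner_fun_def cdot_self complex_norm_square[symmetric] integral_complex_of_real
  by simp

definition h1_rel :: "(real^'n \<Rightarrow> complex) \<Rightarrow> (real^'n \<Rightarrow> complex) \<Rightarrow> bool" where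
  "h1_rel u v \<longleftrightarrow> H1_fun u \<and> H1_fun v \<and> (AE x in lborel. u x = v x)"

lemma part_equivp_h1_rel: "part_equivp h1_rel"
proof (rule part_equivpI)
  show "\<exists>u. h1_rel u u" using H1_fun_0 by (auto simp: h1_rel_def)
  show "symp h1_rel" by (rule sympI) (auto simp: h1_rel_def eq_commute)
  show "transp h1_rel"
    by (rule transpI) (auto simp: h1_rel_def)
qed

text \<open>
  Elements are classes, modulo equality almost everywhere, of square-integrable functions with
  square-integrable weak gradient. HOL-Analysis has real inner product spaces only, so the type
  is made an instance of \<open>real_inner\<close> with the real part of the complex inner product
  \<open>h1_cinner\<close> (linear in the first argument); both induce the same norm and topology.
\<close>

quotient_type 'n h1 = "real^'n \<Rightarrow> complex" / partial: h1_rel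
  by (rule part_equivp_h1_rel)

instantiation h1 :: (finite) real_inner
begin

lift_definition zero_h1 :: "'a h1" is "\<lambda>x. 0"
  by (simp add: h1_rel_def H1_fun_0)

lift_definition plus_h1 :: "'a h1 \<Rightarrow> 'a h1 \<Rightarrow> 'a h1" is "\<lambda>u v x. u x + v x"
  by (auto simp: h1_rel_def intro!: H1_fun_add)

lift_definition scaleR_h1 :: "real \<Rightarrow> 'a h1 \<Rightarrow> 'a h1" is "\<lambda>r u x. complex_of_real r * u x"
  by (auto simp: h1_rel_def intro!: H1_fun_scaleC)

definition uminus_h1 :: "'a h1 \<Rightarrow> 'a h1" where "uminus_h1 u = (-1) *\<^sub>R u"

definition minus_h1 :: "'a h1 \<Rightarrow> 'a h1 \<Rightarrow> 'a h1" where "minus_h1 u v = u + (- v)"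

lift_definition h1_cinner :: "'a h1 \<Rightarrow> 'a h1 \<Rightarrow> complex" is H1_cinner_fun
  by (auto simp: h1_rel_def intro: cinner_fun_cong_AE)

definition inner_h1 :: "'a h1 \<Rightarrow> 'a h1 \<Rightarrow> real" where "inner_h1 u v = Re (h1_cinner u v)"

definition norm_h1 :: "'a h1 \<Rightarrow> real" where "norm_h1 u = sqrt (inner u u)"

definition dist_h1 :: "'a h1 \<Rightarrow> 'a h1 \<Rightarrow> real" where "dist_h1 u v = norm (u - v)"

definition sgn_h1 :: "'a h1 \<Rightarrow> 'a h1" where "sgn_h1 u = inverse (norm u) *\<^sub>R u"

definition uniformity_h1 :: "('a h1 \<times> 'a h1) filter" where
  "uniformity_h1 = (INF e\<in>{0<..}. principal {(u :: 'a h1, v). dist u v < e})"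

definition open_h1 :: "'a h1 set \<Rightarrow> bool" where
  "open_h1 U \<longleftrightarrow> (\<forall>u\<in>U. eventually (\<lambda>(u', v). u' = u \<longrightarrow> v \<in> U) uniformity)"

instance
proof
  fix u v w :: "'a h1" and r q :: real
  show add: "u + v + w = u + (v + w)"
    by transfer (auto simp: h1_rel_def add.assoc intro!: H1_fun_add)
  show "u + v = v + u"
    by transfer (auto simp: h1_rel_def add.commute intro!: H1_fun_add)
  show "0 + u = u" by transfer (auto simp: h1_rel_def)
  show "- u + u = 0"
    unfolding uminus_h1_def
    by transfer (auto simp: h1_rel_def H1_fun_0 intro!: H1_fun_add H1_fun_scaleC[of _ "-1", simplified])
  show "u - v = u + - v" by (rule minus_h1_def)
  show "r *\<^sub>R (u + v) = r *\<^sub>R u + r *\<^sub>R v"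
    by transfer (auto simp: h1_rel_def distrib_left intro!: H1_fun_add H1_fun_scaleC)
  show "(r + q) *\<^sub>R u = r *\<^sub>R u + q *\<^sub>R u"
    by transfer (auto simp: h1_rel_def distrib_right intro!: H1_fun_add H1_fun_scaleC)
  show "r *\<^sub>R q *\<^sub>R u = (r * q) *\<^sub>R u"
    by transfer (auto simp: h1_rel_def mult.assoc intro!: H1_fun_scaleC)
  show "1 *\<^sub>R u = u" by transfer (auto simp: h1_rel_def)
  show "dist u v = norm (u - v)" by (rule dist_h1_def)
  show "sgn u = inverse (norm u) *\<^sub>R u" by (rule sgn_h1_def)
  show "(uniformity :: ('a h1 \<times> 'a h1) filter) = (INF e\<in>{0<..}. principal {(u, v). dist u v < e})"
    by (rule uniformity_h1_def)
  show "open U \<longleftrightarrow> (\<forall>u\<in>U. eventually (\<lambda>(u', v). u' = u \<longrightarrow> v \<in> U) uniformity)" for U :: "'a h1 set"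
    by (rule open_h1_def)
  show "inner u v = inner v u"
    unfolding inner_h1_def by transfer (subst cinner_fun_commute, simp)
  show "inner (u + v) w = inner u w + inner v w"
    unfolding inner_h1_def by transfer (auto simp: h1_rel_def cinner_fun_add)
  show "inner (r *\<^sub>R u) v = r * inner u v"
    unfolding inner_h1_def by transfer (auto simp: h1_rel_def cinner_fun_scaleC)
  show "0 \<le> inner u u"
    unfolding inner_h1_def by transfer (simp add: cinner_fun_self)
  show "inner u u = 0 \<longleftrightarrow> u = 0"
    unfolding inner_h1_def
  proof transfer
    fix u :: "real^'a \<Rightarrow> complex" assume "h1_rel u u"
    then have u: "H1_fun u" by (simp add: h1_rel_def)
    have i: "integrable lborel (\<lambda>x. (norm (u x))\<^sup>2)" using H1_fun_sq[OF u] by (simp add: sq_integrable_def)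
    have "H1_cinner_fun (\<lambda>x::real^'a. 0) (\<lambda>x. 0) = 0"
      using cinner_fun_scaleC[OF u, of "\<lambda>x. 0" 0] by (simp add: H1_fun_0)
    moreover have "AE x in lborel. u x = 0" if "Re (H1_cinner_fun u u) = 0"
    proof -
      have "(LINT x|lborel. (norm (u x))\<^sup>2) + (LINT x|lborel. (norm (grad_fun u x))\<^sup>2) = 0"
        using that by (simp add: cinner_fun_self)
      moreover have "(LINT x|lborel. (norm (u x))\<^sup>2) \<ge> 0" "(LINT x|lborel. (norm (grad_fun u x))\<^sup>2) \<ge> 0" by simp_all
      ultimately have "(LINT x|lborel. (norm (u x))\<^sup>2) = 0" by linarith
      then show ?thesis using integral_nonneg_eq_0_iff_AE[OF i] by simp
    qed
    ultimately show "(Re (H1_cinner_fun u u) = 0) = h1_rel u (\<lambda>x. 0)"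
      using u H1_fun_0 cinner_fun_cong_AE[of u "\<lambda>x. 0" u "\<lambda>x. 0"] by (auto simp: h1_rel_def)
  qed
  show "norm u = sqrt (inner u u)" by (rule norm_h1_def)
qed

end

lift_definition h1_scaleC :: "complex \<Rightarrow> 'n::finite h1 \<Rightarrow> 'n h1" is "\<lambda>c u x. c * u x"
  by (auto simp: h1_rel_def intro!: H1_fun_scaleC)

global_interpretation complex_h1: vector_space "h1_scaleC :: complex \<Rightarrow> 'n::finite h1 \<Rightarrow> 'n h1"
proof
  fix a b :: complex and u v :: "'n h1"
  show "h1_scaleC a (u + v) = h1_scaleC a u + h1_scaleC a v"
    by transfer (auto simp: h1_rel_def distrib_left intro!: H1_fun_add H1_fun_scaleC)
  show "h1_scaleC (a + b) u = h1_scaleC a u + h1_scaleC b u"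
    by transfer (auto simp: h1_rel_def distrib_right intro!: H1_fun_add H1_fun_scaleC)
  show "h1_scaleC a (h1_scaleC b u) = h1_scaleC (a * b) u"
    by transfer (auto simp: h1_rel_def mult.assoc intro!: H1_fun_scaleC)
  show "h1_scaleC 1 u = u" by transfer (auto simp: h1_rel_def)
qed

lemma h1_scaleC_of_real: "h1_scaleC (complex_of_real r) u = r *\<^sub>R u"
  by transfer (auto simp: h1_rel_def intro!: H1_fun_scaleC)

lemma h1_cinner_add_left: "h1_cinner (u + v) w = h1_cinner u w + h1_cinner v w"
  by transfer (auto simp: h1_rel_def cinner_fun_add)

lemma h1_cinner_scaleC_left: "h1_cinner (h1_scaleC c u) w = c * h1_cinner u w"
  by transfer (auto simp: h1_rel_def cinner_fun_scaleC)

lemma h1_cinner_commute: "h1_cinner v u = cnj (h1_cinner u v)"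
  by transfer (rule cinner_fun_commute)

lemma h1_cinner_self: "h1_cinner u u = complex_of_real ((norm u)\<^sup>2)"
proof -
  have "Im (h1_cinner u u) = 0" by transfer (simp add: cinner_fun_self)
  moreover have "Re (h1_cinner u u) = (norm u)\<^sup>2"
    by (simp add: norm_h1_def inner_h1_def[symmetric] del: norm_eq_sqrt_inner[symmetric])
  ultimately show ?thesis by (simp add: complex_eq_iff)
qed

definition bounded_clinear :: "('n::finite h1 \<Rightarrow> 'n h1) \<Rightarrow> bool" where
  "bounded_clinear T \<longleftrightarrow> bounded_linear T \<and> (\<forall>c u. T (h1_scaleC c u) = h1_scaleC c (T u))"

text \<open>Dimension and codimension are taken over the complex numbers.\<close>

definition fredholm :: "('n::finite h1 \<Rightarrow> 'n h1) \<Rightarrow> bool" where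
  "fredholm T \<longleftrightarrow> bounded_clinear T
     \<and> (\<exists>B. finite B \<and> {u. T u = 0} \<subseteq> complex_h1.span B)
     \<and> closed (range T)
     \<and> (\<exists>B. finite B \<and> complex_h1.span (range T \<union> B) = UNIV)"

definition is_riesz_rep :: "('n::finite h1 \<Rightarrow> 'n h1 \<Rightarrow> complex) \<Rightarrow> ('n h1 \<Rightarrow> 'n h1) \<Rightarrow> bool" where
  "is_riesz_rep a T \<longleftrightarrow> bounded_clinear T \<and> (\<forall>u v. h1_cinner (T u) v = a u v)"

definition riesz_rep :: "('n::finite h1 \<Rightarrow> 'n h1 \<Rightarrow> complex) \<Rightarrow> 'n h1 \<Rightarrow> 'n h1" where
  "riesz_rep a = (THE T. is_riesz_rep a T)"

lemma riesz_rep_eqI: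
  assumes "is_riesz_rep a T" shows "riesz_rep a = T"
  unfolding riesz_rep_def
proof (rule the_equality)
  show "is_riesz_rep a T" by fact
next
  fix S assume S: "is_riesz_rep a S"
  show "S = T"
  proof
    fix u
    have "h1_cinner (S u - T u) (S u - T u) = 0"
    proof -
      have "h1_cinner (S u) v = h1_cinner ((S u - T u) + T u) v" for v by simp
      then have "h1_cinner (S u) v = h1_cinner (S u - T u) v + h1_cinner (T u) v" for v
        unfolding h1_cinner_add_left .
      then show ?thesis using S assms by (simp add: is_riesz_rep_def)
    qed
    then have "inner (S u - T u) (S u - T u) = 0" by (simp add: inner_h1_def)
    then show "S u = T u" by simp
  qed
qed

definition h1_grad :: "'n::finite h1 \<Rightarrow> real^'n \<Rightarrow> complex^'n" where
  "h1_grad u = grad_fun (rep_h1 u)"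

section \<open>The sesquilinear form of the perfectly matched layer\<close>

text \<open>
  The absorption parameter is an actual function on the positive half-line (its values at
  nonpositive arguments are irrelevant), not a class modulo null sets.
\<close>

definition L_infinity_pos :: "(real \<Rightarrow> real) \<Rightarrow> bool" where
  "L_infinity_pos \<sigma> \<longleftrightarrow> set_borel_measurable lborel {0<..} \<sigma> \<and>
     (\<exists>C. AE r in lborel. 0 < r \<longrightarrow> \<bar>\<sigma> r\<bar> \<le> C)"

definition sigma_tilde :: "real \<Rightarrow> (real \<Rightarrow> real) \<Rightarrow> real \<Rightarrow> real" where
  "sigma_tilde R \<sigma> r = (if R < r then (LBINT t:{R..r}. \<sigma> t) / r else 0)"

definition d_sigma :: "(real \<Rightarrow> real) \<Rightarrow> complex \<Rightarrow> real^2 \<Rightarrow> complex" where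
  "d_sigma \<sigma> s x = 1 + complex_of_real (\<sigma> (norm x)) / s"

definition d_tilde_sigma :: "real \<Rightarrow> (real \<Rightarrow> real) \<Rightarrow> complex \<Rightarrow> real^2 \<Rightarrow> complex" where
  "d_tilde_sigma R \<sigma> s x = 1 + complex_of_real (sigma_tilde R \<sigma> (norm x)) / s"

definition orth_proj :: "(real^'n) set \<Rightarrow> real^'n^'n" where
  "orth_proj S = matrix (\<lambda>y. THE p. p \<in> S \<and> y - p \<in> S\<^sup>\<bottom>)"

definition Pi_par :: "real^2 \<Rightarrow> real^2^2" where
  "Pi_par x = orth_proj (span {x})"

definition Pi_perp :: "real^2 \<Rightarrow> real^2^2" where
  "Pi_perp x = orth_proj ((span {x})\<^sup>\<bottom>)"

definition cmatrix :: "real^'n^'m \<Rightarrow> complex^'n^'m" where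
  "cmatrix M = (\<chi> i j. complex_of_real (M $ i $ j))"

definition cscale :: "complex \<Rightarrow> complex^'n^'m \<Rightarrow> complex^'n^'m" where
  "cscale c M = (\<chi> i j. c * M $ i $ j)"

definition J_sigma :: "real \<Rightarrow> (real \<Rightarrow> real) \<Rightarrow> complex \<Rightarrow> real^2 \<Rightarrow> complex^2^2" where
  "J_sigma R \<sigma> s x =
     cscale (d_sigma \<sigma> s x) (cmatrix (Pi_par x)) + cscale (d_tilde_sigma R \<sigma> s x) (cmatrix (Pi_perp x))"

definition A_sigma :: "real^2^2 \<Rightarrow> real \<Rightarrow> (real \<Rightarrow> real) \<Rightarrow> complex \<Rightarrow> real^2 \<Rightarrow> complex^2^2" where
  "A_sigma A R \<sigma> s x = (let J = J_sigma R \<sigma> s x in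
     cscale (det J) (matrix_inv J ** cmatrix A ** transpose (matrix_inv J)))"

text \<open>
  The coefficients are meaningful when \<open>s\<close>, \<open>d_sigma\<close> and \<open>d_tilde_sigma\<close> are nonzero, in
  particular whenever \<open>Re s > 0\<close>. If \<open>A\<close> is a multiple of the identity, the form is elliptic for
  all these \<open>s\<close>; only for distinct eigenvalues can ellipticity be lost.
\<close>

definition pml_form :: "real^2^2 \<Rightarrow> real \<Rightarrow> (real \<Rightarrow> real) \<Rightarrow> complex \<Rightarrow> 2 h1 \<Rightarrow> 2 h1 \<Rightarrow> complex" where
  "pml_form A R \<sigma> s u v =
     (LINT x|lborel. cdot (A_sigma A R \<sigma> s x *v h1_grad u x) (h1_grad v x)) +
     s\<^sup>2 * (LINT x|lborel. d_tilde_sigma R \<sigma> s x * d_sigma \<sigma> s x * rep_h1 u x * cnj (rep_h1 v x))"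

definition pml_op :: "real^2^2 \<Rightarrow> real \<Rightarrow> (real \<Rightarrow> real) \<Rightarrow> complex \<Rightarrow> 2 h1 \<Rightarrow> 2 h1" where
  "pml_op A R \<sigma> s = riesz_rep (pml_form A R \<sigma> s)"

definition essential_spectrum_Cplus :: "(complex \<Rightarrow> 'n::finite h1 \<Rightarrow> 'n h1) \<Rightarrow> complex set" where
  "essential_spectrum_Cplus \<A> = {s. Re s > 0 \<and> \<not> fredholm (\<A> s)}"

end

theory Submission
  imports Defs
begin


text \<open>
  At a point \<open>x\<close> of the layer, let \<open>e\<close> be the radial and \<open>f\<close> the tangential unit vector and write
  \<open>\<alpha> = e \<bullet> A e\<close>, \<open>\<beta> = e \<bullet> A f\<close>, \<open>\<gamma> = f \<bullet> A f\<close>. In this basis the coefficient matrix of the layer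
  is \<open>[[q \<alpha>, \<beta>], [\<beta>, \<gamma> / q]]\<close> with \<open>q = d_tilde_sigma / d_sigma\<close>. On the real vector \<open>t e + f\<close> its
  quadratic form is \<open>(\<alpha> (q t)\<^sup>2 + 2 \<beta> (q t) + \<gamma>) / q\<close>, which vanishes exactly if \<open>q t\<close> is one of the two
  roots \<open>(- \<beta> \<plusminus> \<i> sqrt (det A)) / \<alpha>\<close>. Such a \<open>t\<close> exists if \<open>q\<close> has the argument of a root. The
  eigenvalues of \<open>A\<close> being distinct, \<open>\<beta>\<close> does not vanish halfway between two orthogonal eigenvectors
  of \<open>A\<close>. Orienting \<open>f\<close> so that \<open>\<beta>\<close> is negative there, one root lies in the open first quadrant.

  The number \<open>q\<close> is \<open>(s + sigma_tilde) / (s + sigma)\<close>. As \<open>s\<close> runs through the right half-plane, \<open>q\<close>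
  runs through the disc with diameter from \<open>\<tau> = sigma_tilde / sigma\<close> to \<open>1\<close>. Since \<open>\<sigma>\<close> is
  non-decreasing, \<open>\<tau> \<le> (r - R) / r\<close>, which is small just behind the start of the layer. For small
  \<open>\<tau>\<close> the disc meets a given ray of the open right half-plane, so that some \<open>s\<close> and some point of
  the layer produce a real null vector of the quadratic form (\<open>complex_stretching_ratio\<close>,
  \<open>pml_matrix_null_direction\<close>).

  A single such point already excludes the Fredholm property
  (\<open>nonelliptic_point_not_fredholm\<close>, for any second-order form with bounded coefficients that are
  continuous at the point). If \<open>\<xi>\<close> is the null vector, the form applied to any \<open>g\<close> and to a wave
  packet \<open>w = \<eta> x * cos (k * (\<xi> \<bullet> x) + b)\<close> is small compared to \<open>norm g * norm w\<close>: freezing the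
  coefficients costs little near the point, the quadratic terms in \<open>k\<close> cancel by the choice of \<open>\<xi>\<close>,
  and what is left stays bounded, whereas the norm of \<open>w\<close> grows with \<open>k\<close>
  (\<open>wave_packet_form_bound\<close>, \<open>wave_packet_norm_unbounded\<close>, \<open>quasimode_exists\<close>). Wave packets in
  disjoint boxes that shrink to the point, normalized, form an orthonormal sequence \<open>e n\<close> in which
  the coordinates of every element of the range of the operator are of order \<open>(1/4) ^ n\<close>. The series
  with coordinates \<open>(1/2) ^ n\<close> along infinitely many disjoint subsequences are then linearly
  independent modulo the range, and the codimension of the range is infinite
  (\<open>not_fredholm_of_orthonormal_decay\<close>).

  That the form has a representing operator is the Riesz representation theorem, which rests on
  the completeness of H1 and hence of L2 (\<open>L2_complete\<close>, \<open>h1_complete\<close>).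
\<close>

section \<open>Square-integrable functions\<close>

definition L2norm :: "(real^'n \<Rightarrow> 'b::real_normed_vector) \<Rightarrow> real" where
  "L2norm u = sqrt (LINT x|lborel. (norm (u x))\<^sup>2)"

lemma L2norm_nonneg: "0 \<le> L2norm u"
  by (simp add: L2norm_def)

lemma L2norm_power2: "(L2norm u)\<^sup>2 = (LINT x|lborel. (norm (u x))\<^sup>2)"
  by (simp add: L2norm_def)

lemma sq_integrable_norm_mult:
  fixes u :: "real^'n \<Rightarrow> 'b::{real_normed_vector}"
    and v :: "real^'n \<Rightarrow> 'c::{real_normed_vector}"
  assumes "sq_integrable u" "sq_integrable v"
  shows "integrable lborel (\<lambda>x. norm (u x) * norm (v x))"
proof (rule Bochner_Integration.integrable_bound)
  have [measurable]: "u \<in> borel_measurable lborel" "v \<in> borel_measurable lborel"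
    using assms by (auto simp: sq_integrable_def)
  show "integrable lborel (\<lambda>x. (norm (u x))\<^sup>2 + (norm (v x))\<^sup>2)"
    using assms by (simp add: sq_integrable_def)
  show "(\<lambda>x. norm (u x) * norm (v x)) \<in> borel_measurable lborel" by measurable
  have "norm (u x) * norm (v x) \<le> (norm (u x))\<^sup>2 + (norm (v x))\<^sup>2" for x
    using sum_squares_bound[of "norm (u x)" "norm (v x)"] mult_nonneg_nonneg[of "norm (u x)" "norm (v x)"]
    by (simp del: mult_nonneg_nonneg)
  then show "AE x in lborel. norm (norm (u x) * norm (v x)) \<le> norm ((norm (u x))\<^sup>2 + (norm (v x))\<^sup>2)"
    by simp
qed

lemma L2_Cauchy_Schwarz:
  fixes u :: "real^'n \<Rightarrow> 'b::{real_normed_vector}"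
    and v :: "real^'n \<Rightarrow> 'c::{real_normed_vector}"
  assumes "sq_integrable u" "sq_integrable v"
  shows "(LINT x|lborel. norm (u x) * norm (v x)) \<le> L2norm u * L2norm v"
proof -
  define a b c where "a = (LINT x|lborel. (norm (u x))\<^sup>2)" "b = (LINT x|lborel. (norm (v x))\<^sup>2)"
    "c = (LINT x|lborel. norm (u x) * norm (v x))"
  note abc = a_b_c_def
  have iu: "integrable lborel (\<lambda>x. (norm (u x))\<^sup>2)" and iv: "integrable lborel (\<lambda>x. (norm (v x))\<^sup>2)"
    using assms by (auto simp: sq_integrable_def)
  have nn: "0 \<le> a" "0 \<le> b" "0 \<le> c" by (simp_all add: abc)
  have q: "0 \<le> a - 2 * t * c + t\<^sup>2 * b" for t
  proof -
    have "0 \<le> (LINT x|lborel. (norm (u x) - t * norm (v x))\<^sup>2)" by simp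
    also have "(\<lambda>x. (norm (u x) - t * norm (v x))\<^sup>2) =
      (\<lambda>x. (norm (u x))\<^sup>2 - 2 * t * (norm (u x) * norm (v x)) + t\<^sup>2 * (norm (v x))\<^sup>2)"
      by (auto simp: power2_eq_square algebra_simps)
    also have "(LINT x|lborel. (norm (u x))\<^sup>2 - 2 * t * (norm (u x) * norm (v x)) + t\<^sup>2 * (norm (v x))\<^sup>2)
       = a - 2 * t * c + t\<^sup>2 * b"
      using iu iv sq_integrable_norm_mult[OF assms] by (simp add: abc)
    finally show ?thesis .
  qed
  have "c\<^sup>2 \<le> a * b"
  proof (cases "b = 0")
    case True
    have "c = 0"
    proof (rule ccontr)
      assume "c \<noteq> 0"
      then show False using q[of "(a + 1) / (2 * c)"] True by simp
    qed
    then show ?thesis using nn by simp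
  next
    case False
    then have "b > 0" using nn by simp
    then show ?thesis using q[of "c / b"] by (simp add: field_simps power2_eq_square)
  qed
  then have "c \<le> sqrt (a * b)" using real_le_rsqrt by blast
  then show ?thesis by (simp add: abc L2norm_def real_sqrt_mult)
qed

lemma sq_integrable_diff:
  fixes u v :: "real^'n \<Rightarrow> 'b::{real_normed_vector, second_countable_topology}"
  assumes "sq_integrable u" "sq_integrable v"
  shows "sq_integrable (\<lambda>x. u x - v x)"
proof -
  have "sq_integrable (\<lambda>x. - v x)"
    by (rule sq_integrable_dominated[OF assms(2), where C=1]) (use assms in \<open>auto simp: sq_integrable_def\<close>)
  from sq_integrable_add[OF assms(1) this] show ?thesis by simp
qed

lemma L2norm_mono:
  assumes "sq_integrable v" "u \<in> borel_measurable lborel" "\<And>x. norm (u x) \<le> norm (v x)"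
  shows "L2norm u \<le> L2norm v"
proof -
  have "sq_integrable u" by (rule sq_integrable_dominated[OF assms(1,2), where C=1]) (use assms(3) in simp)
  then show ?thesis
    unfolding L2norm_def using assms
    by (intro real_sqrt_le_mono integral_mono) (auto simp: sq_integrable_def intro: power_mono)
qed

text \<open>
  The weighted series of the squared increments, with weights \<open>4 ^ n\<close>, has a finite integral. At
  almost every point it is therefore finite, which bounds the increments there by a geometric
  series.
\<close>

lemma rapidly_L2_Cauchy_imp_AE_convergent:
  fixes f :: "nat \<Rightarrow> real^'n \<Rightarrow> 'b::{banach, second_countable_topology}"
  assumes sq: "\<And>n. sq_integrable (f n)"
    and fast: "\<And>n. (LINT x|lborel. (norm (f (Suc n) x - f n x))\<^sup>2) \<le> (1/16) ^ n"
  shows "AE x in lborel. convergent (\<lambda>n. f n x)"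
proof -
  have [measurable]: "f n \<in> borel_measurable lborel" for n using sq by (auto simp: sq_integrable_def)
  have si: "sq_integrable (\<lambda>x. f (Suc n) x - f n x)" for n
    by (rule sq_integrable_diff[OF sq sq])
  let ?D = "\<lambda>n x. ennreal (4 ^ n * (norm (f (Suc n) x - f n x))\<^sup>2)"
  have "(\<integral>\<^sup>+x. (\<Sum>n. ?D n x) \<partial>lborel) = (\<Sum>n. \<integral>\<^sup>+x. ?D n x \<partial>lborel)"
    by (rule nn_integral_suminf) measurable
  also have "\<dots> \<le> (\<Sum>n. ennreal ((1/4)^n))"
  proof (rule suminf_le)
    fix n
    have "(\<integral>\<^sup>+x. ?D n x \<partial>lborel) = ennreal (LINT x|lborel. 4 ^ n * (norm (f (Suc n) x - f n x))\<^sup>2)"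
      by (rule nn_integral_eq_integral) (use si[of n] in \<open>auto simp: sq_integrable_def\<close>)
    also have "\<dots> \<le> ennreal (4 ^ n * (1/16) ^ n)"
      using fast[of n] by (intro ennreal_leI) simp
    also have "4 ^ n * (1/16) ^ n = (1/4 :: real) ^ n" by (simp flip: power_mult_distrib)
    finally show "(\<integral>\<^sup>+x. ?D n x \<partial>lborel) \<le> ennreal ((1/4)^n)" .
  qed auto
  also have "\<dots> < \<infinity>"
    by (subst suminf_ennreal2) (auto intro!: summable_geometric)
  finally have fin: "(\<integral>\<^sup>+x. (\<Sum>n. ?D n x) \<partial>lborel) \<noteq> \<infinity>" by (metis less_irrefl)
  have ae: "AE x in lborel. (\<Sum>n. ?D n x) \<noteq> \<infinity>"
    by (rule nn_integral_PInf_AE[OF _ fin]) measurable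
  have term_le: "D n \<le> (\<Sum>n. D n)" for D :: "nat \<Rightarrow> ennreal" and n
    using sum_le_suminf[of D "{n}"] by simp
  from ae show ?thesis
  proof eventually_elim
    case (elim x)
    define M where "M = enn2real (\<Sum>n. ?D n x)"
    have M: "(\<Sum>n. ?D n x) = ennreal M" "M \<ge> 0"
      unfolding M_def using elim
      by (subst ennreal_enn2real) (simp_all add: less_top infinity_ennreal_def del: suminf_ennreal2)
    have b: "norm (f (Suc n) x - f n x) \<le> sqrt M * (1/2) ^ n" for n
    proof -
      have four: "((2::real) ^ n)\<^sup>2 = 4 ^ n" by (simp add: power2_eq_square flip: power_mult_distrib)
      have "?D n x \<le> ennreal M"
        unfolding M(1)[symmetric] by (rule term_le)
      then have "4 ^ n * (norm (f (Suc n) x - f n x))\<^sup>2 \<le> M" using M(2) by (simp add: ennreal_le_iff)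
      then have "(2 ^ n * norm (f (Suc n) x - f n x))\<^sup>2 \<le> M"
        using four by (simp add: power_mult_distrib)
      then have "2 ^ n * norm (f (Suc n) x - f n x) \<le> sqrt M" by (rule real_le_rsqrt)
      then show ?thesis by (simp add: field_simps)
    qed
    have "summable (\<lambda>n. sqrt M * (1/2 :: real) ^ n)" by (intro summable_mult summable_geometric) simp
    then have "summable (\<lambda>n. f (Suc n) x - f n x)"
      by (rule summable_comparison_test'[where N=0]) (use b in auto)
    then have "convergent (\<lambda>n. \<Sum>i<n. f (Suc i) x - f i x)" by (simp add: summable_iff_convergent)
    then have "convergent (\<lambda>n. f n x - f 0 x)" by (simp add: sum_lessThan_telescope[of "\<lambda>n. f n x"])
    then show "convergent (\<lambda>n. f n x)"
      using convergent_add[OF _ convergent_const[of "f 0 x"], of "\<lambda>n. f n x - f 0 x"] by simp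
  qed
qed

text \<open>
  A rapidly convergent subsequence has a pointwise limit almost everywhere. Fatou's lemma, applied
  along the subsequence with the other index fixed, turns the Cauchy condition into convergence to
  that limit.
\<close>

lemma L2_complete:
  fixes f :: "nat \<Rightarrow> real^'n \<Rightarrow> 'b::{banach, second_countable_topology}"
  assumes sq: "\<And>n. sq_integrable (f n)"
    and cau: "\<And>e. e > 0 \<Longrightarrow> \<exists>N. \<forall>m\<ge>N. \<forall>n\<ge>N. (LINT x|lborel. (norm (f m x - f n x))\<^sup>2) \<le> e"
  obtains g where "sq_integrable g"
    "\<And>e. e > 0 \<Longrightarrow> \<exists>N. \<forall>n\<ge>N. (LINT x|lborel. (norm (f n x - g x))\<^sup>2) \<le> e"
proof -
  have [measurable]: "f n \<in> borel_measurable lborel" for n using sq by (auto simp: sq_integrable_def)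
  obtain N where N: "\<And>k m n. m \<ge> N k \<Longrightarrow> n \<ge> N k \<Longrightarrow> (LINT x|lborel. (norm (f m x - f n x))\<^sup>2) \<le> (1/16)^k"
  proof -
    have "\<exists>N. \<forall>m\<ge>N. \<forall>n\<ge>N. (LINT x|lborel. (norm (f m x - f n x))\<^sup>2) \<le> (1/16)^k" for k by (rule cau) simp
    then have "\<exists>N. \<forall>k. \<forall>m\<ge>N k. \<forall>n\<ge>N k. (LINT x|lborel. (norm (f m x - f n x))\<^sup>2) \<le> (1/16)^k" by (intro choice) blast
    then show thesis using that by blast
  qed
  define r where "r k = k + (\<Sum>i\<le>k. N i)" for k
  have rN: "r k \<ge> N k" "r (Suc k) \<ge> N k" "r k \<ge> k" for k
  proof -
    have "N k \<le> (\<Sum>i\<le>k. N i)" for k by (rule member_le_sum) auto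
    then show "r k \<ge> N k" "r (Suc k) \<ge> N k" "r k \<ge> k"
      by (auto simp: r_def intro: trans_le_add1 trans_le_add2 le_SucI)
  qed
  have "AE x in lborel. convergent (\<lambda>k. f (r k) x)"
    by (rule rapidly_L2_Cauchy_imp_AE_convergent) (use sq N rN in auto)
  define g where "g x = lim (\<lambda>k. f (r k) x)" for x
  have [measurable]: "g \<in> borel_measurable lborel" unfolding g_def by measurable
  have lim: "AE x in lborel. (\<lambda>k. f (r k) x) \<longlonglongrightarrow> g x"
    using \<open>AE x in lborel. convergent (\<lambda>k. f (r k) x)\<close>
    by eventually_elim (simp add: g_def convergent_LIMSEQ_iff)
  have fatou: "(\<integral>\<^sup>+x. ennreal ((norm (f n x - g x))\<^sup>2) \<partial>lborel) \<le> ennreal e"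
    if n: "\<forall>m\<ge>N0. (LINT x|lborel. (norm (f n x - f m x))\<^sup>2) \<le> e" for n N0 e
  proof -
    have "(\<integral>\<^sup>+x. ennreal ((norm (f n x - g x))\<^sup>2) \<partial>lborel) =
      (\<integral>\<^sup>+x. liminf (\<lambda>k. ennreal ((norm (f n x - f (r k) x))\<^sup>2)) \<partial>lborel)"
    proof (rule nn_integral_cong_AE, use lim in eventually_elim)
      case (elim x)
      have "(\<lambda>k. (norm (f n x - f (r k) x))\<^sup>2) \<longlonglongrightarrow> (norm (f n x - g x))\<^sup>2"
        by (intro tendsto_intros elim)
      then show ?case
        by (intro lim_imp_Liminf[symmetric] trivial_limit_sequentially tendsto_ennrealI)
    qed
    also have "\<dots> \<le> liminf (\<lambda>k. \<integral>\<^sup>+x. ennreal ((norm (f n x - f (r k) x))\<^sup>2) \<partial>lborel)"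
      by (rule nn_integral_liminf) measurable
    also have "\<dots> \<le> ennreal e"
    proof (rule Liminf_le)
      show "\<forall>\<^sub>F k in sequentially. (\<integral>\<^sup>+x. ennreal ((norm (f n x - f (r k) x))\<^sup>2) \<partial>lborel) \<le> ennreal e"
        using eventually_ge_at_top[of N0]
      proof eventually_elim
        case (elim k)
        have "(\<integral>\<^sup>+x. ennreal ((norm (f n x - f (r k) x))\<^sup>2) \<partial>lborel) =
            ennreal (LINT x|lborel. (norm (f n x - f (r k) x))\<^sup>2)"
          by (rule nn_integral_eq_integral) (use sq_integrable_diff[OF sq sq, of n "r k"] in \<open>auto simp: sq_integrable_def\<close>)
        also have "\<dots> \<le> ennreal e"
          using n rN(3)[of k] elim by (intro ennreal_leI) auto
        finally show ?case .
      qed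
    qed simp
    finally show ?thesis .
  qed
  have int: "integrable lborel (\<lambda>x. (norm (f n x - g x))\<^sup>2)"
    and le: "(LINT x|lborel. (norm (f n x - g x))\<^sup>2) \<le> e"
    if n: "\<forall>m\<ge>N0. (LINT x|lborel. (norm (f n x - f m x))\<^sup>2) \<le> e" and "e \<ge> 0" for n N0 e
  proof -
    show i: "integrable lborel (\<lambda>x. (norm (f n x - g x))\<^sup>2)"
    proof (rule integrableI_bounded)
      show "(\<integral>\<^sup>+x. ennreal (norm ((norm (f n x - g x))\<^sup>2)) \<partial>lborel) < \<infinity>"
        using fatou[OF n] by (simp add: le_less_trans[OF _ ennreal_less_top])
    qed measurable
    have "ennreal (LINT x|lborel. (norm (f n x - g x))\<^sup>2) \<le> ennreal e"
      using fatou[OF n] nn_integral_eq_integral[OF i] by simp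
    then show "(LINT x|lborel. (norm (f n x - g x))\<^sup>2) \<le> e" using \<open>e \<ge> 0\<close> by (simp add: ennreal_le_iff)
  qed
  show thesis
  proof (rule that)
    have "sq_integrable (\<lambda>x. f (N 0) x - g x)"
      using int[where n="N 0" and ?N0.0="N 0" and e=1] N[of 0 "N 0"] by (auto simp: sq_integrable_def)
    from sq_integrable_diff[OF sq this, of "N 0"] show "sq_integrable g" by simp
    fix e :: real assume "e > 0"
    then obtain M where M: "\<forall>m\<ge>M. \<forall>n\<ge>M. (LINT x|lborel. (norm (f m x - f n x))\<^sup>2) \<le> e"
      using cau by blast
    have "(LINT x|lborel. (norm (f n x - g x))\<^sup>2) \<le> e" if "n \<ge> M" for n
      by (rule le[where ?N0.0=M]) (use M that \<open>e > 0\<close> in auto)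
    then show "\<exists>N. \<forall>n\<ge>N. (LINT x|lborel. (norm (f n x - g x))\<^sup>2) \<le> e" by blast
  qed
qed

section \<open>Completeness of H1 and the Riesz representation\<close>

lemma h1_rel_rep: "h1_rel (rep_h1 u) (rep_h1 u)"
  by (rule Quotient_rep_reflp[OF Quotient_h1])

lemma abs_rep_h1: "abs_h1 (rep_h1 u) = u"
  by (rule Quotient_abs_rep[OF Quotient_h1])

lemma H1_fun_rep_h1: "H1_fun (rep_h1 u)"
  using h1_rel_rep by (auto simp: h1_rel_def)

lemma h1_relI: "H1_fun f \<Longrightarrow> h1_rel f f"
  by (simp add: h1_rel_def)

lemma AE_rep_abs_h1: "H1_fun f \<Longrightarrow> AE x in lborel. rep_h1 (abs_h1 f) x = f x"
  using Quotient_rep_abs[OF Quotient_h1 h1_relI] by (auto simp: h1_rel_def)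

lemma h1_grad_abs_h1: "H1_fun f \<Longrightarrow> h1_grad (abs_h1 f) = grad_fun f"
  unfolding h1_grad_def by (intro grad_fun_cong_AE H1_fun_rep_h1 AE_rep_abs_h1)

lemma sq_integrable_rep_h1: "sq_integrable (rep_h1 u)" "sq_integrable (h1_grad u)"
  unfolding h1_grad_def by (intro H1_fun_sq grad_fun H1_fun_rep_h1)+

lemma weak_gradient_h1_grad: "weak_gradient (rep_h1 u) (h1_grad u)"
  unfolding h1_grad_def by (intro grad_fun H1_fun_rep_h1)

lemma AE_rep_add: "AE x in lborel. rep_h1 (u + v) x = rep_h1 u x + rep_h1 v x"
proof -
  have "u + v = abs_h1 (\<lambda>x. rep_h1 u x + rep_h1 v x)"
    using plus_h1.abs_eq[OF h1_rel_rep h1_rel_rep, of u v] by (simp add: abs_rep_h1)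
  then show ?thesis using AE_rep_abs_h1[OF H1_fun_add[OF H1_fun_rep_h1 H1_fun_rep_h1]] by simp
qed

lemma AE_rep_scaleC: "AE x in lborel. rep_h1 (h1_scaleC c u) x = c * rep_h1 u x"
proof -
  have "h1_scaleC c u = abs_h1 (\<lambda>x. c * rep_h1 u x)"
    using h1_scaleC.abs_eq[OF h1_rel_rep, of c u] by (simp add: abs_rep_h1)
  then show ?thesis using AE_rep_abs_h1[OF H1_fun_scaleC[OF H1_fun_rep_h1]] by simp
qed

lemma AE_h1_grad_add: "AE x in lborel. h1_grad (u + v) x = h1_grad u x + h1_grad v x"
proof -
  have "u + v = abs_h1 (\<lambda>x. rep_h1 u x + rep_h1 v x)"
    using plus_h1.abs_eq[OF h1_rel_rep h1_rel_rep, of u v] by (simp add: abs_rep_h1)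
  then have "h1_grad (u + v) = grad_fun (\<lambda>x. rep_h1 u x + rep_h1 v x)"
    by (simp only: h1_grad_abs_h1[OF H1_fun_add[OF H1_fun_rep_h1 H1_fun_rep_h1]])
  then show ?thesis using grad_fun_add[OF H1_fun_rep_h1 H1_fun_rep_h1] by (simp add: h1_grad_def)
qed

lemma AE_h1_grad_scaleC: "AE x in lborel. h1_grad (h1_scaleC c u) x = c *s h1_grad u x"
proof -
  have "h1_scaleC c u = abs_h1 (\<lambda>x. c * rep_h1 u x)"
    using h1_scaleC.abs_eq[OF h1_rel_rep, of c u] by (simp add: abs_rep_h1)
  then have "h1_grad (h1_scaleC c u) = grad_fun (\<lambda>x. c * rep_h1 u x)"
    by (simp only: h1_grad_abs_h1[OF H1_fun_scaleC[OF H1_fun_rep_h1]])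
  then show ?thesis using grad_fun_scaleC[OF H1_fun_rep_h1] by (simp add: h1_grad_def)
qed

lemma h1_cinner_eq:
  "h1_cinner u v = (LINT x|lborel. rep_h1 u x * cnj (rep_h1 v x)) +
     (LINT x|lborel. cdot (h1_grad u x) (h1_grad v x))"
  using h1_cinner.abs_eq[OF h1_rel_rep h1_rel_rep, of u v]
  by (simp add: abs_rep_h1 H1_cinner_fun_def h1_grad_def)

lemma norm_h1_power2: "(norm u)\<^sup>2 = (L2norm (rep_h1 u))\<^sup>2 + (L2norm (h1_grad u))\<^sup>2"
proof -
  have "complex_of_real ((norm u)\<^sup>2) = H1_cinner_fun (rep_h1 u) (rep_h1 u)"
    using h1_cinner_self[of u] by (simp add: h1_cinner_eq H1_cinner_fun_def h1_grad_def)
  then have "complex_of_real ((norm u)\<^sup>2) = complex_of_real ((L2norm (rep_h1 u))\<^sup>2 + (L2norm (h1_grad u))\<^sup>2)"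
    unfolding cinner_fun_self L2norm_power2 h1_grad_def .
  then show ?thesis unfolding of_real_eq_iff .
qed

lemma L2norm_rep_le: "L2norm (rep_h1 u) \<le> norm u" "L2norm (h1_grad u) \<le> norm u"
  by (rule power2_le_imp_le[OF _ norm_ge_zero], simp add: norm_h1_power2)+

lemma L2_norm_integral_le:
  fixes u v :: "real^'n \<Rightarrow> 'b::{real_normed_algebra, banach, second_countable_topology}"
  assumes "sq_integrable u" "sq_integrable v"
  shows "norm (LINT x|lborel. u x * v x) \<le> L2norm u * L2norm v"
proof -
  have "norm (LINT x|lborel. u x * v x) \<le> (LINT x|lborel. norm (u x) * norm (v x))"
  proof (cases "integrable lborel (\<lambda>x. u x * v x)")
    case True
    show ?thesis
      by (rule order_trans[OF integral_norm_bound integral_mono])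
        (use True sq_integrable_norm_mult[OF assms] in \<open>auto simp: norm_mult_ineq\<close>)
  next
    case False
    then show ?thesis by (simp add: not_integrable_integral_eq)
  qed
  also have "\<dots> \<le> L2norm u * L2norm v" by (rule L2_Cauchy_Schwarz[OF assms])
  finally show ?thesis .
qed

lemma sq_integrable_test_function:
  assumes "test_function \<phi>" shows "sq_integrable (\<lambda>x. complex_of_real (\<phi> x))"
proof -
  obtain B S where S: "bounded S" "S \<in> sets lborel" and [measurable]: "\<phi> \<in> borel_measurable lborel"
    and B: "\<And>x. \<bar>\<phi> x\<bar> \<le> B * indicat_real S x"
    using test_function_bounded[OF assms] by metis
  have "emeasure lborel S < \<infinity>" using emeasure_bounded_finite[OF S(1)] by simp
  then have "integrable lborel (\<lambda>x. B\<^sup>2 * indicat_real S x)" using S(2) by simp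
  then have "integrable lborel (\<lambda>x. (norm (complex_of_real (\<phi> x)))\<^sup>2)"
  proof (rule Bochner_Integration.integrable_bound)
    show "AE x in lborel. norm ((norm (complex_of_real (\<phi> x)))\<^sup>2) \<le> norm (B\<^sup>2 * indicat_real S x)"
    proof (rule AE_I2)
      fix x
      have "\<bar>\<phi> x\<bar>\<^sup>2 \<le> (B * indicat_real S x)\<^sup>2" by (rule power_mono[OF B]) simp
      also have "\<dots> = B\<^sup>2 * indicat_real S x" by (simp add: indicator_def)
      finally show "norm ((norm (complex_of_real (\<phi> x)))\<^sup>2) \<le> norm (B\<^sup>2 * indicat_real S x)" by simp
    qed
  qed measurable
  then show ?thesis by (simp add: sq_integrable_def)
qed

text \<open>
  Both sides of the integration-by-parts formula are continuous in L2 for a fixed test function.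
\<close>

lemma weak_gradient_L2_limit:
  fixes v :: "real^'n \<Rightarrow> complex"
  assumes sq: "\<And>n. sq_integrable (u n)" "\<And>n. sq_integrable (G n)" "sq_integrable v" "sq_integrable H"
    and w: "\<And>n. weak_gradient (u n) (G n)"
    and lim: "\<And>e. e > 0 \<Longrightarrow> \<exists>n. L2norm (\<lambda>x. u n x - v x) \<le> e \<and> L2norm (\<lambda>x. G n x - H x) \<le> e"
  shows "weak_gradient v H"
  unfolding weak_gradient_def
proof (intro allI impI)
  fix \<phi> :: "real^'n \<Rightarrow> real" and i assume t: "test_function \<phi>"
  note t' = test_function_partial_deriv[OF t, of i]
  let ?a = "LINT x|lborel. v x * complex_of_real (partial_deriv i \<phi> x)"
  let ?b = "LINT x|lborel. H x $ i * complex_of_real (\<phi> x)"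
  define P Q where "P = L2norm (\<lambda>x. complex_of_real (partial_deriv i \<phi> x))"
    and "Q = L2norm (\<lambda>x. complex_of_real (\<phi> x))"
  have PQ: "P \<ge> 0" "Q \<ge> 0" by (simp_all add: P_def Q_def L2norm_nonneg)
  have key: "norm (?a + ?b) \<le> e * (P + Q)" if e: "e > 0" for e
  proof -
    obtain n where n: "L2norm (\<lambda>x. u n x - v x) \<le> e" "L2norm (\<lambda>x. G n x - H x) \<le> e"
      using lim[OF e] by blast
    note s1 = sq_integrable_diff[OF sq(1)[of n] sq(3)]
      and s2 = sq_integrable_diff[OF sq(2)[of n] sq(4)]
    have le: "L2norm (\<lambda>x. (G n x - H x) $ i) \<le> L2norm (\<lambda>x. G n x - H x)"
      unfolding L2norm_def
    proof (intro real_sqrt_le_mono integral_mono)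
      show "integrable lborel (\<lambda>x. (norm ((G n x - H x) $ i))\<^sup>2)"
        using sq_integrable_nth[OF s2, of i] unfolding sq_integrable_def by (rule conjunct2)
      show "integrable lborel (\<lambda>x. (norm (G n x - H x))\<^sup>2)"
        using s2 unfolding sq_integrable_def by (rule conjunct2)
      show "(norm ((G n x - H x) $ i))\<^sup>2 \<le> (norm (G n x - H x))\<^sup>2" for x
        by (intro power_mono Finite_Cartesian_Product.norm_nth_le norm_ge_zero)
    qed
    have 1: "(LINT x|lborel. (u n x - v x) * complex_of_real (partial_deriv i \<phi> x)) =
      (LINT x|lborel. u n x * complex_of_real (partial_deriv i \<phi> x)) - ?a"
      unfolding left_diff_distrib
      by (intro Bochner_Integration.integral_diff test_mult_integrable sq t')
    have 2: "(LINT x|lborel. (G n x - H x) $ i * complex_of_real (\<phi> x)) =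
      (LINT x|lborel. G n x $ i * complex_of_real (\<phi> x)) - ?b"
      unfolding left_diff_distrib vector_minus_component
      by (intro Bochner_Integration.integral_diff test_mult_integrable sq_integrable_nth sq t)
    have "?a + ?b = - ((LINT x|lborel. (u n x - v x) * complex_of_real (partial_deriv i \<phi> x)) +
      (LINT x|lborel. (G n x - H x) $ i * complex_of_real (\<phi> x)))"
      unfolding 1 2 using w[of n, unfolded weak_gradient_def, rule_format, OF t, of i] by simp
    then have "norm (?a + ?b) \<le> norm (LINT x|lborel. (u n x - v x) * complex_of_real (partial_deriv i \<phi> x)) +
      norm (LINT x|lborel. (G n x - H x) $ i * complex_of_real (\<phi> x))"
      by (simp only: norm_minus_cancel norm_triangle_ineq)
    also have "\<dots> \<le> L2norm (\<lambda>x. u n x - v x) * P + L2norm (\<lambda>x. (G n x - H x) $ i) * Q"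
      unfolding P_def Q_def
      by (intro add_mono L2_norm_integral_le s1 sq_integrable_nth[OF s2] sq_integrable_test_function t t')
    also have "\<dots> \<le> e * P + e * Q"
      using n le PQ by (intro add_mono mult_right_mono) auto
    finally show ?thesis by (simp add: distrib_left)
  qed
  have "norm (?a + ?b) \<le> 0"
  proof (rule field_le_epsilon)
    fix e :: real assume "e > 0"
    have "norm (?a + ?b) \<le> e / (P + Q + 1) * (P + Q)" by (rule key) (use \<open>e > 0\<close> PQ in simp)
    also have "\<dots> \<le> e" using \<open>e > 0\<close> PQ by (simp add: field_simps)
    finally show "norm (?a + ?b) \<le> 0 + e" by simp
  qed
  then have "?a + ?b = 0" unfolding norm_le_zero_iff .
  then show "?a = - ?b" unfolding eq_neg_iff_add_eq_0 .
qed

lemma h1_minus: "u - v = u + h1_scaleC (-1) v"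
  using h1_scaleC_of_real[of "-1" v] by simp

lemma AE_rep_diff: "AE x in lborel. rep_h1 (u - v) x = rep_h1 u x - rep_h1 v x"
  using AE_rep_add[of u "h1_scaleC (-1) v"] AE_rep_scaleC[of "-1" v]
  unfolding h1_minus by eventually_elim simp

lemma AE_h1_grad_diff: "AE x in lborel. h1_grad (u - v) x = h1_grad u x - h1_grad v x"
  using AE_h1_grad_add[of u "h1_scaleC (-1) v"] AE_h1_grad_scaleC[of "-1" v]
  unfolding h1_minus by eventually_elim simp

lemma L2norm_cong_AE:
  assumes "u \<in> borel_measurable lborel" "v \<in> borel_measurable lborel" "AE x in lborel. u x = v x"
  shows "L2norm u = L2norm v"
proof -
  have [measurable]: "u \<in> borel_measurable lborel" "v \<in> borel_measurable lborel" by fact+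
  have "(LINT x|lborel. (norm (u x))\<^sup>2) = (LINT x|lborel. (norm (v x))\<^sup>2)"
  proof (rule integral_cong_AE)
    show "AE x in lborel. (norm (u x))\<^sup>2 = (norm (v x))\<^sup>2" using assms(3) by eventually_elim simp
  qed measurable
  then show ?thesis by (simp add: L2norm_def)
qed

lemma norm_h1_diff_power2:
  "(norm (u - v))\<^sup>2 = (LINT x|lborel. (norm ((rep_h1 u x, h1_grad u x) - (rep_h1 v x, h1_grad v x)))\<^sup>2)"
proof -
  note s = sq_integrable_diff[OF sq_integrable_rep_h1(1) sq_integrable_rep_h1(1), of u v]
    sq_integrable_diff[OF sq_integrable_rep_h1(2) sq_integrable_rep_h1(2), of u v]
  have "L2norm (rep_h1 (u - v)) = L2norm (\<lambda>x. rep_h1 u x - rep_h1 v x)"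
    using AE_rep_diff s sq_integrable_rep_h1 by (intro L2norm_cong_AE) (auto simp: sq_integrable_def)
  moreover have "L2norm (h1_grad (u - v)) = L2norm (\<lambda>x. h1_grad u x - h1_grad v x)"
    using AE_h1_grad_diff s sq_integrable_rep_h1 by (intro L2norm_cong_AE) (auto simp: sq_integrable_def)
  ultimately have "(norm (u - v))\<^sup>2 = (LINT x|lborel. (norm (rep_h1 u x - rep_h1 v x))\<^sup>2) +
      (LINT x|lborel. (norm (h1_grad u x - h1_grad v x))\<^sup>2)"
    by (simp add: norm_h1_power2 L2norm_power2)
  also have "\<dots> = (LINT x|lborel. (norm (rep_h1 u x - rep_h1 v x))\<^sup>2 + (norm (h1_grad u x - h1_grad v x))\<^sup>2)"
    using s by (intro Bochner_Integration.integral_add[symmetric]) (auto simp: sq_integrable_def)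
  finally show ?thesis by (simp add: norm_prod_def)
qed

lemma sq_integrable_Pair:
  fixes u :: "real^'n \<Rightarrow> 'b::{real_normed_vector, second_countable_topology}"
    and v :: "real^'n \<Rightarrow> 'c::{real_normed_vector, second_countable_topology}"
  assumes "sq_integrable u" "sq_integrable v"
  shows "sq_integrable (\<lambda>x. (u x, v x))"
proof -
  have [measurable]: "u \<in> borel_measurable lborel" "v \<in> borel_measurable lborel"
    using assms by (auto simp: sq_integrable_def)
  have "(\<lambda>x. (u x, v x)) \<in> borel_measurable lborel" by measurable
  then show ?thesis using assms by (simp add: sq_integrable_def norm_prod_def)
qed

text \<open>
  The map \<open>u \<mapsto> (u, grad u)\<close> embeds H1 isometrically into the square-integrable functions with
  values in a product space, and its range is closed because weak gradients pass to the limit.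
\<close>

lemma h1_complete:
  fixes X :: "nat \<Rightarrow> 'n::finite h1"
  assumes "Cauchy X" shows "convergent X"
proof -
  define f where "f n x = (rep_h1 (X n) x, h1_grad (X n) x)" for n x
  have sq: "sq_integrable (f n)" for n
    unfolding f_def by (intro sq_integrable_Pair sq_integrable_rep_h1)
  have d: "(LINT x|lborel. (norm (f m x - f n x))\<^sup>2) = (norm (X m - X n))\<^sup>2" for m n
    unfolding f_def norm_h1_diff_power2 ..
  have cau: "\<exists>N. \<forall>m\<ge>N. \<forall>n\<ge>N. (LINT x|lborel. (norm (f m x - f n x))\<^sup>2) \<le> e" if "e > 0" for e
  proof -
    have "\<exists>N. \<forall>m\<ge>N. \<forall>n\<ge>N. norm (X m - X n) < sqrt e"
      by (rule CauchyD[OF assms]) (use that in simp)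
    then obtain N where N: "\<And>m n. m \<ge> N \<Longrightarrow> n \<ge> N \<Longrightarrow> norm (X m - X n) < sqrt e"
      by blast
    have "(norm (X m - X n))\<^sup>2 \<le> e" if "m \<ge> N" "n \<ge> N" for m n
      using power_mono[OF less_imp_le[OF N[OF that]], of 2] \<open>e > 0\<close> by simp
    then show ?thesis unfolding d by blast
  qed
  obtain g where g: "sq_integrable g"
    and lim: "\<And>e. e > 0 \<Longrightarrow> \<exists>N. \<forall>n\<ge>N. (LINT x|lborel. (norm (f n x - g x))\<^sup>2) \<le> e"
    using L2_complete[of f, OF sq cau] by blast
  have [measurable]: "g \<in> borel_measurable lborel" using g by (simp add: sq_integrable_def)
  define v H where "v x = fst (g x)" and "H x = snd (g x)" for x
  have sv: "sq_integrable v"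
  proof (rule sq_integrable_dominated[OF g, where C=1])
    show "v \<in> borel_measurable lborel" unfolding v_def
      by (rule borel_measurable_continuous_on[where f=fst]) (auto intro!: continuous_intros)
    show "norm (v x) \<le> 1 * norm (g x)" for x
      unfolding v_def norm_prod_def by simp
  qed
  have sH: "sq_integrable H"
  proof (rule sq_integrable_dominated[OF g, where C=1])
    show "H \<in> borel_measurable lborel" unfolding H_def
      by (rule borel_measurable_continuous_on[where f=snd]) (auto intro!: continuous_intros)
    show "norm (H x) \<le> 1 * norm (g x)" for x
      unfolding H_def norm_prod_def by simp
  qed
  have fg: "f n x - g x = (rep_h1 (X n) x - v x, h1_grad (X n) x - H x)" for n x
    by (simp add: f_def v_def H_def prod_eq_iff)
  note s1 = sq_integrable_diff[OF sq_integrable_rep_h1(1) sv] and s2 = sq_integrable_diff[OF sq_integrable_rep_h1(2) sH]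
  have split: "(LINT x|lborel. (norm (f n x - g x))\<^sup>2) =
      (L2norm (\<lambda>x. rep_h1 (X n) x - v x))\<^sup>2 + (L2norm (\<lambda>x. h1_grad (X n) x - H x))\<^sup>2" for n
    unfolding fg norm_prod_def L2norm_power2
    using s1[of "X n"] s2[of "X n"] by (simp add: sq_integrable_def)
  have wg: "weak_gradient v H"
  proof (rule weak_gradient_L2_limit[OF sq_integrable_rep_h1 sv sH weak_gradient_h1_grad])
    fix e :: real assume "e > 0"
    then obtain n where n: "(LINT x|lborel. (norm (f n x - g x))\<^sup>2) \<le> e\<^sup>2"
      using lim[of "e\<^sup>2"] by auto
    have "L2norm (\<lambda>x. rep_h1 (X n) x - v x) \<le> e" "L2norm (\<lambda>x. h1_grad (X n) x - H x) \<le> e"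
    proof -
      have le: "p \<le> e" "q \<le> e" if "p\<^sup>2 + q\<^sup>2 \<le> e\<^sup>2" for p q :: real
      proof -
        have "0 \<le> p\<^sup>2" "0 \<le> q\<^sup>2" by simp_all
        then have "p\<^sup>2 \<le> e\<^sup>2" "q\<^sup>2 \<le> e\<^sup>2" using that by linarith+
        then show "p \<le> e" "q \<le> e" using \<open>e > 0\<close> by (auto elim: power2_le_imp_le)
      qed
      show "L2norm (\<lambda>x. rep_h1 (X n) x - v x) \<le> e" "L2norm (\<lambda>x. h1_grad (X n) x - H x) \<le> e"
        using le[OF n[unfolded split]] .
    qed
    then show "\<exists>n. L2norm (\<lambda>x. rep_h1 (X n) x - v x) \<le> e \<and> L2norm (\<lambda>x. h1_grad (X n) x - H x) \<le> e" by blast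
  qed
  have Hv: "H1_fun v" by (rule H1_funI[OF sv sH wg])
  define V where "V = abs_h1 v"
  have rV: "AE x in lborel. rep_h1 V x = v x" unfolding V_def by (rule AE_rep_abs_h1[OF Hv])
  have gV: "AE x in lborel. h1_grad V x = H x"
    unfolding V_def h1_grad_abs_h1[OF Hv] by (rule grad_fun_unique[OF Hv sH wg])
  have e: "(norm (X n - V))\<^sup>2 = (LINT x|lborel. (norm (f n x - g x))\<^sup>2)" for n
    unfolding norm_h1_diff_power2 fg
  proof (rule integral_cong_AE)
    show "AE x in lborel. (norm ((rep_h1 (X n) x, h1_grad (X n) x) - (rep_h1 V x, h1_grad V x)))\<^sup>2 =
       (norm (rep_h1 (X n) x - v x, h1_grad (X n) x - H x))\<^sup>2"
      using rV gV by eventually_elim simp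
    show "(\<lambda>x. (norm ((rep_h1 (X n) x, h1_grad (X n) x) - (rep_h1 V x, h1_grad V x)))\<^sup>2)
        \<in> borel_measurable lborel"
      using sq_integrable_diff[OF sq_integrable_Pair[OF sq_integrable_rep_h1(1)[of "X n"] sq_integrable_rep_h1(2)[of "X n"]]
        sq_integrable_Pair[OF sq_integrable_rep_h1(1)[of V] sq_integrable_rep_h1(2)[of V]]]
      unfolding sq_integrable_def by (elim conjE) (erule borel_measurable_integrable)
    show "(\<lambda>x. (norm (rep_h1 (X n) x - v x, h1_grad (X n) x - H x))\<^sup>2) \<in> borel_measurable lborel"
      using sq_integrable_Pair[OF s1[of "X n"] s2[of "X n"]]
      unfolding sq_integrable_def by (elim conjE) (erule borel_measurable_integrable)
  qed
  have "X \<longlonglongrightarrow> V"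
  proof (rule LIMSEQ_I)
    fix e :: real assume "e > 0"
    then obtain N where N: "\<And>n. n \<ge> N \<Longrightarrow> (norm (X n - V))\<^sup>2 \<le> (e/2)\<^sup>2"
      using lim[of "(e/2)\<^sup>2"] unfolding e by auto
    have "norm (X n - V) < e" if "n \<ge> N" for n
      using power2_le_imp_le[OF N[OF that]] \<open>e > 0\<close> by simp
    then show "\<exists>N. \<forall>n\<ge>N. norm (X n - V) < e" by blast
  qed
  then show ?thesis by (auto simp: convergent_def)
qed

instance h1 :: (finite) banach
proof
  fix X :: "nat \<Rightarrow> 'a h1"
  assume "Cauchy X" then show "convergent X" by (rule h1_complete)
qed

text \<open>
  The representing vector minimizes \<open>(norm v)\<^sup>2 - 2 * l v\<close>: by the parallelogram law every minimizing
  sequence is Cauchy, and at a minimum the derivative in each direction vanishes.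
\<close>

lemma Riesz_representation:
  fixes l :: "'a::{real_inner, banach} \<Rightarrow> real"
  assumes "bounded_linear l"
  obtains w where "\<And>v. inner w v = l v"
proof -
  interpret l: bounded_linear l by fact
  obtain K where K: "\<And>v. norm (l v) \<le> norm v * K" using l.bounded by blast
  define J where "J v = (norm v)\<^sup>2 - 2 * l v" for v
  have lower: "- K\<^sup>2 \<le> J v" for v
  proof -
    have "0 \<le> (norm v - K)\<^sup>2" by simp
    then have "2 * (norm v * K) \<le> (norm v)\<^sup>2 + K\<^sup>2" by (simp add: power2_eq_square algebra_simps)
    moreover have "l v \<le> norm v * K" using K[of v] by simp
    ultimately show ?thesis by (simp add: J_def)
  qed
  define m where "m = Inf (range J)"
  have bd: "bdd_below (range J)" using lower by (auto simp: bdd_below_def)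
  have m: "m \<le> J v" for v unfolding m_def by (rule cInf_lower[OF _ bd]) simp
  have "\<exists>v. J v < m + e" if "e > 0" for e
    using cInf_lessD[of "range J" "m + e"] that by (auto simp: m_def)
  then obtain v where v: "\<And>n. J (v n) < m + inverse (real (Suc n))"
    using choice[of "\<lambda>n v. J v < m + inverse (real (Suc n))"] by (metis inverse_positive_iff_positive of_nat_0_less_iff zero_less_Suc)
  have par: "(norm (x - y))\<^sup>2 = 2 * J x + 2 * J y - 4 * J ((1/2) *\<^sub>R (x + y))" for x y
    by (simp add: J_def power2_norm_eq_inner l.scaleR l.add inner_simps inner_commute algebra_simps)
  have close: "(norm (v i - v j))\<^sup>2 \<le> 4 * inverse (real (Suc N))" if "i \<ge> N" "j \<ge> N" for i j N
  proof -
    have "inverse (real (Suc i)) \<le> inverse (real (Suc N))" "inverse (real (Suc j)) \<le> inverse (real (Suc N))"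
      using that by (auto intro!: le_imp_inverse_le)
    then show ?thesis using v[of i] v[of j] m[of "(1/2) *\<^sub>R (v i + v j)"] unfolding par[of "v i" "v j"] by linarith
  qed
  have "Cauchy v"
  proof (rule CauchyI)
    fix e :: real assume e: "e > 0"
    obtain N where N: "inverse (real (Suc N)) < e\<^sup>2 / 4" using reals_Archimedean[of "e\<^sup>2 / 4"] e by auto
    have "norm (v i - v j) < e" if "i \<ge> N" "j \<ge> N" for i j
      by (rule power2_less_imp_less) (use close[OF that] N e in auto)
    then show "\<exists>M. \<forall>m\<ge>M. \<forall>n\<ge>M. norm (v m - v n) < e" by blast
  qed
  then obtain w where w: "v \<longlonglongrightarrow> w" using Cauchy_convergent convergent_def by blast
  have "(\<lambda>n. J (v n)) \<longlonglongrightarrow> J w"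
    unfolding J_def by (intro tendsto_intros w l.tendsto)
  moreover have "(\<lambda>n. m + inverse (real (Suc n))) \<longlonglongrightarrow> m + 0"
    by (intro tendsto_intros LIMSEQ_inverse_real_of_nat)
  ultimately have "J w \<le> m"
    using LIMSEQ_le[of "\<lambda>n. J (v n)" "J w" "\<lambda>n. m + inverse (real (Suc n))" m] v by (auto intro: less_imp_le)
  then have min: "J w \<le> J x" for x using m[of x] by linarith
  have "inner w x = l x" for x
  proof (rule ccontr)
    assume ne: "inner w x \<noteq> l x"
    define d where "d = inner w x - l x"
    have q: "0 \<le> t\<^sup>2 * (norm x)\<^sup>2 + 2 * t * d" for t
    proof -
      have "(norm (w + t *\<^sub>R x))\<^sup>2 = (norm w)\<^sup>2 + 2 * t * inner w x + t\<^sup>2 * (norm x)\<^sup>2"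
        by (simp add: power2_norm_eq_inner inner_simps inner_commute power2_eq_square[of t])
      then show ?thesis using min[of "w + t *\<^sub>R x"]
        by (simp add: J_def d_def l.scaleR l.add algebra_simps)
    qed
    define N where "N = (norm x)\<^sup>2 + 1"
    have N: "N > 0" "(norm x)\<^sup>2 < N" by (simp_all add: N_def add_nonneg_pos)
    have "0 \<le> (- d / N)\<^sup>2 * (norm x)\<^sup>2 + 2 * (- d / N) * d" by (rule q)
    also have "\<dots> \<le> (- d / N)\<^sup>2 * N + 2 * (- d / N) * d"
      using N by (intro add_right_mono mult_left_mono) auto
    also have "\<dots> = - d\<^sup>2 / N" using N by (simp add: power2_eq_square field_simps)
    also have "\<dots> < 0" using ne N by (simp add: d_def)
    finally show False by simp
  qed
  then show thesis by (rule that)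
qed

lemma h1_cinner_scaleC_right: "h1_cinner u (h1_scaleC c v) = cnj c * h1_cinner u v"
  using h1_cinner_scaleC_left[of c v u] h1_cinner_commute[of u "h1_scaleC c v"] h1_cinner_commute[of u v]
  by simp

lemma h1_cinner_eqI:
  assumes "\<And>v. h1_cinner x v = h1_cinner y v" shows "x = y"
proof -
  have "inner x v = inner y v" for v using assms by (simp add: inner_h1_def)
  then show ?thesis using vector_eq_rdot[of x y] by (metis inner_commute)
qed

text \<open>
  The theorem for real functionals is applied to \<open>Re (a u v)\<close>. The imaginary parts follow on
  replacing \<open>v\<close> by \<open>\<i> v\<close>.
\<close>

lemma is_riesz_rep_exists:
  assumes add1: "\<And>u u' v. a (u + u') v = a u v + a u' v"
    and add2: "\<And>u v v'. a u (v + v') = a u v + a u v'"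
    and sc1: "\<And>c u v. a (h1_scaleC c u) v = c * a u v"
    and sc2: "\<And>c u v. a u (h1_scaleC c v) = cnj c * a u v"
    and bd: "\<And>u v. norm (a u v) \<le> C * norm u * norm v"
  shows "\<exists>T. is_riesz_rep a T"
proof -
  have "\<exists>w. \<forall>v. h1_cinner w v = a u v" for u
  proof -
    have "bounded_linear (\<lambda>v. Re (a u v))"
    proof (rule bounded_linear_intro)
      show "Re (a u (x + y)) = Re (a u x) + Re (a u y)" for x y by (simp add: add2)
      show "Re (a u (r *\<^sub>R x)) = r *\<^sub>R Re (a u x)" for r x
        by (simp add: h1_scaleC_of_real[symmetric] sc2)
      show "norm (Re (a u x)) \<le> norm x * (C * norm u)" for x
        using bd[of u x] abs_Re_le_cmod[of "a u x"] by (simp add: mult.commute mult.left_commute)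
    qed
    from Riesz_representation[OF this] obtain w where w: "\<And>v. inner w v = Re (a u v)" by metis
    then have re: "Re (h1_cinner w v) = Re (a u v)" for v by (simp add: inner_h1_def)
    have "h1_cinner w v = a u v" for v
      using re[of v] re[of "h1_scaleC \<i> v"]
      by (simp add: complex_eq_iff h1_cinner_scaleC_right sc2)
    then show ?thesis by blast
  qed
  then obtain T where T: "\<And>u v. h1_cinner (T u) v = a u v" by metis
  have add: "T (u + v) = T u + T v" for u v
    by (rule h1_cinner_eqI) (simp add: T h1_cinner_add_left add1)
  have sc: "T (h1_scaleC c u) = h1_scaleC c (T u)" for c u
    by (rule h1_cinner_eqI) (simp add: T h1_cinner_scaleC_left sc1)
  have "bounded_linear T"
  proof (rule bounded_linear_intro)
    show "T (x + y) = T x + T y" for x y by (rule add)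
    show "T (r *\<^sub>R x) = r *\<^sub>R T x" for r x
      using sc[of "complex_of_real r" x] by (simp add: h1_scaleC_of_real)
    show "norm (T x) \<le> norm x * C" for x
    proof (cases "T x = 0")
      case True
      have "0 \<le> C * norm x * norm x" using order_trans[OF norm_ge_zero bd] .
      then show ?thesis using True by (cases "x = 0") (auto simp: mult.commute zero_le_mult_iff)
    next
      case False
      have "norm (T x) * norm (T x) = norm (a x (T x))"
        using T[of x "T x"] h1_cinner_self[of "T x"] by (metis abs_of_nonneg norm_of_real power2_eq_square zero_le_power2)
      also have "\<dots> \<le> (norm x * C) * norm (T x)" using bd[of x "T x"] by (simp add: mult.commute)
      finally show ?thesis using False by simp
    qed
  qed
  then show ?thesis using sc T by (auto simp: is_riesz_rep_def bounded_clinear_def)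
qed

section \<open>Test functions as elements of H1\<close>

definition smooth_fun :: "(real^'n \<Rightarrow> real) \<Rightarrow> bool" where
  "smooth_fun f \<longleftrightarrow> (\<forall>k. Ck k f)"

lemma test_function_smooth: "test_function \<phi> \<Longrightarrow> smooth_fun \<phi>"
  by (simp add: test_function_def smooth_fun_def)

lemma smooth_has_derivative:
  "smooth_fun f \<Longrightarrow> (f has_derivative frechet_derivative f (at x)) (at x)"
  unfolding smooth_fun_def using Ck_Suc_derivE by blast

lemma smooth_continuous: "smooth_fun f \<Longrightarrow> continuous_on UNIV f"
  unfolding smooth_fun_def using Ck_continuous by blast

lemma smooth_measurable: "smooth_fun f \<Longrightarrow> f \<in> borel_measurable lborel"
  by (simp add: borel_measurable_continuous_onI smooth_continuous)

lemma smooth_mult: "smooth_fun f \<Longrightarrow> smooth_fun g \<Longrightarrow> smooth_fun (\<lambda>x. f x * g x)"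
  by (simp add: smooth_fun_def Ck_mult)

lemma partial_deriv_eqI: "(f has_derivative D) (at x) \<Longrightarrow> partial_deriv i f x = D (axis i 1)"
  unfolding partial_deriv_def using frechet_derivative_at by metis

lemma partial_deriv_mult:
  assumes "smooth_fun f" "smooth_fun g"
  shows "partial_deriv i (\<lambda>x. f x * g x) x = f x * partial_deriv i g x + partial_deriv i f x * g x"
  unfolding partial_deriv_eqI[OF has_derivative_mult[OF smooth_has_derivative[OF assms(1)] smooth_has_derivative[OF assms(2)]]]
  unfolding partial_deriv_def ..

text \<open>
  The derivative is again a plane cosine wave, with shifted phase \<open>b + pi / 2\<close>, so that a single
  induction over all phases suffices.
\<close>

lemma Ck_cos_plane: "Ck k (\<lambda>x::real^'n. cos (a \<bullet> x + b))"
proof (induction k arbitrary: b)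
  case 0
  show ?case by (auto intro!: continuous_intros)
next
  case (Suc k)
  have "((\<lambda>x. cos (a \<bullet> x + b)) has_derivative (\<lambda>h. (a \<bullet> h) * cos (a \<bullet> x + (b + pi / 2)))) (at x)" for x
  proof -
    have "a \<bullet> x + (b + pi / 2) = (a \<bullet> x + b) + pi / 2" by simp
    then have "cos (a \<bullet> x + (b + pi / 2)) = - sin (a \<bullet> x + b)" by (simp only: cos_add cos_pi_half sin_pi_half)
    then show ?thesis by (auto intro!: derivative_eq_intros simp: mult.commute)
  qed
  then show ?case by (rule Ck_SucI) (rule Ck_mult[OF Ck_const Suc.IH])
qed

lemma smooth_cos_plane: "smooth_fun (\<lambda>x::real^'n. cos (a \<bullet> x + b))"
  by (simp add: smooth_fun_def Ck_cos_plane)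

lemma smooth_sin_plane: "smooth_fun (\<lambda>x::real^'n. sin (a \<bullet> x + b))"
proof -
  have "(\<lambda>x. sin (a \<bullet> x + b)) = (\<lambda>x. cos (a \<bullet> x + (b - pi / 2)))"
    by (simp add: cos_diff fun_eq_iff add_diff_eq)
  then show ?thesis using smooth_cos_plane by metis
qed

lemma partial_deriv_cos_plane:
  "partial_deriv i (\<lambda>x::real^'n. cos (a \<bullet> x + b)) x = - (a $ i) * sin (a \<bullet> x + b)"
proof (rule partial_deriv_eqI[THEN trans])
  show "((\<lambda>x. cos (a \<bullet> x + b)) has_derivative (\<lambda>h. - (a \<bullet> h) * sin (a \<bullet> x + b))) (at x)"
    by (auto intro!: derivative_eq_intros)
qed (simp add: inner_axis)

lemma partial_deriv_sin_plane:
  "partial_deriv i (\<lambda>x::real^'n. sin (a \<bullet> x + b)) x = (a $ i) * cos (a \<bullet> x + b)"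
proof (rule partial_deriv_eqI[THEN trans])
  show "((\<lambda>x. sin (a \<bullet> x + b)) has_derivative (\<lambda>h. (a \<bullet> h) * cos (a \<bullet> x + b))) (at x)"
    by (auto intro!: derivative_eq_intros)
qed (simp add: inner_axis)

lemma test_function_mult:
  assumes "test_function \<phi>" "smooth_fun f"
  shows "test_function (\<lambda>x. \<phi> x * f x)"
proof -
  have "closure {x. \<phi> x * f x \<noteq> 0} \<subseteq> closure {x. \<phi> x \<noteq> 0}" by (rule closure_mono) auto
  then have "compact (closure {x. \<phi> x * f x \<noteq> 0})"
    using assms(1) bounded_subset[of "closure {x. \<phi> x \<noteq> 0}"]
    by (simp add: test_function_def compact_eq_bounded_closed)
  then show ?thesis
    using smooth_mult[OF test_function_smooth[OF assms(1)] assms(2)]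
    by (simp add: test_function_def smooth_fun_def)
qed

lemma lborel_integral_translation:
  fixes f :: "'a::euclidean_space \<Rightarrow> 'b::{banach, second_countable_topology}"
  assumes [measurable]: "f \<in> borel_measurable lborel"
  shows "(LINT x|lborel. f (c + x)) = (LINT x|lborel. f x)"
proof -
  have "(LINT x|lborel. f x) = (LINT x|distr lborel borel ((+) c). f x)"
    by (simp add: lborel_distr_plus)
  also have "\<dots> = (LINT x|lborel. f (c + x))"
    by (rule integral_distr) (use assms in auto)
  finally show ?thesis by simp
qed

text \<open>
  The difference quotients of \<open>\<psi>\<close> in direction \<open>i\<close> have integral zero by translation invariance. They
  converge to the partial derivative and are dominated, by the mean value theorem, by a multiple of
  the indicator of a ball.
\<close>

lemma integral_partial_deriv_test_function:
  fixes \<psi> :: "real^'n \<Rightarrow> real"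
  assumes t: "test_function \<psi>"
  shows "(LINT x|lborel. partial_deriv i \<psi> x) = 0"
proof -
  note sm = test_function_smooth[OF t] and t' = test_function_partial_deriv[OF t, of i]
  have [measurable]: "\<psi> \<in> borel_measurable lborel" by (rule smooth_measurable[OF sm])
  have [measurable]: "partial_deriv i \<psi> \<in> borel_measurable lborel"
    by (rule smooth_measurable[OF test_function_smooth[OF t']])
  obtain B S where S: "bounded S" "S \<in> sets lborel" and B: "\<And>x. \<bar>\<psi> x\<bar> \<le> B * indicat_real S x"
    using test_function_bounded[OF t] by metis
  obtain B' S' where B': "\<And>x. \<bar>partial_deriv i \<psi> x\<bar> \<le> B' * indicat_real S' x"
    using test_function_bounded[OF t'] by metis
  have B'0: "\<bar>partial_deriv i \<psi> x\<bar> \<le> \<bar>B'\<bar>" for x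
    using B'[of x] abs_ge_self[of B'] by (cases "x \<in> S'") auto
  obtain r where r: "\<And>x. x \<in> S \<Longrightarrow> norm x \<le> r" using S(1) by (auto simp: bounded_iff)
  have zero: "\<psi> x = 0" if "norm x > r" for x using B[of x] r[of x] that by (cases "x \<in> S") auto
  define h where "h n = inverse (real (Suc n))" for n
  have h: "h n > 0" "h n \<le> 1" for n by (auto simp: h_def field_simps)
  define e where "e = (axis i 1 :: real^'n)"
  have ne: "norm e = 1" by (simp add: e_def norm_axis_1)
  define q where "q n x = (\<psi> (h n *\<^sub>R e + x) - \<psi> x) / h n" for n x
  have der: "((\<lambda>s. \<psi> (s *\<^sub>R e + x)) has_real_derivative partial_deriv i \<psi> (s *\<^sub>R e + x)) (at s)" for s x
  proof -
    have "((\<lambda>s. s *\<^sub>R e + x) has_derivative (\<lambda>d. d *\<^sub>R e)) (at s)"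
      by (auto intro!: derivative_eq_intros)
    from has_derivative_compose[OF this smooth_has_derivative[OF sm]]
    have "((\<lambda>s. \<psi> (s *\<^sub>R e + x)) has_derivative
        (\<lambda>d. frechet_derivative \<psi> (at (s *\<^sub>R e + x)) (d *\<^sub>R e))) (at s)" .
    moreover have "frechet_derivative \<psi> (at y) (d *\<^sub>R e) = partial_deriv i \<psi> y * d" for y d
      using linear_cmul[OF has_derivative_linear[OF smooth_has_derivative[OF sm, of y]], of d e]
      by (simp add: partial_deriv_def e_def mult.commute)
    ultimately show ?thesis by (simp add: has_field_derivative_def)
  qed
  have bound: "\<bar>q n x\<bar> \<le> \<bar>B'\<bar> * indicat_real (cball 0 (r + 1)) x" for n x
  proof (cases "x \<in> cball 0 (r + 1)")
    case True
    have "\<exists>z>0. z < h n \<and> \<psi> (h n *\<^sub>R e + x) - \<psi> (0 *\<^sub>R e + x) = (h n - 0) * partial_deriv i \<psi> (z *\<^sub>R e + x)"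
      by (rule MVT2[OF h(1)]) (rule der)
    then show ?thesis using True h(1)[of n] B'0 by (auto simp: q_def abs_mult)
  next
    case False
    then have "norm x > r + 1" by simp
    moreover have "norm x \<le> norm (h n *\<^sub>R e + x) + norm (h n *\<^sub>R e)"
      using norm_triangle_ineq4[of "h n *\<^sub>R e + x" "h n *\<^sub>R e"] by simp
    moreover have "norm (h n *\<^sub>R e) \<le> 1" using h[of n] ne by simp
    ultimately have "\<psi> (h n *\<^sub>R e + x) = 0" "\<psi> x = 0" by (auto intro: zero)
    then show ?thesis by (simp add: q_def)
  qed
  have "(\<lambda>n. LINT x|lborel. q n x) \<longlonglongrightarrow> (LINT x|lborel. partial_deriv i \<psi> x)"
  proof (rule integral_dominated_convergence[where w="\<lambda>x. \<bar>B'\<bar> * indicat_real (cball 0 (r + 1)) x"])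
    show "integrable lborel (\<lambda>x::real^'n. \<bar>B'\<bar> * indicat_real (cball 0 (r + 1)) x)"
      using emeasure_bounded_finite[OF bounded_cball, of "0::real^'n" "r + 1"] by simp
    show "AE x in lborel. (\<lambda>n. q n x) \<longlonglongrightarrow> partial_deriv i \<psi> x"
    proof (rule AE_I2)
      fix x
      have "((\<lambda>s. (\<psi> ((0 + s) *\<^sub>R e + x) - \<psi> (0 *\<^sub>R e + x)) / s) \<longlongrightarrow> partial_deriv i \<psi> (0 *\<^sub>R e + x)) (at 0)"
        using der[of x 0] unfolding DERIV_def .
      moreover have "filterlim h (at 0) sequentially"
        unfolding filterlim_at h_def using LIMSEQ_inverse_real_of_nat by (auto intro!: always_eventually)
      ultimately have "((\<lambda>n. (\<psi> ((0 + h n) *\<^sub>R e + x) - \<psi> (0 *\<^sub>R e + x)) / h n) \<longlonglongrightarrow> partial_deriv i \<psi> (0 *\<^sub>R e + x))"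
        by (rule filterlim_compose)
      then show "(\<lambda>n. q n x) \<longlonglongrightarrow> partial_deriv i \<psi> x" by (simp add: q_def)
    qed
    show "q n \<in> borel_measurable lborel" for n unfolding q_def by measurable
    show "AE x in lborel. norm (q n x) \<le> \<bar>B'\<bar> * indicat_real (cball 0 (r + 1)) x" for n
      using bound by (intro AE_I2) simp
  qed measurable
  moreover have "(LINT x|lborel. q n x) = 0" for n
  proof -
    have i: "integrable lborel \<psi>"
      by (rule Bochner_Integration.integrable_bound[of lborel "\<lambda>x. B * indicat_real S x"])
        (use B S emeasure_bounded_finite[OF S(1)] in \<open>auto intro: order_trans[OF _ abs_ge_self]\<close>)
    have m: "(\<lambda>x. \<psi> (h n *\<^sub>R e + x)) \<in> borel_measurable lborel" by measurable
    have i': "integrable lborel (\<lambda>x. \<psi> (h n *\<^sub>R e + x))"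
      using integrable_distr[of "(+) (h n *\<^sub>R e)" lborel borel \<psi>] i by (simp add: lborel_distr_plus)
    show ?thesis
      unfolding q_def using lborel_integral_translation[of \<psi> "h n *\<^sub>R e"] i i' by simp
  qed
  ultimately show ?thesis by (simp add: LIMSEQ_const_iff)
qed

definition test_grad :: "(real^'n \<Rightarrow> real) \<Rightarrow> real^'n \<Rightarrow> complex^'n" where
  "test_grad \<psi> x = (\<chi> i. complex_of_real (partial_deriv i \<psi> x))"

lemma sq_integrable_test_grad:
  assumes "test_function \<psi>" shows "sq_integrable (test_grad \<psi>)"
proof -
  have s: "sq_integrable (\<lambda>x. complex_of_real (partial_deriv i \<psi> x))" for i
    by (rule sq_integrable_test_function[OF test_function_partial_deriv[OF assms]])
  have n: "(norm (test_grad \<psi> x))\<^sup>2 = (\<Sum>i\<in>UNIV. (norm (complex_of_real (partial_deriv i \<psi> x)))\<^sup>2)" for x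
    by (simp add: test_grad_def norm_vec_def L2_set_def sum_nonneg)
  show ?thesis
    unfolding sq_integrable_def n
  proof
    show "test_grad \<psi> \<in> borel_measurable lborel"
      unfolding test_grad_def by (rule measurable_vec_lambda) (use s in \<open>simp add: sq_integrable_def\<close>)
    show "integrable lborel (\<lambda>x. \<Sum>i\<in>UNIV. (norm (complex_of_real (partial_deriv i \<psi> x)))\<^sup>2)"
      by (rule Bochner_Integration.integrable_sum) (use s in \<open>simp add: sq_integrable_def\<close>)
  qed
qed

text \<open>
  Integration by parts is the vanishing of the integral of the derivative of the product.
\<close>

lemma weak_gradient_test_function:
  fixes \<psi> :: "real^'n \<Rightarrow> real"
  assumes t: "test_function \<psi>"
  shows "weak_gradient (\<lambda>x. complex_of_real (\<psi> x)) (test_grad \<psi>)"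
  unfolding weak_gradient_def
proof (intro allI impI)
  fix \<phi> :: "real^'n \<Rightarrow> real" and i assume p: "test_function \<phi>"
  let ?A = "LINT x|lborel. complex_of_real (\<psi> x) * complex_of_real (partial_deriv i \<phi> x)"
  let ?B = "LINT x|lborel. complex_of_real (partial_deriv i \<psi> x) * complex_of_real (\<phi> x)"
  have "?A + ?B = (LINT x|lborel. complex_of_real (\<psi> x) * complex_of_real (partial_deriv i \<phi> x) +
      complex_of_real (partial_deriv i \<psi> x) * complex_of_real (\<phi> x))"
    by (intro Bochner_Integration.integral_add[symmetric] test_mult_integrable sq_integrable_test_function
        test_function_partial_deriv p t)
  also have "\<dots> = (LINT x|lborel. complex_of_real (partial_deriv i (\<lambda>x. \<psi> x * \<phi> x) x))"
    by (simp add: partial_deriv_mult[OF test_function_smooth[OF t] test_function_smooth[OF p]])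
  also have "\<dots> = 0"
    using integral_partial_deriv_test_function[OF test_function_mult[OF t test_function_smooth[OF p]], of i]
    by (simp add: integral_complex_of_real)
  finally show "?A = - (LINT x|lborel. test_grad \<psi> x $ i * complex_of_real (\<phi> x))"
    by (simp add: test_grad_def eq_neg_iff_add_eq_0)
qed

lemma H1_fun_test_function:
  "test_function \<psi> \<Longrightarrow> H1_fun (\<lambda>x. complex_of_real (\<psi> x))"
  by (intro H1_funI[OF sq_integrable_test_function sq_integrable_test_grad weak_gradient_test_function])

definition test_h1 :: "(real^'n::finite \<Rightarrow> real) \<Rightarrow> 'n h1" where
  "test_h1 \<psi> = abs_h1 (\<lambda>x. complex_of_real (\<psi> x))"

lemma AE_rep_test_h1: "test_function \<psi> \<Longrightarrow> AE x in lborel. rep_h1 (test_h1 \<psi>) x = complex_of_real (\<psi> x)"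
  unfolding test_h1_def by (intro AE_rep_abs_h1 H1_fun_test_function)

lemma AE_grad_test_h1: "test_function \<psi> \<Longrightarrow> AE x in lborel. h1_grad (test_h1 \<psi>) x = test_grad \<psi> x"
  unfolding test_h1_def
  by (simp add: h1_grad_abs_h1 H1_fun_test_function grad_fun_unique sq_integrable_test_grad weak_gradient_test_function)

lemma L2norm_rep_test_h1: "test_function \<psi> \<Longrightarrow> L2norm (rep_h1 (test_h1 \<psi>)) = L2norm (\<lambda>x. complex_of_real (\<psi> x))"
  using sq_integrable_rep_h1(1)[of "test_h1 \<psi>"] sq_integrable_test_function[of \<psi>] AE_rep_test_h1[of \<psi>]
  by (intro L2norm_cong_AE) (simp_all add: sq_integrable_def)

lemma L2norm_grad_test_h1: "test_function \<psi> \<Longrightarrow> L2norm (h1_grad (test_h1 \<psi>)) = L2norm (test_grad \<psi>)"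
  using sq_integrable_rep_h1(2)[of "test_h1 \<psi>"] sq_integrable_test_grad[of \<psi>] AE_grad_test_h1[of \<psi>]
  by (intro L2norm_cong_AE) (simp_all add: sq_integrable_def)

lemma h1_by_parts:
  assumes "test_function \<phi>"
  shows "(LINT x|lborel. h1_grad g x $ i * complex_of_real (\<phi> x)) =
     - (LINT x|lborel. rep_h1 g x * complex_of_real (partial_deriv i \<phi> x))"
  using weak_gradient_h1_grad[of g] assms by (simp add: weak_gradient_def)

section \<open>Second-order forms with bounded coefficients\<close>

definition div_form :: "(real^'n \<Rightarrow> complex^'n^'n) \<Rightarrow> (real^'n \<Rightarrow> complex) \<Rightarrow> 'n::finite h1 \<Rightarrow> 'n h1 \<Rightarrow> complex" where
  "div_form A c u v = (LINT x|lborel. cdot (A x *v h1_grad u x) (h1_grad v x)) +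
     (LINT x|lborel. c x * rep_h1 u x * cnj (rep_h1 v x))"

definition bounded_coeff :: "(real^'n \<Rightarrow> complex) \<Rightarrow> bool" where
  "bounded_coeff m \<longleftrightarrow> m \<in> borel_measurable lborel \<and> (\<exists>M. AE x in lborel. norm (m x) \<le> M)"

lemma measurable_cnj: "f \<in> borel_measurable lborel \<Longrightarrow> (\<lambda>x. cnj (f x)) \<in> borel_measurable lborel"
  by (rule borel_measurable_continuous_on[where f=cnj]) (auto intro!: continuous_intros)

lemma sq_integrable_cnj:
  assumes "sq_integrable f" shows "sq_integrable (\<lambda>x. cnj (f x))"
proof (rule sq_integrable_dominated[OF assms, where C=1])
  show "(\<lambda>x. cnj (f x)) \<in> borel_measurable lborel"
    using assms unfolding sq_integrable_def by (blast intro: measurable_cnj)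
qed simp

lemma L2norm_cnj: "L2norm (\<lambda>x. cnj (f x)) = L2norm f"
  by (simp add: L2norm_def)

lemma L2norm_nth_le:
  fixes g :: "real^'m \<Rightarrow> complex^'n"
  assumes "sq_integrable g" shows "L2norm (\<lambda>x. g x $ i) \<le> L2norm g"
proof (rule L2norm_mono[OF assms])
  show "(\<lambda>x. g x $ i) \<in> borel_measurable lborel"
    using sq_integrable_nth[OF assms] by (simp add: sq_integrable_def)
  show "norm (g x $ i) \<le> norm (g x)" for x by (rule Finite_Cartesian_Product.norm_nth_le)
qed

lemma coeff_integral_bound:
  fixes m u v :: "real^'n \<Rightarrow> complex"
  assumes m: "m \<in> borel_measurable lborel" "AE x in lborel. norm (m x) \<le> M" "0 \<le> M"
    and sq: "sq_integrable u" "sq_integrable v"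
  shows "integrable lborel (\<lambda>x. m x * u x * v x)"
    and "norm (LINT x|lborel. m x * u x * v x) \<le> M * (L2norm u * L2norm v)"
proof -
  have [measurable]: "m \<in> borel_measurable lborel" "u \<in> borel_measurable lborel" "v \<in> borel_measurable lborel"
    using m sq by (auto simp: sq_integrable_def)
  have iM: "integrable lborel (\<lambda>x. M * (norm (u x) * norm (v x)))"
    using sq_integrable_norm_mult[OF sq] by simp
  have ae: "AE x in lborel. norm (m x * u x * v x) \<le> M * (norm (u x) * norm (v x))"
    using m(2)
  proof eventually_elim
    case (elim x)
    show ?case using mult_right_mono[OF elim, of "norm (u x) * norm (v x)"] by (simp add: norm_mult mult.assoc)
  qed
  show i: "integrable lborel (\<lambda>x. m x * u x * v x)"
  proof (rule Bochner_Integration.integrable_bound[OF iM])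
    show "AE x in lborel. norm (m x * u x * v x) \<le> norm (M * (norm (u x) * norm (v x)))"
      using ae by eventually_elim simp
  qed measurable
  have "norm (LINT x|lborel. m x * u x * v x) \<le> (LINT x|lborel. norm (m x * u x * v x))"
    by (rule integral_norm_bound)
  also have "\<dots> \<le> (LINT x|lborel. M * (norm (u x) * norm (v x)))"
    by (rule integral_mono_AE[OF integrable_norm[OF i] iM ae])
  also have "\<dots> = M * (LINT x|lborel. norm (u x) * norm (v x))" by simp
  also have "\<dots> \<le> M * (L2norm u * L2norm v)"
    by (intro mult_left_mono L2_Cauchy_Schwarz sq m)
  finally show "norm (LINT x|lborel. m x * u x * v x) \<le> M * (L2norm u * L2norm v)" .
qed

lemma bounded_coeffE:
  assumes "bounded_coeff m"
  obtains M where "m \<in> borel_measurable lborel" "AE x in lborel. norm (m x) \<le> M" "0 \<le> M"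
proof -
  obtain M where M: "AE x in lborel. norm (m x) \<le> M" using assms by (auto simp: bounded_coeff_def)
  then have "AE x in lborel. norm (m x) \<le> max M 0" by eventually_elim simp
  then show ?thesis using that[of "max M 0"] assms by (simp add: bounded_coeff_def)
qed

lemma bounded_coeff_integrable:
  "bounded_coeff m \<Longrightarrow> sq_integrable u \<Longrightarrow> sq_integrable v \<Longrightarrow> integrable lborel (\<lambda>x. m x * u x * v x)"
  by (rule bounded_coeffE) (auto intro: coeff_integral_bound(1)[simplified])

lemma sq_grad_nth: "sq_integrable (\<lambda>x. h1_grad u x $ i)"
  by (rule sq_integrable_nth[OF sq_integrable_rep_h1(2)])

lemma L2norm_grad_nth_le: "L2norm (\<lambda>x. h1_grad u x $ i) \<le> norm u"
  by (rule order_trans[OF L2norm_nth_le[OF sq_integrable_rep_h1(2)] L2norm_rep_le(2)])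

lemma div_form_eq:
  assumes "\<And>i j. bounded_coeff (\<lambda>x. A x $ i $ j)"
  shows "div_form A c u v =
    (\<Sum>i\<in>UNIV. \<Sum>j\<in>UNIV. (LINT x|lborel. A x $ i $ j * h1_grad u x $ j * cnj (h1_grad v x $ i))) +
    (LINT x|lborel. c x * rep_h1 u x * cnj (rep_h1 v x))"
proof -
  have "(LINT x|lborel. cdot (A x *v h1_grad u x) (h1_grad v x)) =
    (LINT x|lborel. (\<Sum>i\<in>UNIV. \<Sum>j\<in>UNIV. A x $ i $ j * h1_grad u x $ j * cnj (h1_grad v x $ i)))"
    by (simp add: cdot_def matrix_vector_mult_def sum_distrib_right)
  also have "\<dots> = (\<Sum>i\<in>UNIV. \<Sum>j\<in>UNIV. (LINT x|lborel. A x $ i $ j * h1_grad u x $ j * cnj (h1_grad v x $ i)))"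
    by (subst Bochner_Integration.integral_sum Bochner_Integration.integral_sum,
        intro Bochner_Integration.integrable_sum bounded_coeff_integrable assms sq_grad_nth sq_integrable_cnj)+ simp
  finally show ?thesis by (simp add: div_form_def)
qed

lemma bounded_coeff_const: "bounded_coeff (\<lambda>x. k)"
  by (auto simp: bounded_coeff_def)

lemma bounded_coeff_add: "bounded_coeff f \<Longrightarrow> bounded_coeff g \<Longrightarrow> bounded_coeff (\<lambda>x. f x + g x)"
proof -
  assume f: "bounded_coeff f" and g: "bounded_coeff g"
  obtain M where M: "f \<in> borel_measurable lborel" "AE x in lborel. norm (f x) \<le> M" "0 \<le> M" using bounded_coeffE[OF f] .
  obtain N where N: "g \<in> borel_measurable lborel" "AE x in lborel. norm (g x) \<le> N" "0 \<le> N" using bounded_coeffE[OF g] .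
  have "AE x in lborel. norm (f x + g x) \<le> M + N"
    using M(2) N(2) by eventually_elim (rule order_trans[OF norm_triangle_ineq add_mono])
  then show ?thesis using M(1) N(1) unfolding bounded_coeff_def by (auto intro: borel_measurable_add)
qed

lemma bounded_coeff_mult: "bounded_coeff f \<Longrightarrow> bounded_coeff g \<Longrightarrow> bounded_coeff (\<lambda>x. f x * g x)"
proof -
  assume f: "bounded_coeff f" and g: "bounded_coeff g"
  obtain M where M: "f \<in> borel_measurable lborel" "AE x in lborel. norm (f x) \<le> M" "0 \<le> M" using bounded_coeffE[OF f] .
  obtain N where N: "g \<in> borel_measurable lborel" "AE x in lborel. norm (g x) \<le> N" "0 \<le> N" using bounded_coeffE[OF g] .
  have "AE x in lborel. norm (f x * g x) \<le> M * N"
    using M(2) N(2) by eventually_elim (auto simp: norm_mult intro!: mult_mono M(3))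
  then show ?thesis using M(1) N(1) unfolding bounded_coeff_def by (auto intro: borel_measurable_times)
qed

lemma bounded_coeff_diff: "bounded_coeff f \<Longrightarrow> bounded_coeff g \<Longrightarrow> bounded_coeff (\<lambda>x. f x - g x)"
  using bounded_coeff_add[OF _ bounded_coeff_mult[OF bounded_coeff_const[of "-1"]], of f g] by simp

lemma bounded_coeff_power: "bounded_coeff f \<Longrightarrow> bounded_coeff (\<lambda>x. f x ^ n)"
  by (induction n) (simp_all add: bounded_coeff_const bounded_coeff_mult)

definition bounded_sesquilinear_form :: "('n::finite h1 \<Rightarrow> 'n h1 \<Rightarrow> complex) \<Rightarrow> bool" where
  "bounded_sesquilinear_form a \<longleftrightarrow>
     (\<forall>u u' v. a (u + u') v = a u v + a u' v) \<and> (\<forall>u v v'. a u (v + v') = a u v + a u v') \<and>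
     (\<forall>c u v. a (h1_scaleC c u) v = c * a u v) \<and> (\<forall>c u v. a u (h1_scaleC c v) = cnj c * a u v) \<and>
     (\<exists>C. \<forall>u v. norm (a u v) \<le> C * norm u * norm v)"

lemma bounded_sesquilinear_form_is_riesz_rep:
  assumes "bounded_sesquilinear_form a" shows "\<exists>T. is_riesz_rep a T"
proof -
  obtain C where "\<And>u v. norm (a u v) \<le> C * norm u * norm v"
    using assms unfolding bounded_sesquilinear_form_def by blast
  then show ?thesis
    using assms unfolding bounded_sesquilinear_form_def by (intro is_riesz_rep_exists[of a C]) blast+
qed

lemma bounded_sesquilinear_form_add:
  assumes "bounded_sesquilinear_form a" "bounded_sesquilinear_form b"
  shows "bounded_sesquilinear_form (\<lambda>u v. a u v + b u v)"
proof -
  obtain C where C: "\<And>u v. norm (a u v) \<le> C * norm u * norm v"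
    using assms(1) unfolding bounded_sesquilinear_form_def by blast
  obtain D where D: "\<And>u v. norm (b u v) \<le> D * norm u * norm v"
    using assms(2) unfolding bounded_sesquilinear_form_def by blast
  have "norm (a u v + b u v) \<le> (C + D) * norm u * norm v" for u v
    using norm_triangle_ineq[of "a u v" "b u v"] C[of u v] D[of u v] by (simp add: algebra_simps)
  then have "\<exists>C. \<forall>u v. norm (a u v + b u v) \<le> C * norm u * norm v" by blast
  then show ?thesis
    using assms unfolding bounded_sesquilinear_form_def by (simp add: algebra_simps)
qed

lemma bounded_sesquilinear_form_0: "bounded_sesquilinear_form (\<lambda>u v. 0)"
  by (auto simp: bounded_sesquilinear_form_def intro: exI[of _ 0])

lemma bounded_sesquilinear_form_sum:
  assumes "finite I" "\<And>i. i \<in> I \<Longrightarrow> bounded_sesquilinear_form (a i)"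
  shows "bounded_sesquilinear_form (\<lambda>u v. \<Sum>i\<in>I. a i u v)"
  using assms by (induction I rule: finite_induct)
    (simp_all add: bounded_sesquilinear_form_0 bounded_sesquilinear_form_add)

text \<open>
  The property that \<open>u \<mapsto> u\<close> and all the maps \<open>u \<mapsto> \<partial>\<^sub>i u\<close> share, so that every term of a
  second-order form is covered by the same argument.
\<close>

definition h1_component :: "('n::finite h1 \<Rightarrow> real^'n \<Rightarrow> complex) \<Rightarrow> bool" where
  "h1_component U \<longleftrightarrow> (\<forall>u. sq_integrable (U u) \<and> L2norm (U u) \<le> norm u) \<and>
     (\<forall>u v. AE x in lborel. U (u + v) x = U u x + U v x) \<and>
     (\<forall>c u. AE x in lborel. U (h1_scaleC c u) x = c * U u x)"

lemma h1_component_rep: "h1_component rep_h1"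
  by (simp add: h1_component_def sq_integrable_rep_h1 L2norm_rep_le AE_rep_add AE_rep_scaleC)

lemma h1_component_grad: "h1_component (\<lambda>u x. h1_grad u x $ i)"
  unfolding h1_component_def
proof (intro conjI allI)
  fix u v :: "'a h1" and c
  show "AE x in lborel. h1_grad (u + v) x $ i = h1_grad u x $ i + h1_grad v x $ i"
    using AE_h1_grad_add[of u v] by eventually_elim simp
  show "AE x in lborel. h1_grad (h1_scaleC c u) x $ i = c * h1_grad u x $ i"
    using AE_h1_grad_scaleC[of c u] by eventually_elim simp
qed (rule sq_grad_nth L2norm_grad_nth_le)+

lemma bounded_sesquilinear_form_coeff:
  assumes m: "bounded_coeff m" and U: "h1_component U" and V: "h1_component V"
  shows "bounded_sesquilinear_form (\<lambda>u v. LINT x|lborel. m x * U u x * cnj (V v x))"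
proof -
  obtain M where M: "m \<in> borel_measurable lborel" "AE x in lborel. norm (m x) \<le> M" "0 \<le> M"
    using bounded_coeffE[OF m] .
  have sq: "sq_integrable (U u)" "sq_integrable (\<lambda>x. cnj (V u x))" for u
    using U V by (auto simp: h1_component_def intro: sq_integrable_cnj)
  have int: "integrable lborel (\<lambda>x. m x * U u x * cnj (V v x))" for u v
    by (rule bounded_coeff_integrable[OF m sq])
  have meas: "(\<lambda>x. m x * U u x * cnj (V v x)) \<in> borel_measurable lborel" for u v
    by (rule borel_measurable_integrable[OF int])
  have 1: "(LINT x|lborel. m x * U (u + u') x * cnj (V v x)) =
      (LINT x|lborel. m x * U u x * cnj (V v x)) + (LINT x|lborel. m x * U u' x * cnj (V v x))" for u u' v
  proof -
    have "AE x in lborel. U (u + u') x = U u x + U u' x" using U unfolding h1_component_def by blast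
    then have "AE x in lborel. m x * U (u + u') x * cnj (V v x) = m x * U u x * cnj (V v x) + m x * U u' x * cnj (V v x)"
      by eventually_elim (simp add: algebra_simps)
    then have "(LINT x|lborel. m x * U (u + u') x * cnj (V v x)) =
        (LINT x|lborel. m x * U u x * cnj (V v x) + m x * U u' x * cnj (V v x))"
      by (intro integral_cong_AE meas borel_measurable_add) 
    then show ?thesis using int by simp
  qed
  have 2: "(LINT x|lborel. m x * U u x * cnj (V (v + v') x)) =
      (LINT x|lborel. m x * U u x * cnj (V v x)) + (LINT x|lborel. m x * U u x * cnj (V v' x))" for u v v'
  proof -
    have "AE x in lborel. V (v + v') x = V v x + V v' x" using V unfolding h1_component_def by blast
    then have "AE x in lborel. m x * U u x * cnj (V (v + v') x) = m x * U u x * cnj (V v x) + m x * U u x * cnj (V v' x)"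
      by eventually_elim (simp add: algebra_simps)
    then have "(LINT x|lborel. m x * U u x * cnj (V (v + v') x)) =
        (LINT x|lborel. m x * U u x * cnj (V v x) + m x * U u x * cnj (V v' x))"
      by (intro integral_cong_AE meas borel_measurable_add)
    then show ?thesis using int by simp
  qed
  have 3: "(LINT x|lborel. m x * U (h1_scaleC c u) x * cnj (V v x)) = c * (LINT x|lborel. m x * U u x * cnj (V v x))" for c u v
  proof -
    have "AE x in lborel. U (h1_scaleC c u) x = c * U u x" using U unfolding h1_component_def by blast
    then have "AE x in lborel. m x * U (h1_scaleC c u) x * cnj (V v x) = c * (m x * U u x * cnj (V v x))"
      by eventually_elim (simp add: algebra_simps)
    then have "(LINT x|lborel. m x * U (h1_scaleC c u) x * cnj (V v x)) = (LINT x|lborel. c * (m x * U u x * cnj (V v x)))"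
      by (intro integral_cong_AE meas borel_measurable_times borel_measurable_const)
    then show ?thesis by simp
  qed
  have 4: "(LINT x|lborel. m x * U u x * cnj (V (h1_scaleC c v) x)) = cnj c * (LINT x|lborel. m x * U u x * cnj (V v x))" for c u v
  proof -
    have "AE x in lborel. V (h1_scaleC c v) x = c * V v x" using V unfolding h1_component_def by blast
    then have "AE x in lborel. m x * U u x * cnj (V (h1_scaleC c v) x) = cnj c * (m x * U u x * cnj (V v x))"
      by eventually_elim (simp add: algebra_simps)
    then have "(LINT x|lborel. m x * U u x * cnj (V (h1_scaleC c v) x)) = (LINT x|lborel. cnj c * (m x * U u x * cnj (V v x)))"
      by (intro integral_cong_AE meas borel_measurable_times borel_measurable_const)
    then show ?thesis by simp
  qed
  have 5: "norm (LINT x|lborel. m x * U u x * cnj (V v x)) \<le> M * norm u * norm v" for u v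
  proof -
    have "norm (LINT x|lborel. m x * U u x * cnj (V v x)) \<le> M * (L2norm (U u) * L2norm (V v))"
      using coeff_integral_bound(2)[OF M sq, of u v] unfolding L2norm_cnj .
    also have "\<dots> \<le> M * (norm u * norm v)"
      using U V M(3) by (intro mult_left_mono mult_mono) (auto simp: h1_component_def L2norm_nonneg)
    finally show ?thesis by (simp add: mult.assoc)
  qed
  show ?thesis
    unfolding bounded_sesquilinear_form_def using 1 2 3 4 5 by blast
qed

lemma div_form_has_riesz_rep:
  assumes "\<And>i j. bounded_coeff (\<lambda>x. A x $ i $ j)" "bounded_coeff c"
  shows "\<exists>T. is_riesz_rep (div_form A c) T"
proof -
  have "bounded_sesquilinear_form (\<lambda>u v.
      (\<Sum>i\<in>UNIV. \<Sum>j\<in>UNIV. (LINT x|lborel. A x $ i $ j * h1_grad u x $ j * cnj (h1_grad v x $ i))) +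
      (LINT x|lborel. c x * rep_h1 u x * cnj (rep_h1 v x)))"
  proof (rule bounded_sesquilinear_form_add)
    show "bounded_sesquilinear_form (\<lambda>u v. LINT x|lborel. c x * rep_h1 u x * cnj (rep_h1 v x))"
      by (rule bounded_sesquilinear_form_coeff[OF assms(2) h1_component_rep h1_component_rep])
    show "bounded_sesquilinear_form (\<lambda>u v.
      \<Sum>i\<in>UNIV. \<Sum>j\<in>UNIV. (LINT x|lborel. A x $ i $ j * h1_grad u x $ j * cnj (h1_grad v x $ i)))"
    proof (rule bounded_sesquilinear_form_sum[OF finite], rule bounded_sesquilinear_form_sum[OF finite])
      show "bounded_sesquilinear_form (\<lambda>u v. LINT x|lborel. A x $ i $ j * h1_grad u x $ j * cnj (h1_grad v x $ i))" for i j
        by (rule bounded_sesquilinear_form_coeff[OF assms(1) h1_component_grad h1_component_grad])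
    qed
  qed
  moreover have "div_form A c = (\<lambda>u v.
      (\<Sum>i\<in>UNIV. \<Sum>j\<in>UNIV. (LINT x|lborel. A x $ i $ j * h1_grad u x $ j * cnj (h1_grad v x $ i))) +
      (LINT x|lborel. c x * rep_h1 u x * cnj (rep_h1 v x)))"
    using div_form_eq[OF assms(1)] by (intro ext)
  ultimately show ?thesis by (simp only: bounded_sesquilinear_form_is_riesz_rep)
qed

section \<open>Wave packets\<close>

lemma test_wave_bound:
  assumes f: "sq_integrable f" and t: "test_function \<psi>" and b: "smooth_fun b" "\<And>x. \<bar>b x\<bar> \<le> 1"
  shows "norm (LINT x|lborel. f x * complex_of_real (\<psi> x * b x)) \<le> L2norm f * L2norm (\<lambda>x. complex_of_real (\<psi> x))"
proof -
  note tb = test_function_mult[OF t b(1)]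
  have "norm (LINT x|lborel. f x * complex_of_real (\<psi> x * b x)) \<le> L2norm f * L2norm (\<lambda>x. complex_of_real (\<psi> x * b x))"
    by (rule L2_norm_integral_le[OF f sq_integrable_test_function[OF tb]])
  also have "\<dots> \<le> L2norm f * L2norm (\<lambda>x. complex_of_real (\<psi> x))"
  proof (intro mult_left_mono L2norm_nonneg L2norm_mono sq_integrable_test_function t)
    show "(\<lambda>x. complex_of_real (\<psi> x * b x)) \<in> borel_measurable lborel"
      using sq_integrable_test_function[OF tb] by (simp add: sq_integrable_def)
    show "norm (complex_of_real (\<psi> x * b x)) \<le> norm (complex_of_real (\<psi> x))" for x
      using b(2)[of x] by (simp add: abs_mult mult_left_le norm_mult)
  qed
  finally show ?thesis .
qed

text \<open>
  The factor \<open>k\<close> is the derivative of the oscillation: up to the factor \<open>\<xi> $ l\<close>, the function \<open>k sin\<close> is minus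
  the derivative of \<open>cos\<close> in direction \<open>l\<close>. Integrating by parts moves this derivative to \<open>g\<close> and \<open>\<psi>\<close>,
  and the bound is uniform in \<open>k\<close>.
\<close>

lemma oscillation_bound:
  fixes \<psi> :: "real^'n::finite \<Rightarrow> real"
  assumes t: "test_function \<psi>" and "\<xi> \<noteq> 0"
  shows "\<exists>K. \<forall>g k b. norm (complex_of_real k * (LINT x|lborel. rep_h1 g x * complex_of_real (\<psi> x * sin ((k *\<^sub>R \<xi>) \<bullet> x + b)))) \<le> K * norm g"
proof -
  obtain l where l: "\<xi> $ l \<noteq> 0" using assms(2) by (auto simp: vec_eq_iff)
  note t' = test_function_partial_deriv[OF t, of l]
  let ?N = "\<lambda>\<psi>. L2norm (\<lambda>x. complex_of_real (\<psi> x))"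
  have "norm (complex_of_real k * (LINT x|lborel. rep_h1 g x * complex_of_real (\<psi> x * sin ((k *\<^sub>R \<xi>) \<bullet> x + b))))
      \<le> ((?N (partial_deriv l \<psi>) + ?N \<psi>) / \<bar>\<xi> $ l\<bar>) * norm g" for g k b
  proof -
    define a where "a = k *\<^sub>R \<xi>"
    let ?S = "\<lambda>x. sin (a \<bullet> x + b)" and ?C = "\<lambda>x. cos (a \<bullet> x + b)"
    let ?I = "LINT x|lborel. rep_h1 g x * complex_of_real (\<psi> x * ?S x)"
    let ?I1 = "LINT x|lborel. rep_h1 g x * complex_of_real (partial_deriv l \<psi> x * ?C x)"
    let ?I2 = "LINT x|lborel. h1_grad g x $ l * complex_of_real (\<psi> x * ?C x)"
    note tC = test_function_mult[OF t smooth_cos_plane[of a b]]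
      and tS = test_function_mult[OF t smooth_sin_plane[of a b]]
      and tC' = test_function_mult[OF t' smooth_cos_plane[of a b]]
    have pd: "partial_deriv l (\<lambda>x. \<psi> x * ?C x) x = partial_deriv l \<psi> x * ?C x - a $ l * (\<psi> x * ?S x)" for x
      using partial_deriv_mult[OF test_function_smooth[OF t] smooth_cos_plane, of l a b x]
      unfolding partial_deriv_cos_plane by simp
    have "?I2 = - (LINT x|lborel. rep_h1 g x * complex_of_real (partial_deriv l \<psi> x * ?C x) -
        complex_of_real (a $ l) * (rep_h1 g x * complex_of_real (\<psi> x * ?S x)))"
      unfolding h1_by_parts[OF tC] pd by (simp add: algebra_simps)
    also have "\<dots> = - (?I1 - complex_of_real (a $ l) * ?I)"
      using test_mult_integrable[OF sq_integrable_rep_h1(1) tC'] test_mult_integrable[OF sq_integrable_rep_h1(1) tS]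
      by (subst Bochner_Integration.integral_diff) auto
    finally have "complex_of_real (a $ l) * ?I = ?I1 + ?I2" by simp
    then have eq: "complex_of_real (\<xi> $ l) * (complex_of_real k * ?I) = ?I1 + ?I2" by (simp add: a_def mult_ac)
    have "\<bar>\<xi> $ l\<bar> * norm (complex_of_real k * ?I) = norm (?I1 + ?I2)" unfolding eq[symmetric] norm_mult by simp
    also have "\<dots> \<le> norm ?I1 + norm ?I2" by (rule norm_triangle_ineq)
    also have "\<dots> \<le> L2norm (rep_h1 g) * ?N (partial_deriv l \<psi>) + L2norm (\<lambda>x. h1_grad g x $ l) * ?N \<psi>"
      by (intro add_mono test_wave_bound sq_integrable_rep_h1 sq_grad_nth t t' smooth_cos_plane) auto
    also have "\<dots> \<le> norm g * ?N (partial_deriv l \<psi>) + norm g * ?N \<psi>"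
      by (intro add_mono mult_right_mono L2norm_nonneg L2norm_rep_le L2norm_grad_nth_le)
    finally show ?thesis using l unfolding a_def by (simp add: field_simps)
  qed
  then show ?thesis by blast
qed

definition wave_packet :: "(real^'n \<Rightarrow> real) \<Rightarrow> real^'n \<Rightarrow> real \<Rightarrow> real^'n \<Rightarrow> real" where
  "wave_packet \<eta> a b x = \<eta> x * cos (a \<bullet> x + b)"

lemma test_function_wave_packet: "test_function \<eta> \<Longrightarrow> test_function (wave_packet \<eta> a b)"
  unfolding wave_packet_def[abs_def] by (rule test_function_mult[OF _ smooth_cos_plane])

lemma partial_deriv_wave_packet:
  assumes "test_function \<eta>"
  shows "partial_deriv i (wave_packet \<eta> a b) x =
    partial_deriv i \<eta> x * cos (a \<bullet> x + b) - a $ i * (\<eta> x * sin (a \<bullet> x + b))"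
  using partial_deriv_mult[OF test_function_smooth[OF assms] smooth_cos_plane, of i a b x]
  unfolding partial_deriv_cos_plane wave_packet_def[abs_def] by simp

text \<open>
  For one pair of indices, the form with constant coefficients on \<open>g\<close> and a wave packet is a term
  proportional to \<open>k\<^sup>2 * \<xi> $ i * \<xi> $ j\<close> plus a remainder that is bounded uniformly in \<open>k\<close>. The
  leading terms cancel upon contraction with a matrix whose quadratic form vanishes at \<open>\<xi>\<close>. The remainder
  contains only one power of \<open>k\<close>, in a term that \<open>oscillation_bound\<close> controls.
\<close>

lemma wave_packet_form_bound:
  fixes \<eta> :: "real^'n::finite \<Rightarrow> real"
  assumes t: "test_function \<eta>" and xi: "\<xi> \<noteq> 0"
  shows "\<exists>K. \<forall>g k b. norm ((LINT x|lborel. h1_grad g x $ j * complex_of_real (partial_deriv i (wave_packet \<eta> (k *\<^sub>R \<xi>) b) x))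
     - complex_of_real (k\<^sup>2 * (\<xi> $ i * \<xi> $ j)) * (LINT x|lborel. rep_h1 g x * complex_of_real (wave_packet \<eta> (k *\<^sub>R \<xi>) b x))) \<le> K * norm g"
proof -
  note ti = test_function_partial_deriv[OF t, of i] and tj = test_function_partial_deriv[OF t, of j]
  let ?N = "\<lambda>\<psi>. L2norm (\<lambda>x. complex_of_real (\<psi> x))"
  obtain K where K: "\<And>g k b. norm (complex_of_real k * (LINT x|lborel. rep_h1 g x *
      complex_of_real (partial_deriv j \<eta> x * sin ((k *\<^sub>R \<xi>) \<bullet> x + b)))) \<le> K * norm g"
    using oscillation_bound[OF tj xi] by blast
  have "norm ((LINT x|lborel. h1_grad g x $ j * complex_of_real (partial_deriv i (wave_packet \<eta> (k *\<^sub>R \<xi>) b) x))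
     - complex_of_real (k\<^sup>2 * (\<xi> $ i * \<xi> $ j)) * (LINT x|lborel. rep_h1 g x * complex_of_real (wave_packet \<eta> (k *\<^sub>R \<xi>) b x)))
     \<le> (?N (partial_deriv i \<eta>) + \<bar>\<xi> $ i\<bar> * K) * norm g" for g k b
  proof -
    define a where "a = k *\<^sub>R \<xi>"
    let ?S = "\<lambda>x. sin (a \<bullet> x + b)" and ?C = "\<lambda>x. cos (a \<bullet> x + b)"
    let ?I1 = "LINT x|lborel. h1_grad g x $ j * complex_of_real (partial_deriv i \<eta> x * ?C x)"
    let ?I2 = "LINT x|lborel. h1_grad g x $ j * complex_of_real (\<eta> x * ?S x)"
    let ?I3 = "LINT x|lborel. rep_h1 g x * complex_of_real (partial_deriv j \<eta> x * ?S x)"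
    let ?I4 = "LINT x|lborel. rep_h1 g x * complex_of_real (wave_packet \<eta> a b x)"
    note tC = test_function_mult[OF t smooth_cos_plane[of a b]]
      and tS = test_function_mult[OF t smooth_sin_plane[of a b]]
      and tC' = test_function_mult[OF ti smooth_cos_plane[of a b]]
      and tS' = test_function_mult[OF tj smooth_sin_plane[of a b]]
    have 1: "(LINT x|lborel. h1_grad g x $ j * complex_of_real (partial_deriv i (wave_packet \<eta> a b) x))
        = ?I1 - complex_of_real (a $ i) * ?I2"
    proof -
      have "(LINT x|lborel. h1_grad g x $ j * complex_of_real (partial_deriv i (wave_packet \<eta> a b) x)) =
        (LINT x|lborel. h1_grad g x $ j * complex_of_real (partial_deriv i \<eta> x * ?C x) -
           complex_of_real (a $ i) * (h1_grad g x $ j * complex_of_real (\<eta> x * ?S x)))"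
        unfolding partial_deriv_wave_packet[OF t] by (simp add: algebra_simps)
      also have "\<dots> = ?I1 - complex_of_real (a $ i) * ?I2"
        using test_mult_integrable[OF sq_grad_nth tC'] test_mult_integrable[OF sq_grad_nth tS]
        by (subst Bochner_Integration.integral_diff) auto
      finally show ?thesis .
    qed
    have pd: "partial_deriv j (\<lambda>x. \<eta> x * ?S x) x = partial_deriv j \<eta> x * ?S x + a $ j * wave_packet \<eta> a b x" for x
      using partial_deriv_mult[OF test_function_smooth[OF t] smooth_sin_plane, of j a b x]
      unfolding partial_deriv_sin_plane wave_packet_def by simp
    have 2: "?I2 = - (?I3 + complex_of_real (a $ j) * ?I4)"
    proof -
      have "?I2 = - (LINT x|lborel. rep_h1 g x * complex_of_real (partial_deriv j \<eta> x * ?S x) +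
          complex_of_real (a $ j) * (rep_h1 g x * complex_of_real (wave_packet \<eta> a b x)))"
        unfolding h1_by_parts[OF tS] pd by (simp add: algebra_simps)
      also have "\<dots> = - (?I3 + complex_of_real (a $ j) * ?I4)"
        using test_mult_integrable[OF sq_integrable_rep_h1(1) tS']
          test_mult_integrable[OF sq_integrable_rep_h1(1) test_function_wave_packet[OF t]]
        by (subst Bochner_Integration.integral_add) auto
      finally show ?thesis .
    qed
    have "(LINT x|lborel. h1_grad g x $ j * complex_of_real (partial_deriv i (wave_packet \<eta> a b) x))
      - complex_of_real (k\<^sup>2 * (\<xi> $ i * \<xi> $ j)) * ?I4 = ?I1 + complex_of_real (\<xi> $ i) * (complex_of_real k * ?I3)"
      unfolding 1 2 by (simp add: a_def power2_eq_square algebra_simps)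
    also have "norm \<dots> \<le> norm ?I1 + norm (complex_of_real (\<xi> $ i) * (complex_of_real k * ?I3))"
      by (rule norm_triangle_ineq)
    also have "\<dots> \<le> L2norm (\<lambda>x. h1_grad g x $ j) * ?N (partial_deriv i \<eta>) + \<bar>\<xi> $ i\<bar> * (K * norm g)"
    proof (rule add_mono)
      show "norm ?I1 \<le> L2norm (\<lambda>x. h1_grad g x $ j) * ?N (partial_deriv i \<eta>)"
        by (rule test_wave_bound[OF sq_grad_nth ti smooth_cos_plane]) simp
      show "norm (complex_of_real (\<xi> $ i) * (complex_of_real k * ?I3)) \<le> \<bar>\<xi> $ i\<bar> * (K * norm g)"
        using mult_left_mono[OF K[of k g b], of "\<bar>\<xi> $ i\<bar>"] unfolding a_def[symmetric] norm_mult[of "complex_of_real (\<xi> $ i)"] by simp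
    qed
    also have "\<dots> \<le> norm g * ?N (partial_deriv i \<eta>) + \<bar>\<xi> $ i\<bar> * (K * norm g)"
      by (intro add_right_mono mult_right_mono L2norm_nonneg L2norm_grad_nth_le)
    finally show ?thesis unfolding a_def by (simp add: algebra_simps)
  qed
  then show ?thesis by blast
qed

text \<open>
  The gradient of the packet is about \<open>k \<xi> \<eta> sin\<close>. Its L2 norm could be small because of the sine, but
  shifting the phase by \<open>pi / 2\<close> replaces the sine by the cosine, and the squares of the two add
  up to \<open>1\<close>. Hence at least one of the phases \<open>0\<close> and \<open>pi / 2\<close> gives a large norm.
\<close>

lemma wave_packet_norm_unbounded:
  fixes \<eta> :: "real^'n::finite \<Rightarrow> real"
  assumes t: "test_function \<eta>" and xi: "\<xi> \<noteq> 0" and ne: "L2norm (\<lambda>x. complex_of_real (\<eta> x)) > 0"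
  shows "\<exists>k b. norm (test_h1 (wave_packet \<eta> (k *\<^sub>R \<xi>) b)) \<ge> Y"
proof -
  obtain l where l: "\<xi> $ l \<noteq> 0" using xi by (auto simp: vec_eq_iff)
  note t' = test_function_partial_deriv[OF t, of l]
  have sqi: "integrable lborel (\<lambda>x. (\<psi> x)\<^sup>2)" if "test_function \<psi>" for \<psi> :: "real^'n \<Rightarrow> real"
    using sq_integrable_test_function[OF that] by (simp add: sq_integrable_def)
  define P Q where "P = (LINT x|lborel. (\<eta> x)\<^sup>2)" and "Q = (LINT x|lborel. (partial_deriv l \<eta> x)\<^sup>2)"
  have P: "P > 0" using ne by (simp add: P_def L2norm_def)
  have Q: "Q \<ge> 0" by (simp add: Q_def)
  \<comment> \<open>With this k, the lower bound for the sum of the two squared norms is 2 Y^2.\<close>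
  define k where "k = sqrt (4 * (Y\<^sup>2 + Q) / ((\<xi> $ l)\<^sup>2 * P))"
  have k2: "k\<^sup>2 * (\<xi> $ l)\<^sup>2 * P = 4 * (Y\<^sup>2 + Q)"
    using P Q l by (simp add: k_def field_simps)
  define w where "w b = wave_packet \<eta> (k *\<^sub>R \<xi>) b" for b
  have tw: "test_function (w b)" for b unfolding w_def by (rule test_function_wave_packet[OF t])
  note tw' = test_function_partial_deriv[OF tw, of l]
  have lower: "(LINT x|lborel. (partial_deriv l (w b) x)\<^sup>2) \<le> (norm (test_h1 (w b)))\<^sup>2" for b
  proof -
    have "L2norm (\<lambda>x. test_grad (w b) x $ l) \<le> norm (test_h1 (w b))"
      using L2norm_nth_le[OF sq_integrable_test_grad[OF tw]] L2norm_rep_le(2)[of "test_h1 (w b)"]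
      unfolding L2norm_grad_test_h1[OF tw] by (rule order_trans)
    then have "(L2norm (\<lambda>x. test_grad (w b) x $ l))\<^sup>2 \<le> (norm (test_h1 (w b)))\<^sup>2"
      by (rule power_mono[OF _ L2norm_nonneg])
    then show ?thesis by (simp add: L2norm_power2 test_grad_def)
  qed
  have "k\<^sup>2 * (\<xi> $ l)\<^sup>2 / 2 * P - 2 * Q =
     (LINT x|lborel. k\<^sup>2 * (\<xi> $ l)\<^sup>2 / 2 * (\<eta> x)\<^sup>2 - 2 * (partial_deriv l \<eta> x)\<^sup>2)"
    unfolding P_def Q_def using sqi[OF t] sqi[OF t'] by simp
  also have "\<dots> \<le> (LINT x|lborel. (partial_deriv l (w 0) x)\<^sup>2 + (partial_deriv l (w (pi/2)) x)\<^sup>2)"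
  proof (rule integral_mono)
    fix x
    let ?d = "partial_deriv l \<eta> x" and ?y = "(k *\<^sub>R \<xi>) \<bullet> x" and ?m = "k * \<xi> $ l * \<eta> x"
    \<comment> \<open>This separates the term with k from the derivative of the envelope.\<close>
    have sq: "(p - q)\<^sup>2 \<ge> q\<^sup>2 / 2 - p\<^sup>2" for p q :: real
    proof -
      have "0 \<le> (2 * p - q)\<^sup>2" by simp
      then show ?thesis by (simp add: power2_eq_square algebra_simps)
    qed
    have e: "k\<^sup>2 * (\<xi> $ l)\<^sup>2 / 2 * (\<eta> x)\<^sup>2 = ?m\<^sup>2 / 2 * ((sin ?y)\<^sup>2 + (cos ?y)\<^sup>2)"
      by (simp add: power_mult_distrib)
    have e': "?d\<^sup>2 = ?d\<^sup>2 * ((sin ?y)\<^sup>2 + (cos ?y)\<^sup>2)" by simp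
    have "partial_deriv l (w 0) x = ?d * cos ?y - ?m * sin ?y"
      unfolding w_def partial_deriv_wave_packet[OF t] by simp
    moreover have "partial_deriv l (w (pi/2)) x = - (?d * sin ?y) - ?m * cos ?y"
      unfolding w_def partial_deriv_wave_packet[OF t] by (simp add: cos_add sin_add)
    ultimately have "(partial_deriv l (w 0) x)\<^sup>2 + (partial_deriv l (w (pi/2)) x)\<^sup>2 \<ge>
        ((?m * sin ?y)\<^sup>2 / 2 - (?d * cos ?y)\<^sup>2) + ((?m * cos ?y)\<^sup>2 / 2 - (- (?d * sin ?y))\<^sup>2)"
      by (simp only: add_mono sq)
    also have "((?m * sin ?y)\<^sup>2 / 2 - (?d * cos ?y)\<^sup>2) + ((?m * cos ?y)\<^sup>2 / 2 - (- (?d * sin ?y))\<^sup>2) =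
       ?m\<^sup>2 / 2 * ((sin ?y)\<^sup>2 + (cos ?y)\<^sup>2) - ?d\<^sup>2 * ((sin ?y)\<^sup>2 + (cos ?y)\<^sup>2)"
      by (simp only: power_mult_distrib power2_minus) (simp add: algebra_simps del: sin_cos_squared_add sin_cos_squared_add2)
    finally show "k\<^sup>2 * (\<xi> $ l)\<^sup>2 / 2 * (\<eta> x)\<^sup>2 - 2 * ?d\<^sup>2 \<le> (partial_deriv l (w 0) x)\<^sup>2 + (partial_deriv l (w (pi/2)) x)\<^sup>2"
      using e zero_le_power2[of ?d] unfolding e'[symmetric] by linarith
  qed (use sqi[OF t] sqi[OF t'] sqi[OF tw'] in auto)
  also have "\<dots> = (LINT x|lborel. (partial_deriv l (w 0) x)\<^sup>2) + (LINT x|lborel. (partial_deriv l (w (pi/2)) x)\<^sup>2)"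
    by (intro Bochner_Integration.integral_add sqi tw')
  also have "\<dots> \<le> (norm (test_h1 (w 0)))\<^sup>2 + (norm (test_h1 (w (pi/2))))\<^sup>2"
    by (intro add_mono lower)
  finally have "2 * Y\<^sup>2 \<le> (norm (test_h1 (w 0)))\<^sup>2 + (norm (test_h1 (w (pi/2))))\<^sup>2"
    using k2 by (simp add: add_divide_distrib)
  then have "Y\<^sup>2 \<le> (norm (test_h1 (w 0)))\<^sup>2 \<or> Y\<^sup>2 \<le> (norm (test_h1 (w (pi/2))))\<^sup>2" by linarith
  then show ?thesis unfolding w_def using power2_le_imp_le[OF _ norm_ge_zero] by blast
qed

lemma partial_deriv_outside:
  assumes "{x. \<phi> x \<noteq> 0} \<subseteq> K" "closed K" "x \<notin> K"
  shows "partial_deriv i \<phi> x = 0"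
proof -
  have "(\<phi> has_derivative (\<lambda>h. 0)) (at x)"
    by (rule has_derivative_transform_within_open[of "\<lambda>x. 0", where s="- K"])
      (use assms in \<open>auto simp: open_Compl\<close>)
  then show ?thesis by (rule partial_deriv_eqI)
qed

text \<open>
  The form is split into the part with the coefficients frozen at the values \<open>A0\<close>, the error \<open>E\<close> of
  freezing and the term \<open>Z\<close> of order zero. The frozen part and \<open>Z\<close> are at most \<open>H * norm g\<close>, where \<open>H\<close>
  depends on the envelope \<open>\<eta>\<close> but not on \<open>k\<close> and \<open>b\<close>. The wave packet is then chosen so large in norm
  that \<open>H\<close> is at most \<open>\<epsilon>\<close> times this norm.
\<close>

lemma quasimode_exists:
  fixes A :: "real^'n::finite \<Rightarrow> complex^'n^'n"
  assumes A: "\<And>i j. bounded_coeff (\<lambda>x. A x $ i $ j)" and c: "bounded_coeff c"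
    and xi: "\<xi> \<noteq> 0" and symbol: "(\<Sum>i\<in>UNIV. \<Sum>j\<in>UNIV. A0 $ i $ j * complex_of_real (\<xi> $ i * \<xi> $ j)) = 0"
    and t: "test_function \<eta>" and ne: "L2norm (\<lambda>x. complex_of_real (\<eta> x)) > 0"
    and K: "closed K" "{x. \<eta> x \<noteq> 0} \<subseteq> K"
    and close: "\<And>x i j. x \<in> K \<Longrightarrow> norm (A x $ i $ j - A0 $ i $ j) \<le> \<epsilon>" and eps: "\<epsilon> > 0"
  shows "\<exists>w. test_function w \<and> {x. w x \<noteq> 0} \<subseteq> K \<and> test_h1 w \<noteq> 0 \<and>
    (\<forall>g. norm (div_form A c g (test_h1 w)) \<le> ((real CARD('n))\<^sup>2 + 1) * \<epsilon> * norm g * norm (test_h1 w))"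
proof -
  obtain M where M: "c \<in> borel_measurable lborel" "AE x in lborel. norm (c x) \<le> M" "0 \<le> M"
    using bounded_coeffE[OF c] .
  have "\<exists>L. \<forall>i j g k b. norm ((LINT x|lborel. h1_grad g x $ j * complex_of_real (partial_deriv i (wave_packet \<eta> (k *\<^sub>R \<xi>) b) x))
     - complex_of_real (k\<^sup>2 * (\<xi> $ i * \<xi> $ j)) * (LINT x|lborel. rep_h1 g x * complex_of_real (wave_packet \<eta> (k *\<^sub>R \<xi>) b x))) \<le> L i j * norm g"
    by (intro choice allI wave_packet_form_bound t xi)
  then obtain L where L: "\<And>i j g k b. norm ((LINT x|lborel. h1_grad g x $ j * complex_of_real (partial_deriv i (wave_packet \<eta> (k *\<^sub>R \<xi>) b) x))
     - complex_of_real (k\<^sup>2 * (\<xi> $ i * \<xi> $ j)) * (LINT x|lborel. rep_h1 g x * complex_of_real (wave_packet \<eta> (k *\<^sub>R \<xi>) b x))) \<le> L i j * norm g"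
    by blast
  define N where "N = L2norm (\<lambda>x. complex_of_real (\<eta> x))"
  define H where "H = (\<Sum>i\<in>UNIV. \<Sum>j\<in>UNIV. norm (A0 $ i $ j) * L i j) + M * N"
  obtain k b where kb: "norm (test_h1 (wave_packet \<eta> (k *\<^sub>R \<xi>) b)) \<ge> max 1 (H / \<epsilon>)"
    using wave_packet_norm_unbounded[OF t xi ne] by blast
  define w where "w = wave_packet \<eta> (k *\<^sub>R \<xi>) b"
  define W where "W = test_h1 w"
  have W1: "norm W \<ge> 1" and WH: "H \<le> \<epsilon> * norm W"
    using kb eps by (simp_all add: W_def w_def field_simps)
  have tw: "test_function w" unfolding w_def by (rule test_function_wave_packet[OF t])
  have sup: "{x. w x \<noteq> 0} \<subseteq> K" using K(2) by (auto simp: w_def wave_packet_def)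
  have "norm (div_form A c g W) \<le> ((real CARD('n))\<^sup>2 + 1) * \<epsilon> * norm g * norm W" for g
  proof -
    let ?v = "\<lambda>i x. complex_of_real (partial_deriv i w x)"
    have sqv: "sq_integrable (?v i)" for i
      by (rule sq_integrable_test_function[OF test_function_partial_deriv[OF tw]])
    have vW: "L2norm (?v i) \<le> norm W" for i
      using order_trans[OF L2norm_nth_le[OF sq_integrable_test_grad[OF tw], of i] L2norm_rep_le(2)[of W, unfolded W_def L2norm_grad_test_h1[OF tw]]]
      by (simp add: test_grad_def W_def)
    define I where "I = (LINT x|lborel. rep_h1 g x * complex_of_real (w x))"
    define E where "E i j = (LINT x|lborel. (indicator K x * (A x $ i $ j - A0 $ i $ j)) * h1_grad g x $ j * ?v i x)" for i j
    define F where "F i j = (LINT x|lborel. h1_grad g x $ j * ?v i x)" for i j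
    have split: "(LINT x|lborel. A x $ i $ j * h1_grad g x $ j * cnj (h1_grad W x $ i)) = E i j + A0 $ i $ j * F i j"
      and Ele: "norm (E i j) \<le> \<epsilon> * norm g * norm W" for i j
    proof -
      have [measurable]: "(\<lambda>x. A x $ i $ j) \<in> borel_measurable lborel" "K \<in> sets lborel"
        using A[of i j] K(1) by (auto simp: bounded_coeff_def)
      have mE: "(\<lambda>x. indicator K x * (A x $ i $ j - A0 $ i $ j)) \<in> borel_measurable lborel" by measurable
      have bE: "AE x in lborel. norm (indicator K x * (A x $ i $ j - A0 $ i $ j)) \<le> \<epsilon>"
        using eps close by (intro AE_I2) (auto simp: indicator_def)
      note cE = coeff_integral_bound[OF mE bE less_imp_le[OF eps] sq_grad_nth[of g j] sqv[of i]]
      have iF: "integrable lborel (\<lambda>x. A0 $ i $ j * (h1_grad g x $ j * ?v i x))"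
        by (intro integrable_mult_right test_mult_integrable sq_grad_nth test_function_partial_deriv tw)
      have "(LINT x|lborel. A x $ i $ j * h1_grad g x $ j * cnj (h1_grad W x $ i)) =
         (LINT x|lborel. (indicator K x * (A x $ i $ j - A0 $ i $ j)) * h1_grad g x $ j * ?v i x +
            A0 $ i $ j * (h1_grad g x $ j * ?v i x))"
      proof (rule integral_cong_AE)
        show "(\<lambda>x. A x $ i $ j * h1_grad g x $ j * cnj (h1_grad W x $ i)) \<in> borel_measurable lborel"
          by (intro borel_measurable_integrable bounded_coeff_integrable A sq_grad_nth sq_integrable_cnj)
        show "(\<lambda>x. (indicator K x * (A x $ i $ j - A0 $ i $ j)) * h1_grad g x $ j * ?v i x +
            A0 $ i $ j * (h1_grad g x $ j * ?v i x)) \<in> borel_measurable lborel"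
          by (intro borel_measurable_integrable Bochner_Integration.integrable_add cE(1) iF)
        show "AE x in lborel. A x $ i $ j * h1_grad g x $ j * cnj (h1_grad W x $ i) =
           (indicator K x * (A x $ i $ j - A0 $ i $ j)) * h1_grad g x $ j * ?v i x + A0 $ i $ j * (h1_grad g x $ j * ?v i x)"
          using AE_grad_test_h1[OF tw]
        proof eventually_elim
          case (elim x)
          have "cnj (h1_grad W x $ i) = ?v i x" by (simp add: W_def elim test_grad_def)
          moreover have "?v i x = 0" if "x \<notin> K" using partial_deriv_outside[OF sup K(1) that] by simp
          ultimately show ?case by (cases "x \<in> K") (simp_all add: algebra_simps)
        qed
      qed
      also have "\<dots> = E i j + A0 $ i $ j * F i j"
        unfolding E_def F_def using cE(1) iF by (subst Bochner_Integration.integral_add) auto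
      finally show "(LINT x|lborel. A x $ i $ j * h1_grad g x $ j * cnj (h1_grad W x $ i)) = E i j + A0 $ i $ j * F i j" .
      have "norm (E i j) \<le> \<epsilon> * (L2norm (\<lambda>x. h1_grad g x $ j) * L2norm (?v i))"
        unfolding E_def by (rule cE(2))
      also have "\<dots> \<le> \<epsilon> * (norm g * norm W)"
        using eps by (intro mult_left_mono mult_mono L2norm_grad_nth_le vW L2norm_nonneg) auto
      finally show "norm (E i j) \<le> \<epsilon> * norm g * norm W" by (simp add: mult.assoc)
    qed
    define Z where "Z = (LINT x|lborel. c x * rep_h1 g x * cnj (rep_h1 W x))"
    have Zle: "norm Z \<le> M * N * norm g"
    proof -
      have "norm Z \<le> M * (L2norm (rep_h1 g) * L2norm (rep_h1 W))"
        unfolding Z_def using coeff_integral_bound(2)[OF M sq_integrable_rep_h1(1) sq_integrable_cnj[OF sq_integrable_rep_h1(1)], of g W]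
        unfolding L2norm_cnj .
      also have "L2norm (rep_h1 W) = L2norm (\<lambda>x. complex_of_real (w x))" unfolding W_def by (rule L2norm_rep_test_h1[OF tw])
      also have "M * (L2norm (rep_h1 g) * L2norm (\<lambda>x. complex_of_real (w x))) \<le> M * (norm g * N)"
        unfolding N_def
      proof (intro mult_left_mono mult_mono L2norm_rep_le L2norm_nonneg norm_ge_zero M L2norm_mono sq_integrable_test_function t)
        show "(\<lambda>x. complex_of_real (w x)) \<in> borel_measurable lborel"
          using sq_integrable_test_function[OF tw] by (simp add: sq_integrable_def)
        show "norm (complex_of_real (w x)) \<le> norm (complex_of_real (\<eta> x))" for x
          by (simp add: w_def wave_packet_def norm_mult mult_left_le)
      qed
      finally show ?thesis by (simp add: mult_ac)
    qed
    \<comment> \<open>Subtracting the leading terms changes nothing, as the quadratic form of A0 vanishes at xi.\<close>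
    have "(\<Sum>i\<in>UNIV. \<Sum>j\<in>UNIV. A0 $ i $ j * F i j) =
       (\<Sum>i\<in>UNIV. \<Sum>j\<in>UNIV. A0 $ i $ j * (F i j - complex_of_real (k\<^sup>2 * (\<xi> $ i * \<xi> $ j)) * I)) +
       complex_of_real (k\<^sup>2) * I * (\<Sum>i\<in>UNIV. \<Sum>j\<in>UNIV. A0 $ i $ j * complex_of_real (\<xi> $ i * \<xi> $ j))"
      by (simp add: sum_distrib_left sum.distrib[symmetric] algebra_simps)
    also have "\<dots> = (\<Sum>i\<in>UNIV. \<Sum>j\<in>UNIV. A0 $ i $ j * (F i j - complex_of_real (k\<^sup>2 * (\<xi> $ i * \<xi> $ j)) * I))"
      unfolding symbol by simp
    finally have F: "(\<Sum>i\<in>UNIV. \<Sum>j\<in>UNIV. A0 $ i $ j * F i j) =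
      (\<Sum>i\<in>UNIV. \<Sum>j\<in>UNIV. A0 $ i $ j * (F i j - complex_of_real (k\<^sup>2 * (\<xi> $ i * \<xi> $ j)) * I))" .
    have Fle: "norm (\<Sum>i\<in>UNIV. \<Sum>j\<in>UNIV. A0 $ i $ j * F i j) \<le> (\<Sum>i\<in>UNIV. \<Sum>j\<in>UNIV. norm (A0 $ i $ j) * L i j) * norm g"
      unfolding F sum_distrib_right
    proof (intro sum_norm_le)
      fix i j :: 'n
      have "norm (F i j - complex_of_real (k\<^sup>2 * (\<xi> $ i * \<xi> $ j)) * I) \<le> L i j * norm g"
        unfolding F_def I_def w_def by (rule L)
      then show "norm (A0 $ i $ j * (F i j - complex_of_real (k\<^sup>2 * (\<xi> $ i * \<xi> $ j)) * I)) \<le> norm (A0 $ i $ j) * L i j * norm g"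
        using mult_left_mono[of _ "L i j * norm g" "norm (A0 $ i $ j)"] by (simp add: norm_mult mult.assoc)
    qed
    have "norm (\<Sum>i\<in>UNIV. \<Sum>j\<in>UNIV. E i j) \<le> (\<Sum>i\<in>(UNIV::'n set). \<Sum>j\<in>(UNIV::'n set). \<epsilon> * norm g * norm W)"
      by (intro sum_norm_le Ele)
    also have "\<dots> = (real CARD('n))\<^sup>2 * (\<epsilon> * norm g * norm W)" by (simp add: power2_eq_square)
    finally have E: "norm (\<Sum>i\<in>UNIV. \<Sum>j\<in>UNIV. E i j) \<le> (real CARD('n))\<^sup>2 * (\<epsilon> * norm g * norm W)" .
    have "div_form A c g W = (\<Sum>i\<in>UNIV. \<Sum>j\<in>UNIV. E i j) + (\<Sum>i\<in>UNIV. \<Sum>j\<in>UNIV. A0 $ i $ j * F i j) + Z"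
      unfolding div_form_eq[OF A] split Z_def by (simp add: sum.distrib)
    then have "norm (div_form A c g W) \<le> norm (\<Sum>i\<in>UNIV. \<Sum>j\<in>UNIV. E i j) + norm (\<Sum>i\<in>UNIV. \<Sum>j\<in>UNIV. A0 $ i $ j * F i j) + norm Z"
      by (simp only: order_trans[OF norm_triangle_ineq add_right_mono[OF norm_triangle_ineq]])
    also have "\<dots> \<le> (real CARD('n))\<^sup>2 * (\<epsilon> * norm g * norm W) + (\<Sum>i\<in>UNIV. \<Sum>j\<in>UNIV. norm (A0 $ i $ j) * L i j) * norm g + M * N * norm g"
      by (intro add_mono E Fle Zle)
    also have "\<dots> = (real CARD('n))\<^sup>2 * (\<epsilon> * norm g * norm W) + H * norm g" by (simp add: H_def algebra_simps)
    also have "\<dots> \<le> (real CARD('n))\<^sup>2 * (\<epsilon> * norm g * norm W) + \<epsilon> * norm W * norm g"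
      by (intro add_left_mono mult_right_mono WH norm_ge_zero)
    also have "\<dots> = ((real CARD('n))\<^sup>2 + 1) * \<epsilon> * norm g * norm W" by (simp add: algebra_simps)
    finally show ?thesis .
  qed
  moreover have "W \<noteq> 0" using W1 by auto
  ultimately show ?thesis using tw sup unfolding W_def by blast
qed

section \<open>Failure of the Fredholm property at a nonelliptic point\<close>

lemma norm_h1_scaleC_ii: "norm (h1_scaleC \<i> u) = norm u"
proof -
  have "complex_of_real ((norm (h1_scaleC \<i> u))\<^sup>2) = complex_of_real ((norm u)\<^sup>2)"
    unfolding h1_cinner_self[symmetric] by (simp add: h1_cinner_scaleC_left h1_cinner_scaleC_right)
  then have "(norm (h1_scaleC \<i> u))\<^sup>2 = (norm u)\<^sup>2" unfolding of_real_eq_iff .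
  then show ?thesis by simp
qed

lemma norm_h1_cinner_le: "norm (h1_cinner u v) \<le> 2 * (norm u * norm v)"
proof -
  have "\<bar>Re (h1_cinner u v)\<bar> \<le> norm u * norm v"
    using Cauchy_Schwarz_ineq2[of u v] by (simp add: inner_h1_def)
  moreover have "\<bar>Im (h1_cinner u v)\<bar> \<le> norm u * norm v"
    using Cauchy_Schwarz_ineq2[of "h1_scaleC \<i> u" v]
    by (simp add: inner_h1_def h1_cinner_scaleC_left norm_h1_scaleC_ii)
  ultimately show ?thesis using cmod_le[of "h1_cinner u v"] by linarith
qed

lemma h1_cinner_scaleR_left: "h1_cinner (r *\<^sub>R u) v = complex_of_real r * h1_cinner u v"
  by (simp add: h1_scaleC_of_real[symmetric] h1_cinner_scaleC_left)

lemma h1_cinner_scaleR_right: "h1_cinner u (r *\<^sub>R v) = complex_of_real r * h1_cinner u v"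
  by (simp add: h1_scaleC_of_real[symmetric] h1_cinner_scaleC_right)

lemma bounded_linear_h1_cinner_left: "bounded_linear (\<lambda>u. h1_cinner u v)"
proof (rule bounded_linear_intro)
  show "norm (h1_cinner u v) \<le> norm u * (2 * norm v)" for u
    using norm_h1_cinner_le[of u v] by (simp add: mult_ac)
qed (simp_all add: h1_cinner_add_left h1_cinner_scaleR_left scaleR_conv_of_real)

text \<open>
  The pairing function splits the orthonormal sequence into infinitely many subsequences. The vector
  \<open>f j\<close> has the coordinates \<open>(1/2) ^ n\<close> along the \<open>j\<close>-th subsequence. If a combination of the \<open>f j\<close>
  lies in the range of \<open>T\<close>, its coordinates are of order \<open>(1/4) ^ n\<close>, and therefore all its
  coefficients vanish. Modulo the range the \<open>f j\<close> are thus linearly independent, whereas a Fredholm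
  operator has a range of finite codimension.
\<close>

lemma not_fredholm_of_orthonormal_decay:
  fixes T :: "'n::finite h1 \<Rightarrow> 'n h1" and e :: "nat \<Rightarrow> 'n h1"
  assumes orth: "\<And>m n. h1_cinner (e m) (e n) = (if m = n then 1 else 0)"
    and decay: "\<And>g n. norm (h1_cinner (T g) (e n)) \<le> (1/4) ^ n * norm g"
  shows "\<not> fredholm T"
proof
  assume fr: "fredholm T"
  then have bc: "bounded_clinear T" by (simp add: fredholm_def)
  then interpret T: bounded_linear T by (simp add: bounded_clinear_def)
  have sub: "complex_h1.subspace (range T)"
    unfolding complex_h1.subspace_def
  proof (intro conjI ballI allI)
    show "0 \<in> range T" using T.zero by (metis rangeI)
    fix x y c assume "x \<in> range T" "y \<in> range T"
    then obtain u v where uv: "x = T u" "y = T v" by blast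
    show "x + y \<in> range T" unfolding uv T.add[symmetric] by simp
    have "h1_scaleC c x = T (h1_scaleC c u)" using bc uv by (simp add: bounded_clinear_def)
    then show "h1_scaleC c x \<in> range T" by simp
  qed
  obtain B where B: "finite B" "complex_h1.span (range T \<union> B) = UNIV"
    using fr by (auto simp: fredholm_def)
  have ne: "norm (e n) = 1" for n
  proof -
    have "complex_of_real ((norm (e n))\<^sup>2) = complex_of_real 1"
      unfolding h1_cinner_self[symmetric] by (simp add: orth)
    then have "(norm (e n))\<^sup>2 = 1" unfolding of_real_eq_iff .
    then show ?thesis by (intro power2_eq_imp_eq[of "norm (e n)" 1]) simp_all
  qed
  define f where "f j = (\<Sum>n. (1/2::real) ^ n *\<^sub>R e (prod_encode (j, n)))" for j
  have coord: "h1_cinner (f j) (e (prod_encode (i, n))) = (if j = i then (1/2) ^ n else 0)" for i j n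
  proof -
    have "summable (\<lambda>n. (1/2::real) ^ n *\<^sub>R e (prod_encode (j, n)))"
      by (rule summable_norm_cancel) (simp add: ne summable_geometric)
    then have "(\<lambda>n. (1/2::real) ^ n *\<^sub>R e (prod_encode (j, n))) sums f j"
      unfolding f_def by (rule summable_sums)
    from bounded_linear.sums[OF bounded_linear_h1_cinner_left this, of "e (prod_encode (i, n))"]
    have s: "(\<lambda>m. h1_cinner ((1/2::real) ^ m *\<^sub>R e (prod_encode (j, m))) (e (prod_encode (i, n))))
       sums h1_cinner (f j) (e (prod_encode (i, n)))" .
    have "h1_cinner ((1/2::real) ^ m *\<^sub>R e (prod_encode (j, m))) (e (prod_encode (i, n))) =
        (if m = n then if j = i then (1/2) ^ m else 0 else 0)" for m
      by (simp add: h1_cinner_scaleR_left orth)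
    then have "(\<lambda>m. if m = n then if j = i then (1/2) ^ m else 0 else 0)
       sums h1_cinner (f j) (e (prod_encode (i, n)))"
      using s by simp
    moreover have "(\<lambda>m. if m = n then if j = i then (1/2::complex) ^ m else 0 else 0) sums (if j = i then (1/2) ^ n else 0)"
      using sums_single[of n "\<lambda>m. if j = i then (1/2::complex) ^ m else 0"] .
    ultimately show ?thesis by (rule sums_unique2)
  qed
  have cinner_sum: "h1_cinner (\<Sum>j\<in>S. h1_scaleC (d j) (x j)) v = (\<Sum>j\<in>S. d j * h1_cinner (x j) v)"
    for S :: "nat set" and d x and v :: "'n h1"
    using linear_sum[OF bounded_linear.linear[OF bounded_linear_h1_cinner_left[of v]], of "\<lambda>j. h1_scaleC (d j) (x j)" S]
    by (simp add: h1_cinner_scaleC_left)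
  have indep: "d i = 0" if S: "finite S" "i \<in> S" "(\<Sum>j\<in>S. h1_scaleC (d j) (f j)) \<in> range T" for S d i
  proof -
    obtain g where g: "(\<Sum>j\<in>S. h1_scaleC (d j) (f j)) = T g" using S(3) by blast
    have "norm (d i) \<le> (1/2) ^ n * norm g" for n
    proof -
      have "h1_cinner (T g) (e (prod_encode (i, n))) = (\<Sum>j\<in>S. d j * (if j = i then (1/2) ^ n else 0))"
        unfolding g[symmetric] cinner_sum coord ..
      also have "\<dots> = d i * (1/2) ^ n" using S by (simp add: if_distrib sum.delta cong: if_cong)
      finally have "norm (d i) * (1/2) ^ n \<le> (1/4) ^ prod_encode (i, n) * norm g"
        using decay[of g "prod_encode (i, n)"] by (simp add: norm_mult norm_power norm_divide)
      also have "\<dots> \<le> (1/4) ^ n * norm g"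
        by (intro mult_right_mono power_decreasing le_prod_encode_2) auto
      also have "\<dots> = ((1/2) ^ n * norm g) * (1/2) ^ n" by (simp add: power_mult_distrib[symmetric] mult_ac)
      finally show ?thesis by (simp add: mult.commute)
    qed
    moreover have "(\<lambda>n. (1/2::real) ^ n * norm g) \<longlonglongrightarrow> 0 * norm g"
      by (intro tendsto_intros LIMSEQ_realpow_zero) auto
    ultimately have "norm (d i) \<le> 0"
      using LIMSEQ_le_const[of "\<lambda>n. (1/2::real) ^ n * norm g" 0 "norm (d i)"] by auto
    then show ?thesis by simp
  qed
  \<comment> \<open>The b j represent the classes of the f j modulo the range inside a space of finite dimension.\<close>
  have "\<exists>b. b \<in> complex_h1.span B \<and> f j - b \<in> range T" for j
  proof -
    have "f j \<in> complex_h1.span (range T \<union> B)" using B(2) by simp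
    then obtain x y where "f j = x + y" "x \<in> range T" "y \<in> complex_h1.span B"
      unfolding complex_h1.span_Un complex_h1.span_eq_iff[THEN iffD2, OF sub] by blast
    then show ?thesis by (intro exI[of _ y]) auto
  qed
  then obtain b where b: "\<And>j. b j \<in> complex_h1.span B" "\<And>j. f j - b j \<in> range T" by metis
  have indep_b: "d i = 0" if S: "finite S" "i \<in> S" "(\<Sum>j\<in>S. h1_scaleC (d j) (b j)) = 0" for S d i
  proof (rule indep[OF S(1,2)])
    have "(\<Sum>j\<in>S. h1_scaleC (d j) (f j - b j)) \<in> range T"
      by (intro complex_h1.subspace_sum[OF sub] complex_h1.subspace_scale[OF sub] b)
    moreover have "(\<Sum>j\<in>S. h1_scaleC (d j) (f j - b j)) = (\<Sum>j\<in>S. h1_scaleC (d j) (f j))"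
      using S(3) by (simp add: complex_h1.scale_right_diff_distrib sum_subtractf)
    ultimately show "(\<Sum>j\<in>S. h1_scaleC (d j) (f j)) \<in> range T" by simp
  qed
  have inj: "inj b"
  proof (rule injI, rule ccontr)
    fix i j assume "b i = b j" "i \<noteq> j"
    then have "(\<Sum>m\<in>{i, j}. h1_scaleC (if m = i then 1 else - 1) (b m)) = 0"
      by simp
    from indep_b[OF _ _ this, of i] show False by simp
  qed
  have "complex_h1.independent (range b)"
    unfolding complex_h1.dependent_explicit
  proof (rule notI, elim exE conjE bexE)
    fix t u v assume t: "finite t" "t \<subseteq> range b" "(\<Sum>v\<in>t. h1_scaleC (u v) v) = 0" and v: "v \<in> t" "u v \<noteq> 0"
    obtain S where S: "t = b ` S" using t(2) by (meson subset_imageE)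
    have "finite S" using t(1) inj unfolding S by (auto simp: finite_image_iff inj_on_subset)
    obtain i where i: "i \<in> S" "v = b i" using v S by blast
    have "(\<Sum>j\<in>S. h1_scaleC (u (b j)) (b j)) = 0"
      using t(3) unfolding S by (subst (asm) sum.reindex) (use inj in \<open>auto simp: inj_on_def\<close>)
    from indep_b[OF \<open>finite S\<close> i(1) this] show False using v(2) i(2) by simp
  qed
  moreover have "range b \<subseteq> complex_h1.span B" using b by blast
  ultimately have "finite (range b)" using complex_h1.independent_span_bound[OF B(1)] by blast
  then show False using finite_imageD[of b UNIV] inj infinite_UNIV_nat by blast
qed

lemma h1_cinner_test_h1_disjoint:
  assumes t: "test_function w" "test_function w'" and K: "closed K" "closed K'" "K \<inter> K' = {}"
    and s: "{x. w x \<noteq> 0} \<subseteq> K" "{x. w' x \<noteq> 0} \<subseteq> K'"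
  shows "h1_cinner (test_h1 w) (test_h1 w') = 0"
proof -
  have "(LINT x|lborel. rep_h1 (test_h1 w) x * cnj (rep_h1 (test_h1 w') x)) = 0"
  proof (rule integral_eq_zero_AE)
    show "AE x in lborel. rep_h1 (test_h1 w) x * cnj (rep_h1 (test_h1 w') x) = 0"
      using AE_rep_test_h1[OF t(1)] AE_rep_test_h1[OF t(2)]
    proof eventually_elim
      case (elim x)
      have "w x = 0 \<or> w' x = 0" using K s by blast
      then show ?case by (auto simp: elim)
    qed
  qed
  moreover have "(LINT x|lborel. cdot (h1_grad (test_h1 w) x) (h1_grad (test_h1 w') x)) = 0"
  proof (rule integral_eq_zero_AE)
    show "AE x in lborel. cdot (h1_grad (test_h1 w) x) (h1_grad (test_h1 w') x) = 0"
      using AE_grad_test_h1[OF t(1)] AE_grad_test_h1[OF t(2)]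
    proof eventually_elim
      case (elim x)
      have "x \<notin> K \<or> x \<notin> K'" using K by blast
      then have "(\<forall>i. partial_deriv i w x = 0) \<or> (\<forall>i. partial_deriv i w' x = 0)"
        using partial_deriv_outside[OF s(1) K(1)] partial_deriv_outside[OF s(2) K(2)] by blast
      then show ?case by (auto simp: elim cdot_def test_grad_def)
    qed
  qed
  ultimately show ?thesis by (simp add: h1_cinner_eq)
qed

lemma box_bump_L2norm_pos:
  fixes a b :: "real^'n"
  assumes "\<And>i. a $ i < b $ i"
  shows "L2norm (\<lambda>x. complex_of_real (box_bump a b 1 x)) > 0"
proof (rule ccontr)
  assume "\<not> ?thesis"
  then have "(L2norm (\<lambda>x. complex_of_real (box_bump a b 1 x)))\<^sup>2 = 0" using L2norm_nonneg[of "\<lambda>x. complex_of_real (box_bump a b 1 x)"] by simp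
  then have 0: "(LINT x|lborel. (norm (complex_of_real (box_bump a b 1 x)))\<^sup>2) = 0" unfolding L2norm_power2 .
  have "integrable lborel (\<lambda>x. (norm (complex_of_real (box_bump a b 1 x)))\<^sup>2)"
    using sq_integrable_test_function[OF test_function_box_bump, of a b 1] unfolding sq_integrable_def by blast
  from integral_nonneg_eq_0_iff_AE[OF this] 0
  have ae: "AE x in lborel. box_bump a b 1 x = 0" by simp
  have pos: "box_bump a b 1 x \<noteq> 0" if "x \<in> box a b" for x
    using that by (auto simp: box_bump_def flat_fun_def mem_box_cart)
  have "AE x in lborel. x \<notin> box a b" using ae by eventually_elim (use pos in blast)
  then have "emeasure lborel (box a b) = 0" by (subst (asm) AE_iff_measurable[OF _ refl]) auto
  moreover have "emeasure lborel (box a b) = ennreal (\<Prod>i\<in>Basis. (b - a) \<bullet> i)"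
    by (rule emeasure_lborel_box) (use assms in \<open>auto simp: Basis_vec_def inner_axis intro: less_imp_le\<close>)
  moreover have "(\<Prod>i\<in>Basis. (b - a) \<bullet> i) > 0"
    by (rule prod_pos) (use assms in \<open>auto simp: Basis_vec_def inner_axis\<close>)
  ultimately show False by (metis ennreal_eq_0_iff not_le)
qed

text \<open>
  Quasimodes with errors \<open>(1/4) ^ n\<close> are placed in pairwise disjoint boxes near \<open>x0\<close>. Disjoint
  supports make them orthogonal in H1.
\<close>

theorem nonelliptic_point_not_fredholm:
  fixes A :: "real^'n::finite \<Rightarrow> complex^'n^'n" and x0 \<xi> :: "real^'n"
  assumes A: "\<And>i j. bounded_coeff (\<lambda>x. A x $ i $ j)" and c: "bounded_coeff c"
    and cont: "\<And>i j. isCont (\<lambda>x. A x $ i $ j) x0"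
    and xi: "\<xi> \<noteq> 0" and symbol: "(\<Sum>i\<in>UNIV. \<Sum>j\<in>UNIV. A x0 $ i $ j * complex_of_real (\<xi> $ i * \<xi> $ j)) = 0"
    and T: "is_riesz_rep (div_form A c) T"
  shows "\<not> fredholm T"
proof -
  define C where "C = (real CARD('n))\<^sup>2 + 1"
  have C: "C > 0" by (simp add: C_def add_nonneg_pos)
  have "\<exists>d>0. \<forall>x. x \<in> ball x0 d \<longrightarrow> (\<forall>i j. norm (A x $ i $ j - A x0 $ i $ j) \<le> (1/4)^n / C)" for n
  proof -
    have "\<forall>\<^sub>F x in nhds x0. norm (A x $ i $ j - A x0 $ i $ j) \<le> (1/4)^n / C" for i j
    proof -
      have "((\<lambda>x. A x $ i $ j) \<longlongrightarrow> A x0 $ i $ j) (nhds x0)"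
        using cont[of i j] unfolding isCont_def by (rule tendsto_at_iff_tendsto_nhds[THEN iffD1])
      then have "\<forall>\<^sub>F x in nhds x0. dist (A x $ i $ j) (A x0 $ i $ j) < (1/4)^n / C"
        by (rule tendstoD) (use C in simp)
      then show ?thesis by (rule eventually_mono) (simp add: dist_norm)
    qed
    then have "\<forall>\<^sub>F x in nhds x0. \<forall>i j. norm (A x $ i $ j - A x0 $ i $ j) \<le> (1/4)^n / C"
      by (intro eventually_all_finite)
    then show ?thesis unfolding eventually_nhds_metric by (auto simp: dist_commute)
  qed
  then have "\<exists>\<delta>. \<forall>n. \<delta> n > 0 \<and> (\<forall>x. x \<in> ball x0 (\<delta> n) \<longrightarrow> (\<forall>i j. norm (A x $ i $ j - A x0 $ i $ j) \<le> (1/4)^n / C))"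
    by (intro choice) blast
  then obtain \<delta> where d: "\<And>n. \<delta> n > 0"
    and close: "\<And>n x i j. x \<in> ball x0 (\<delta> n) \<Longrightarrow> norm (A x $ i $ j - A x0 $ i $ j) \<le> (1/4)^n / C"
    by blast
  \<comment> \<open>The boxes lie along the diagonal at x0. In each coordinate, the m-th box begins at distance 4^-m
    from x0 and the next one ends at distance 4^-m / 2, so they are disjoint.\<close>
  define lo hi where "lo m = x0 + (\<chi> i. (1/4)^m)" and "hi m = x0 + (\<chi> i. 2 * (1/4)^m)" for m
  define K where "K m = cbox (lo m) (hi m)" for m
  have K_bounds: "x0 $ i + (1/4)^m \<le> x $ i" "x $ i \<le> x0 $ i + 2 * (1/4)^m" if "x \<in> K m" for x m i
    using that by (auto simp: K_def lo_def hi_def mem_box_cart)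
  have disj: "K m \<inter> K n = {}" if "m < n" for m n
  proof -
    have "2 * (1/4::real) ^ n \<le> 2 * (1/4) ^ Suc m"
      by (intro mult_left_mono power_decreasing) (use that in auto)
    then have "2 * (1/4::real) ^ n < (1/4) ^ m" using zero_less_power[of "1/4::real" m] by (simp add: field_simps del: zero_less_power)
    then show ?thesis using K_bounds[of _ m undefined] K_bounds[of _ n undefined] by force
  qed
  have small: "\<exists>N. \<forall>m\<ge>N. K m \<subseteq> ball x0 r" if r: "r > 0" for r
  proof -
    have "(\<lambda>m. real CARD('n) * (2 * (1/4::real)^m)) \<longlonglongrightarrow> real CARD('n) * (2 * 0)"
      by (intro tendsto_intros LIMSEQ_realpow_zero) auto
    then have "\<forall>\<^sub>F m in sequentially. real CARD('n) * (2 * (1/4::real)^m) < r"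
      using r by (intro order_tendstoD) auto
    then obtain N where N: "\<And>m. m \<ge> N \<Longrightarrow> real CARD('n) * (2 * (1/4::real)^m) < r"
      unfolding eventually_sequentially by blast
    have "x \<in> ball x0 r" if "m \<ge> N" "x \<in> K m" for m x
    proof -
      have "\<bar>(x - x0) $ i\<bar> \<le> 2 * (1/4)^m" for i
      proof -
        have "(0::real) < (1/4)^m" by simp
        then show ?thesis using K_bounds[OF that(2), of i] unfolding vector_minus_component by linarith
      qed
      then have "(\<Sum>i\<in>UNIV. \<bar>(x - x0) $ i\<bar>) \<le> (\<Sum>i\<in>(UNIV::'n set). 2 * (1/4)^m)" by (intro sum_mono)
      then have "norm (x - x0) \<le> real CARD('n) * (2 * (1/4)^m)"
        using norm_le_l1_cart[of "x - x0"] by simp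
      then show ?thesis using N[OF that(1)] by (simp add: dist_norm norm_minus_commute)
    qed
    then show ?thesis by blast
  qed
  have "\<exists>N. \<forall>n. \<forall>m\<ge>N n. K m \<subseteq> ball x0 (\<delta> n)"
    by (intro choice allI small d)
  then obtain N where N: "\<And>n m. m \<ge> N n \<Longrightarrow> K m \<subseteq> ball x0 (\<delta> n)" by blast
  \<comment> \<open>A strictly increasing choice of boxes, the n-th of which is inside the n-th ball.\<close>
  define r where "r n = n + (\<Sum>i\<le>n. N i)" for n
  have rN: "N n \<le> r n" for n
    using member_le_sum[of n "{..n}" N] by (simp add: r_def)
  have "strict_mono r" by (rule strict_monoI_Suc) (simp add: r_def)
  have "\<exists>w. test_function w \<and> {x. w x \<noteq> 0} \<subseteq> K (r n) \<and> test_h1 w \<noteq> 0 \<and>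
     (\<forall>g. norm (div_form A c g (test_h1 w)) \<le> C * ((1/4)^n / C) * norm g * norm (test_h1 w))" for n
    unfolding C_def
  proof (rule quasimode_exists[OF A c xi symbol, of "box_bump (lo (r n)) (hi (r n)) 1"], unfold C_def[symmetric])
    show "test_function (box_bump (lo (r n)) (hi (r n)) 1)" by (rule test_function_box_bump)
    show "0 < L2norm (\<lambda>x. complex_of_real (box_bump (lo (r n)) (hi (r n)) 1 x))"
      by (rule box_bump_L2norm_pos) (simp add: lo_def hi_def)
    show "closed (K (r n))" by (simp add: K_def closed_cbox)
    show "{x. box_bump (lo (r n)) (hi (r n)) 1 x \<noteq> 0} \<subseteq> K (r n)"
      using box_bump_outside box_subset_cbox unfolding K_def by blast
    show "norm (A x $ i $ j - A x0 $ i $ j) \<le> (1/4)^n / C" if "x \<in> K (r n)" for x i j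
      by (rule close) (use N[OF rN[of n]] that in blast)
    show "0 < (1/4)^n / C" using C by simp
  qed
  then obtain w where w: "\<And>n. test_function (w n)" "\<And>n. {x. w n x \<noteq> 0} \<subseteq> K (r n)" "\<And>n. test_h1 (w n) \<noteq> 0"
    and dec: "\<And>n g. norm (div_form A c g (test_h1 (w n))) \<le> C * ((1/4)^n / C) * norm g * norm (test_h1 (w n))"
    by metis
  define e where "e n = sgn (test_h1 (w n))" for n
  have orth0: "h1_cinner (test_h1 (w m)) (test_h1 (w n)) = 0" if "m \<noteq> n" for m n
  proof (rule h1_cinner_test_h1_disjoint[OF w(1) w(1) _ _ _ w(2) w(2)])
    have "r m < r n \<or> r n < r m" using \<open>strict_mono r\<close> that by (metis linorder_neqE_nat strict_mono_less)
    then show "K (r m) \<inter> K (r n) = {}" using disj by blast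
  qed (simp_all add: K_def closed_cbox)
  show ?thesis
  proof (rule not_fredholm_of_orthonormal_decay)
    show "h1_cinner (e m) (e n) = (if m = n then 1 else 0)" for m n
    proof (cases "m = n")
      case True
      have "norm (e n) = 1" unfolding e_def using w(3) by (simp add: norm_sgn)
      then show ?thesis using True h1_cinner_self[of "e n"] by simp
    next
      case False
      then show ?thesis by (simp add: e_def sgn_h1_def h1_cinner_scaleR_left h1_cinner_scaleR_right orth0)
    qed
    show "norm (h1_cinner (T g) (e n)) \<le> (1/4) ^ n * norm g" for g n
    proof -
      have "norm (h1_cinner (T g) (e n)) = inverse (norm (test_h1 (w n))) * norm (div_form A c g (test_h1 (w n)))"
        using T by (simp add: e_def sgn_h1_def h1_cinner_scaleR_right norm_mult norm_inverse is_riesz_rep_def)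
      also have "\<dots> \<le> inverse (norm (test_h1 (w n))) * ((1/4)^n * norm g * norm (test_h1 (w n)))"
        using dec[where n=n and g=g] C by (intro mult_left_mono) auto
      also have "\<dots> = (1/4)^n * norm g" using w(3)[of n] by simp
      finally show ?thesis .
    qed
  qed
qed

section \<open>The coefficient matrix of the layer in polar form\<close>

lemma orth_proj_apply:
  assumes "subspace S" "p \<in> S" "y - p \<in> S\<^sup>\<bottom>"
  shows "(THE p. p \<in> S \<and> y - p \<in> S\<^sup>\<bottom>) = p"
proof (rule the_equality)
  fix p' assume p': "p' \<in> S \<and> y - p' \<in> S\<^sup>\<bottom>"
  have "p' - p \<in> S" using p' assms subspace_diff by blast
  then have "orthogonal (p' - p) (y - p)" "orthogonal (p' - p) (y - p')"
    using p' assms(3) by (auto simp: orthogonal_comp_def)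
  then have "inner (p' - p) ((y - p) - (y - p')) = 0" by (simp add: orthogonal_def inner_diff_right)
  then show "p' = p" by simp
qed (use assms in auto)

lemma Pi_par_nth:
  assumes "x \<noteq> 0" shows "Pi_par x $ i $ j = x $ i * x $ j / (norm x)\<^sup>2"
proof -
  have "(THE p. p \<in> span {x} \<and> y - p \<in> (span {x})\<^sup>\<bottom>) = ((x \<bullet> y) / (norm x)\<^sup>2) *\<^sub>R x" for y
  proof (rule orth_proj_apply[OF subspace_span])
    show "y - ((x \<bullet> y) / (norm x)\<^sup>2) *\<^sub>R x \<in> (span {x})\<^sup>\<bottom>"
      using assms by (auto simp: orthogonal_comp_def orthogonal_def span_singleton inner_diff_right power2_norm_eq_inner)
  qed (simp add: span_base span_scale)
  then show ?thesis by (simp add: Pi_par_def orth_proj_def matrix_def inner_axis)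
qed

lemma Pi_perp_nth:
  assumes "x \<noteq> 0" shows "Pi_perp x $ i $ j = (if i = j then 1 else 0) - x $ i * x $ j / (norm x)\<^sup>2"
proof -
  have "(THE p. p \<in> (span {x})\<^sup>\<bottom> \<and> y - p \<in> ((span {x})\<^sup>\<bottom>)\<^sup>\<bottom>) = y - ((x \<bullet> y) / (norm x)\<^sup>2) *\<^sub>R x" for y
  proof (rule orth_proj_apply[OF subspace_orthogonal_comp])
    show "y - ((x \<bullet> y) / (norm x)\<^sup>2) *\<^sub>R x \<in> (span {x})\<^sup>\<bottom>"
      using assms by (auto simp: orthogonal_comp_def orthogonal_def span_singleton inner_diff_right power2_norm_eq_inner)
    show "y - (y - ((x \<bullet> y) / (norm x)\<^sup>2) *\<^sub>R x) \<in> ((span {x})\<^sup>\<bottom>)\<^sup>\<bottom>"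
      by (simp add: orthogonal_comp_self span_base span_scale)
  qed
  moreover have "axis j (1::real) $ i = (if i = j then 1 else 0)" by (simp add: axis_def)
  ultimately show ?thesis by (simp add: Pi_perp_def orth_proj_def matrix_def inner_axis)
qed

text \<open>
  The matrix with eigenvalues \<open>a\<close> in direction \<open>(c, e)\<close> and \<open>b\<close> in the orthogonal direction, provided
  that \<open>c\<^sup>2 + e\<^sup>2 = 1\<close>.
\<close>

definition polar_diag :: "complex \<Rightarrow> complex \<Rightarrow> complex \<Rightarrow> complex \<Rightarrow> complex^2^2" where
  "polar_diag c e a b = vector [vector [a * c\<^sup>2 + b * e\<^sup>2, (a - b) * c * e], vector [(a - b) * c * e, a * e\<^sup>2 + b * c\<^sup>2]]"

lemma polar_diag_mult:
  assumes "c\<^sup>2 + e\<^sup>2 = 1"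
  shows "polar_diag c e a b ** polar_diag c e a' b' = polar_diag c e (a * a') (b * b')"
proof -
  have e2: "e\<^sup>2 = 1 - c\<^sup>2" using assms by (simp add: algebra_simps)
  have e: "e * e = 1 - c * c" using e2 by (simp add: power2_eq_square)
  have "(a * c\<^sup>2 + b * e\<^sup>2) * (a' * c\<^sup>2 + b' * e\<^sup>2) + (a - b) * c * e * ((a' - b') * c * e) = a * a' * c\<^sup>2 + b * b' * e\<^sup>2"
    "(a * c\<^sup>2 + b * e\<^sup>2) * ((a' - b') * c * e) + (a - b) * c * e * (a' * e\<^sup>2 + b' * c\<^sup>2) = (a * a' - b * b') * c * e"
    "(a - b) * c * e * (a' * c\<^sup>2 + b' * e\<^sup>2) + (a * e\<^sup>2 + b * c\<^sup>2) * ((a' - b') * c * e) = (a * a' - b * b') * c * e"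
    "(a - b) * c * e * ((a' - b') * c * e) + (a * e\<^sup>2 + b * c\<^sup>2) * (a' * e\<^sup>2 + b' * c\<^sup>2) = a * a' * e\<^sup>2 + b * b' * c\<^sup>2"
    using assms by algebra+
  then show ?thesis
    by (simp add: polar_diag_def vec_eq_iff forall_2 matrix_matrix_mult_def sum_2)
qed

lemma polar_diag_one: "c\<^sup>2 + e\<^sup>2 = 1 \<Longrightarrow> polar_diag c e 1 1 = mat 1"
  by (simp add: polar_diag_def vec_eq_iff forall_2 mat_def add.commute)

lemma det_polar_diag:
  assumes "c\<^sup>2 + e\<^sup>2 = 1" shows "det (polar_diag c e a b) = a * b"
proof -
  have "(a * c\<^sup>2 + b * e\<^sup>2) * (a * e\<^sup>2 + b * c\<^sup>2) - (a - b) * c * e * ((a - b) * c * e) = a * b"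
    using assms by algebra
  then show ?thesis by (simp add: det_2 polar_diag_def)
qed

lemma matrix_inv_eqI:
  fixes M :: "'a::field^'n^'n"
  assumes "M ** N = mat 1" "N ** M = mat 1" shows "matrix_inv M = N"
proof -
  have "invertible M" using assms by (auto simp: invertible_def)
  then have "M ** matrix_inv M = mat 1" using matrix_inv_def[of M] someI_ex[of "\<lambda>A'. M ** A' = mat 1 \<and> A' ** M = mat 1"] assms by auto
  then have "N ** (M ** matrix_inv M) = N" by simp
  then show ?thesis unfolding matrix_mul_assoc assms(2) by simp
qed

lemma matrix_inv_polar_diag:
  assumes "c\<^sup>2 + e\<^sup>2 = 1" "a \<noteq> 0" "b \<noteq> 0"
  shows "matrix_inv (polar_diag c e a b) = polar_diag c e (inverse a) (inverse b)"
  by (rule matrix_inv_eqI) (use assms in \<open>simp_all add: polar_diag_mult polar_diag_one\<close>)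

lemma diag_of_matrix_inv_diag:
  fixes A :: "real^2^2"
  assumes pd: "\<And>x. x \<noteq> 0 \<Longrightarrow> x \<bullet> (A *v x) > 0"
    and inv: "matrix_inv A = vector [vector [b1, 0], vector [0, b2]]" and b: "b1 \<noteq> 0" "b2 \<noteq> 0"
  shows "A = vector [vector [1 / b1, 0], vector [0, 1 / b2]]"
proof -
  have "A *v x \<noteq> 0" if "x \<noteq> 0" for x using pd[OF that] by auto
  then have "\<exists>B. B ** A = mat 1" unfolding matrix_left_invertible_ker by blast
  then obtain B where B: "B ** A = mat 1" by blast
  then have B': "A ** B = mat 1" unfolding matrix_left_right_inverse .
  have "A ** vector [vector [b1, 0], vector [0, b2]] = mat 1"
    using matrix_inv_eqI[OF B' B] inv B' by simp
  then have AB: "(A ** vector [vector [b1, 0], vector [0, b2]]) $ i $ j = mat 1 $ i $ j" for i j by simp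
  have "A $ i $ 1 * b1 = mat 1 $ i $ 1" "A $ i $ 2 * b2 = mat 1 $ i $ 2" for i
    using AB[of i 1] AB[of i 2] by (simp_all add: matrix_matrix_mult_def sum_2)
  from this[of 1] this[of 2] show ?thesis using b by (simp add: vec_eq_iff forall_2 mat_def field_simps)
qed

lemma norm_vec2_power2: "(norm (x :: real^2))\<^sup>2 = (x $ 1)\<^sup>2 + (x $ 2)\<^sup>2"
  unfolding power2_norm_eq_inner by (simp add: inner_vec_def sum_2 power2_eq_square)

lemma J_sigma_polar:
  assumes x: "x \<noteq> 0"
  shows "J_sigma R \<sigma> s x = polar_diag (complex_of_real (x $ 1 / norm x)) (complex_of_real (x $ 2 / norm x))
    (d_sigma \<sigma> s x) (d_tilde_sigma R \<sigma> s x)"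
proof -
  note n = norm_vec2_power2[of x]
  have n0: "(norm x)\<^sup>2 \<noteq> 0" using x by simp
  have 1: "1 - x $ 1 * x $ 1 / (norm x)\<^sup>2 = (x $ 2 / norm x)\<^sup>2" "1 - x $ 2 * x $ 2 / (norm x)\<^sup>2 = (x $ 1 / norm x)\<^sup>2"
    using n0 by (simp_all add: field_simps power2_eq_square n[unfolded power2_eq_square])
  have 2: "x $ i * x $ j / (norm x)\<^sup>2 = (x $ i / norm x) * (x $ j / norm x)" for i j
    by (simp add: power2_eq_square)
  show ?thesis
    unfolding J_sigma_def polar_diag_def
    by (simp add: vec_eq_iff forall_2 cscale_def cmatrix_def Pi_par_nth[OF x] Pi_perp_nth[OF x] 1 del: of_real_diff of_real_divide)
      (simp add: 2 power2_eq_square algebra_simps)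
qed

text \<open>
  The coefficient matrix in Cartesian coordinates at a point in direction \<open>(c, e)\<close>, for
  \<open>A = diag a1 a2\<close> and \<open>q = d_tilde_sigma / d_sigma\<close>. The argument \<open>q'\<close> stands for \<open>1 / q\<close>, so that the
  entries are polynomials and inherit boundedness and continuity from the arguments.
\<close>

definition pml_matrix :: "complex \<Rightarrow> complex \<Rightarrow> complex \<Rightarrow> complex \<Rightarrow> complex \<Rightarrow> complex \<Rightarrow> complex^2^2" where
  "pml_matrix a1 a2 q q' c e = vector
     [vector [a1 * (c^4 * q + 2 * c\<^sup>2 * e\<^sup>2 + e^4 * q') + a2 * c\<^sup>2 * e\<^sup>2 * (q - 2 + q'),
              c * e * (a1 * (c\<^sup>2 * q - c\<^sup>2 + e\<^sup>2 - e\<^sup>2 * q') + a2 * (e\<^sup>2 * q - e\<^sup>2 + c\<^sup>2 - c\<^sup>2 * q'))],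
      vector [c * e * (a1 * (c\<^sup>2 * q - c\<^sup>2 + e\<^sup>2 - e\<^sup>2 * q') + a2 * (e\<^sup>2 * q - e\<^sup>2 + c\<^sup>2 - c\<^sup>2 * q')),
              a1 * c\<^sup>2 * e\<^sup>2 * (q - 2 + q') + a2 * (e^4 * q + 2 * c\<^sup>2 * e\<^sup>2 + c^4 * q')]]"

text \<open>
  With \<open>u = 1 / d_sigma\<close> and \<open>v = 1 / d_tilde_sigma\<close>, the factor \<open>det J\<close> turns \<open>u\<^sup>2\<close>, \<open>u v\<close>, \<open>v\<^sup>2\<close> into
  \<open>q\<close>, \<open>1\<close>, \<open>1 / q\<close>, since the determinant is \<open>1 / (u v)\<close>.
\<close>

lemma A_sigma_polar:
  assumes x: "x \<noteq> 0" and A: "A = vector [vector [a1, 0], vector [0, a2]]"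
    and d: "d_sigma \<sigma> s x \<noteq> 0" "d_tilde_sigma R \<sigma> s x \<noteq> 0"
  shows "A_sigma A R \<sigma> s x = pml_matrix (complex_of_real a1) (complex_of_real a2)
    (d_tilde_sigma R \<sigma> s x / d_sigma \<sigma> s x) (d_sigma \<sigma> s x / d_tilde_sigma R \<sigma> s x)
    (complex_of_real (x $ 1 / norm x)) (complex_of_real (x $ 2 / norm x))"
proof -
  define c e where "c = complex_of_real (x $ 1 / norm x)" and "e = complex_of_real (x $ 2 / norm x)"
  define D t where "D = d_sigma \<sigma> s x" and "t = d_tilde_sigma R \<sigma> s x"
  have "(x $ 1 / norm x)\<^sup>2 + (x $ 2 / norm x)\<^sup>2 = 1"
    unfolding power_divide add_divide_distrib[symmetric] norm_vec2_power2[symmetric] using x by simp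
  then have ce: "c\<^sup>2 + e\<^sup>2 = 1" unfolding c_def e_def of_real_power[symmetric] of_real_add[symmetric] by simp
  have D: "D \<noteq> 0" "t \<noteq> 0" using d by (simp_all add: D_def t_def)
  define u v where "u = inverse D" and "v = inverse t"
  have uv: "D * u = 1" "t * v = 1" using D by (simp_all add: u_def v_def)
  have q: "t / D = t * u" "D / t = D * v" by (simp_all add: u_def v_def divide_inverse)
  have inv: "matrix_inv (polar_diag c e D t) = polar_diag c e u v"
    unfolding u_def v_def by (rule matrix_inv_polar_diag[OF ce D])
  have tr: "transpose (polar_diag c e u v) = polar_diag c e u v"
    by (simp add: transpose_def polar_diag_def vec_eq_iff forall_2)
  let ?a = "complex_of_real a1" and ?b = "complex_of_real a2"
  have 11: "(D * t) * ((u * c\<^sup>2 + v * e\<^sup>2) * ?a * (u * c\<^sup>2 + v * e\<^sup>2) + ((u - v) * c * e) * ?b * ((u - v) * c * e)) =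
      ?a * (c^4 * (t * u) + 2 * c\<^sup>2 * e\<^sup>2 + e^4 * (D * v)) + ?b * c\<^sup>2 * e\<^sup>2 * (t * u - 2 + D * v)"
    using uv by algebra
  have 12: "(D * t) * ((u * c\<^sup>2 + v * e\<^sup>2) * ?a * ((u - v) * c * e) + ((u - v) * c * e) * ?b * (u * e\<^sup>2 + v * c\<^sup>2)) =
      c * e * (?a * (c\<^sup>2 * (t * u) - c\<^sup>2 + e\<^sup>2 - e\<^sup>2 * (D * v)) + ?b * (e\<^sup>2 * (t * u) - e\<^sup>2 + c\<^sup>2 - c\<^sup>2 * (D * v)))"
    using uv by algebra
  have 21: "(D * t) * (((u - v) * c * e) * ?a * (u * c\<^sup>2 + v * e\<^sup>2) + (u * e\<^sup>2 + v * c\<^sup>2) * ?b * ((u - v) * c * e)) =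
      c * e * (?a * (c\<^sup>2 * (t * u) - c\<^sup>2 + e\<^sup>2 - e\<^sup>2 * (D * v)) + ?b * (e\<^sup>2 * (t * u) - e\<^sup>2 + c\<^sup>2 - c\<^sup>2 * (D * v)))"
    using uv by algebra
  have 22: "(D * t) * (((u - v) * c * e) * ?a * ((u - v) * c * e) + (u * e\<^sup>2 + v * c\<^sup>2) * ?b * (u * e\<^sup>2 + v * c\<^sup>2)) =
      ?a * c\<^sup>2 * e\<^sup>2 * (t * u - 2 + D * v) + ?b * (e^4 * (t * u) + 2 * c\<^sup>2 * e\<^sup>2 + c^4 * (D * v))"
    using uv by algebra
  have P: "polar_diag c e u v $ 1 $ 1 = u * c\<^sup>2 + v * e\<^sup>2" "polar_diag c e u v $ 1 $ 2 = (u - v) * c * e"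
    "polar_diag c e u v $ 2 $ 1 = (u - v) * c * e" "polar_diag c e u v $ 2 $ 2 = u * e\<^sup>2 + v * c\<^sup>2"
    by (simp_all add: polar_diag_def)
  have cA: "cmatrix A $ 1 $ 1 = ?a" "cmatrix A $ 1 $ 2 = 0" "cmatrix A $ 2 $ 1 = 0" "cmatrix A $ 2 $ 2 = ?b"
    by (simp_all add: cmatrix_def A)
  have "A_sigma A R \<sigma> s x = cscale (D * t) (polar_diag c e u v ** cmatrix A ** polar_diag c e u v)"
    unfolding A_sigma_def Let_def J_sigma_polar[OF x] c_def[symmetric] e_def[symmetric] D_def[symmetric] t_def[symmetric]
      det_polar_diag[OF ce] inv tr ..
  also have "\<dots> = pml_matrix ?a ?b (t / D) (D / t) c e"
    unfolding q pml_matrix_def vec_eq_iff forall_2 cscale_def matrix_matrix_mult_def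
    by (simp only: vec_lambda_beta sum_2 P cA vector_2 mult_zero_right add_0_left add_0_right 11 12 21 22)
  finally show ?thesis unfolding c_def e_def D_def t_def .
qed

lemma bounded_coeff_pml_matrix:
  assumes "bounded_coeff q" "bounded_coeff q'" "bounded_coeff c" "bounded_coeff e"
  shows "bounded_coeff (\<lambda>x. pml_matrix a1 a2 (q x) (q' x) (c x) (e x) $ i $ j)"
  using exhaust_2[of i] exhaust_2[of j]
  by (auto simp: pml_matrix_def intro!: assms bounded_coeff_add bounded_coeff_diff bounded_coeff_mult bounded_coeff_power bounded_coeff_const)

lemma isCont_pml_matrix:
  assumes "isCont q x0" "isCont q' x0" "isCont c x0" "isCont e x0"
  shows "isCont (\<lambda>x. pml_matrix a1 a2 (q x) (q' x) (c x) (e x) $ i $ j) x0"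
  using exhaust_2[of i] exhaust_2[of j]
  by (elim disjE; simp add: pml_matrix_def; intro continuous_intros assms)

text \<open>
  Polar coordinates and the absorption profile are only meaningful away from the origin.
\<close>

lemma bounded_coeff_modify_at_0:
  assumes "bounded_coeff g" "\<And>x. x \<noteq> 0 \<Longrightarrow> f x = g x"
  shows "bounded_coeff f"
proof -
  have f: "f = (\<lambda>x. if x \<in> {0} then f 0 else g x)" using assms(2) by auto
  have "(\<lambda>x. if x \<in> {0} then f 0 else g x) \<in> borel_measurable lborel"
    using assms(1) by (intro measurable_If_set) (auto simp: bounded_coeff_def)
  moreover obtain M where "AE x in lborel. norm (g x) \<le> M" using assms(1) by (auto simp: bounded_coeff_def)
  then have "AE x in lborel. norm (f x) \<le> M"
    using AE_lborel_singleton[of 0] by eventually_elim (use assms(2) in simp)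
  ultimately show ?thesis using f by (auto simp: bounded_coeff_def)
qed

section \<open>Absorption profiles\<close>

lemma bounded_coeff_direction:
  "bounded_coeff (\<lambda>x::real^2. complex_of_real (x $ i / norm x))"
proof -
  have "(\<lambda>x::real^2. x $ i) \<in> borel_measurable borel"
    by (intro borel_measurable_continuous_onI continuous_intros)
  then have "(\<lambda>x::real^2. complex_of_real (x $ i / norm x)) \<in> borel_measurable lborel" by measurable
  moreover have "norm (complex_of_real (x $ i / norm x)) \<le> 1" for x :: "real^2"
    using component_le_norm_cart[of x i] by (cases "x = 0") (auto simp: norm_divide divide_le_eq)
  ultimately show ?thesis unfolding bounded_coeff_def by blast
qed

locale pml_profile =
  fixes R :: real and \<sigma> :: "real \<Rightarrow> real"
  assumes R_pos: "R > 0"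
    and L_infinity: "L_infinity_pos \<sigma>"
    and zero_inside: "\<And>r. 0 < r \<Longrightarrow> r < R \<Longrightarrow> \<sigma> r = 0"
    and pos_outside: "\<And>r. r > R \<Longrightarrow> \<sigma> r > 0"
    and mono: "mono_on {R..} \<sigma>"
    and cont: "continuous_on {R..} \<sigma>"
begin

lemma sigma_R_nonneg: "0 \<le> \<sigma> R"
proof (rule tendsto_lowerbound)
  show "(\<sigma> \<longlongrightarrow> \<sigma> R) (at_right R)"
    using cont by (auto simp: continuous_on_def intro: tendsto_within_subset)
  show "\<forall>\<^sub>F r in at_right R. 0 \<le> \<sigma> r"
    using pos_outside by (auto simp: eventually_at_filter intro!: always_eventually less_imp_le)
qed simp

text \<open>
  The essential bound holds at some point to the right of \<open>r\<close>, hence at \<open>r\<close> by monotonicity.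
\<close>

lemma sigma_bounded: "\<exists>C. \<forall>r\<ge>R. 0 \<le> \<sigma> r \<and> \<sigma> r \<le> C"
proof -
  obtain C where C: "AE r in lborel. 0 < r \<longrightarrow> \<bar>\<sigma> r\<bar> \<le> C"
    using L_infinity by (auto simp: L_infinity_pos_def)
  have "0 \<le> \<sigma> r \<and> \<sigma> r \<le> C" if r: "r \<ge> R" for r
  proof -
    have "\<exists>r'\<in>{r<..<r+1}. \<bar>\<sigma> r'\<bar> \<le> C"
    proof (rule ccontr)
      assume n: "\<not> ?thesis"
      have "AE x in lborel. x \<notin> {r<..<r+1}"
        using C by eventually_elim (use n r R_pos in force)
      then have "{r<..<r+1} \<in> null_sets lborel" by (subst AE_iff_null_sets) auto
      then show False by (simp add: null_sets_def)
    qed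
    then obtain r' where "r' > r" "\<sigma> r' \<le> C" by (auto simp: abs_le_iff)
    moreover have "\<sigma> r \<le> \<sigma> r'" by (rule mono_onD[OF mono]) (use r \<open>r' > r\<close> in auto)
    moreover have "0 \<le> \<sigma> r" using sigma_R_nonneg pos_outside[of r] r by (cases "r = R") auto
    ultimately show ?thesis by simp
  qed
  then show ?thesis by blast
qed

lemma sigma_nonneg: "r \<ge> R \<Longrightarrow> 0 \<le> \<sigma> r"
  using sigma_bounded by blast

lemma sigma_integral:
  assumes "R \<le> r" shows "\<sigma> integrable_on {R..r}" "(LBINT t:{R..r}. \<sigma> t) = integral {R..r} \<sigma>"
proof -
  have "set_integrable lborel {R..r} \<sigma>"
    by (rule borel_integrable_atLeastAtMost') (rule continuous_on_subset[OF cont], auto)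
  then show "\<sigma> integrable_on {R..r}" "(LBINT t:{R..r}. \<sigma> t) = integral {R..r} \<sigma>"
    by (rule set_borel_integral_eq_integral)+
qed

lemma sigma_tilde_eq: "R \<le> r \<Longrightarrow> sigma_tilde R \<sigma> r = integral {R..r} \<sigma> / r"
  by (cases "r = R") (simp_all add: sigma_tilde_def sigma_integral)

text \<open>
  By monotonicity the mean of \<open>\<sigma>\<close> over the layer up to \<open>r\<close> is at most \<open>\<sigma> r\<close>. The factor \<open>(r - R) / r\<close>
  is what makes \<open>sigma_tilde\<close> much smaller than \<open>\<sigma>\<close> at the start of the layer, even if \<open>\<sigma> R = 0\<close>.
\<close>

lemma sigma_tilde_bounds:
  assumes "R \<le> r" shows "0 \<le> sigma_tilde R \<sigma> r" "sigma_tilde R \<sigma> r \<le> (r - R) / r * \<sigma> r"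
proof -
  have r: "r > 0" using assms R_pos by simp
  have "0 \<le> integral {R..r} \<sigma>"
    by (rule integral_nonneg[OF sigma_integral(1)[OF assms]]) (auto intro: sigma_nonneg)
  then show "0 \<le> sigma_tilde R \<sigma> r" using r by (simp add: sigma_tilde_eq assms)
  have "integral {R..r} \<sigma> \<le> integral {R..r} (\<lambda>t. \<sigma> r)"
    by (rule integral_le[OF sigma_integral(1)[OF assms]]) (auto intro!: mono_onD[OF mono])
  also have "\<dots> = (r - R) * \<sigma> r" using assms by simp
  finally show "sigma_tilde R \<sigma> r \<le> (r - R) / r * \<sigma> r"
    using r by (simp add: sigma_tilde_eq assms divide_right_mono)
qed

lemma continuous_on_sigma_tilde: "continuous_on {R..} (sigma_tilde R \<sigma>)"
proof -
  have "continuous_on {R..} (\<lambda>r. integral {R..r} \<sigma> / r)"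
  proof (rule continuous_on_divide)
    show "continuous_on {R..} (\<lambda>r. integral {R..r} \<sigma>)"
    proof (unfold continuous_on_eq_continuous_within, intro ballI)
      fix r assume r: "r \<in> {R..}"
      have "continuous_on {R..r + 1} (\<lambda>r. integral {R..r} \<sigma>)"
        by (rule indefinite_integral_continuous_1[OF sigma_integral(1)]) (use r in simp)
      then have "continuous (at r within {R..r + 1}) (\<lambda>r. integral {R..r} \<sigma>)"
        using r by (simp add: continuous_on_eq_continuous_within)
      moreover have "at r within {R..} = at r within {R..r + 1}"
        by (rule at_within_nhd[where S="{..<r + 1}"]) auto
      ultimately show "continuous (at r within {R..}) (\<lambda>r. integral {R..r} \<sigma>)" by simp
    qed
  qed (use R_pos in \<open>auto intro: continuous_on_id\<close>)
  then show ?thesis by (rule continuous_on_eq) (simp add: sigma_tilde_eq)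
qed

text \<open>
  Both stretching factors are of this form, with \<open>f\<close> equal to \<open>\<sigma>\<close> or to \<open>sigma_tilde R \<sigma>\<close>. The
  factor is bounded away from zero because \<open>Re (s + f) \<ge> Re s\<close>.
\<close>

lemma radial_coeff:
  fixes f :: "real \<Rightarrow> real" and s :: complex
  assumes s: "Re s > 0" and c: "continuous_on {R..} f" and z: "\<And>r. 0 < r \<Longrightarrow> r < R \<Longrightarrow> f r = 0"
    and b: "\<And>r. r \<ge> R \<Longrightarrow> 0 \<le> f r \<and> f r \<le> C"
  defines "d \<equiv> \<lambda>x::real^2. 1 + complex_of_real (f (norm x)) / s"
  shows "x \<noteq> 0 \<Longrightarrow> d x \<noteq> 0" and "bounded_coeff d" and "bounded_coeff (\<lambda>x. inverse (d x))"
    and "norm y > R \<Longrightarrow> isCont d y"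
proof -
  have s0: "s \<noteq> 0" using s by auto
  have f: "0 \<le> f (norm x)" if "x \<noteq> 0" for x :: "real^2"
    using z[of "norm x"] b[of "norm x"] that by (cases "norm x < R") auto
  have low: "norm (d x) \<ge> Re s / norm s" if "x \<noteq> 0" for x
  proof -
    have "Re s \<le> Re (s + complex_of_real (f (norm x)))" using f[OF that] by simp
    also have "\<dots> \<le> norm (s + complex_of_real (f (norm x)))" by (rule complex_Re_le_cmod)
    also have "s + complex_of_real (f (norm x)) = s * d x" using s0 by (simp add: d_def field_simps)
    finally show ?thesis using s0 by (simp add: norm_mult field_simps)
  qed
  have pos: "Re s / norm s > 0" using s s0 by simp
  show ne: "d x \<noteq> 0" if "x \<noteq> 0" for x using low[OF that] pos by auto
  \<comment> \<open>The values of f at 0 and below are arbitrary; h is a Borel function that agrees with f on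
    the positive half-line.\<close>
  define h where "h r = indicator {R..} r *\<^sub>R f r" for r
  have [measurable]: "h \<in> borel_measurable borel"
    unfolding h_def by (rule borel_measurable_continuous_on_indicator[OF _ c]) simp
  have hf: "f (norm x) = h (norm x)" if "x \<noteq> 0" for x :: "real^2"
    using z[of "norm x"] that by (auto simp: h_def indicator_def)
  have hb: "\<bar>h r\<bar> \<le> \<bar>C\<bar>" for r using b[of r] by (auto simp: h_def indicator_def)
  have m: "(\<lambda>x::real^2. 1 + complex_of_real (h (norm x)) / s) \<in> borel_measurable lborel" by measurable
  show "bounded_coeff d"
  proof (rule bounded_coeff_modify_at_0)
    have "norm (1 + complex_of_real (h (norm x)) / s) \<le> 1 + \<bar>C\<bar> / norm s" for x :: "real^2"
    proof (rule order_trans[OF norm_triangle_ineq], intro add_mono)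
      show "norm (complex_of_real (h (norm x)) / s) \<le> \<bar>C\<bar> / norm s"
        using hb[of "norm x"] by (simp add: norm_divide divide_right_mono)
    qed simp
    then show "bounded_coeff (\<lambda>x::real^2. 1 + complex_of_real (h (norm x)) / s)"
      using m unfolding bounded_coeff_def by blast
  qed (simp add: d_def hf)
  show "bounded_coeff (\<lambda>x. inverse (d x))"
  proof (rule bounded_coeff_modify_at_0)
    have "AE x::real^2 in lborel. norm (inverse (1 + complex_of_real (h (norm x)) / s)) \<le> inverse (Re s / norm s)"
      using AE_lborel_singleton[of "0::real^2"]
    proof eventually_elim
      case (elim x)
      show ?case
        using le_imp_inverse_le[OF low[OF elim] pos] by (simp add: norm_inverse d_def hf[OF elim])
    qed
    then show "bounded_coeff (\<lambda>x::real^2. inverse (1 + complex_of_real (h (norm x)) / s))"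
      using borel_measurable_inverse[OF m] unfolding bounded_coeff_def by blast
  qed (simp add: d_def hf)
  show "isCont d y" if "norm y > R" for y
  proof -
    have "isCont f (norm y)" by (rule continuous_on_interior[OF c]) (use that in simp)
    then have "isCont (\<lambda>x. f (norm x)) y" by (intro isCont_o2[of _ norm f] continuous_intros)
    then show ?thesis unfolding d_def using s0 by (intro continuous_intros)
  qed
qed

lemma d_sigma_coeff:
  assumes "Re s > 0"
  shows "x \<noteq> 0 \<Longrightarrow> d_sigma \<sigma> s x \<noteq> 0" and "bounded_coeff (d_sigma \<sigma> s)"
    and "bounded_coeff (\<lambda>x. inverse (d_sigma \<sigma> s x))" and "norm y > R \<Longrightarrow> isCont (d_sigma \<sigma> s) y"
proof -
  obtain C where C: "\<And>r. r \<ge> R \<Longrightarrow> 0 \<le> \<sigma> r \<and> \<sigma> r \<le> C" using sigma_bounded by blast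
  note rc = radial_coeff[OF assms cont zero_inside C]
  show "x \<noteq> 0 \<Longrightarrow> d_sigma \<sigma> s x \<noteq> 0" "bounded_coeff (d_sigma \<sigma> s)"
    "bounded_coeff (\<lambda>x. inverse (d_sigma \<sigma> s x))" "norm y > R \<Longrightarrow> isCont (d_sigma \<sigma> s) y"
    unfolding d_sigma_def[abs_def] using rc by blast+
qed

lemma d_tilde_sigma_coeff:
  assumes "Re s > 0"
  shows "x \<noteq> 0 \<Longrightarrow> d_tilde_sigma R \<sigma> s x \<noteq> 0" and "bounded_coeff (d_tilde_sigma R \<sigma> s)"
    and "bounded_coeff (\<lambda>x. inverse (d_tilde_sigma R \<sigma> s x))" and "norm y > R \<Longrightarrow> isCont (d_tilde_sigma R \<sigma> s) y"
proof -
  obtain C where C: "\<And>r. r \<ge> R \<Longrightarrow> 0 \<le> \<sigma> r \<and> \<sigma> r \<le> C" using sigma_bounded by blast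
  have b: "0 \<le> sigma_tilde R \<sigma> r \<and> sigma_tilde R \<sigma> r \<le> C" if r: "r \<ge> R" for r
  proof -
    have "(r - R) / r * \<sigma> r \<le> 1 * \<sigma> r"
      using r R_pos sigma_nonneg[OF r] by (intro mult_right_mono) (auto simp: divide_le_eq)
    then show ?thesis using sigma_tilde_bounds[OF r] C[OF r] by linarith
  qed
  have z: "sigma_tilde R \<sigma> r = 0" if "r < R" for r using that by (simp add: sigma_tilde_def)
  note rc = radial_coeff[OF assms continuous_on_sigma_tilde z b]
  show "x \<noteq> 0 \<Longrightarrow> d_tilde_sigma R \<sigma> s x \<noteq> 0" "bounded_coeff (d_tilde_sigma R \<sigma> s)"
    "bounded_coeff (\<lambda>x. inverse (d_tilde_sigma R \<sigma> s x))" "norm y > R \<Longrightarrow> isCont (d_tilde_sigma R \<sigma> s) y"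
    unfolding d_tilde_sigma_def[abs_def] using rc by blast+
qed

lemma A_sigma_coeff:
  assumes s: "Re s > 0" and A: "A = vector [vector [a1, 0], vector [0, a2]]"
  shows "bounded_coeff (\<lambda>x. A_sigma A R \<sigma> s x $ i $ j)"
    and "norm y > R \<Longrightarrow> isCont (\<lambda>x. A_sigma A R \<sigma> s x $ i $ j) y"
proof -
  let ?M = "\<lambda>x. pml_matrix (complex_of_real a1) (complex_of_real a2)
    (d_tilde_sigma R \<sigma> s x * inverse (d_sigma \<sigma> s x)) (d_sigma \<sigma> s x * inverse (d_tilde_sigma R \<sigma> s x))
    (complex_of_real (x $ 1 / norm x)) (complex_of_real (x $ 2 / norm x))"
  have eq: "A_sigma A R \<sigma> s x = ?M x" if "x \<noteq> 0" for x
    using A_sigma_polar[OF that A d_sigma_coeff(1)[OF s that] d_tilde_sigma_coeff(1)[OF s that]]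
    by (simp only: divide_inverse)
  have "bounded_coeff (\<lambda>x. ?M x $ i $ j)"
    by (intro bounded_coeff_pml_matrix bounded_coeff_mult d_sigma_coeff d_tilde_sigma_coeff bounded_coeff_direction s)
  then show "bounded_coeff (\<lambda>x. A_sigma A R \<sigma> s x $ i $ j)"
    by (rule bounded_coeff_modify_at_0) (simp add: eq)
  show "isCont (\<lambda>x. A_sigma A R \<sigma> s x $ i $ j) y" if y: "norm y > R"
  proof -
    have y0: "y \<noteq> 0" using y R_pos by auto
    have "isCont (\<lambda>x::real^2. complex_of_real (x $ k / norm x)) y" for k
      using y0 by (intro continuous_intros) auto
    then have "isCont (\<lambda>x. ?M x $ i $ j) y"
      by (intro isCont_pml_matrix continuous_mult continuous_at_within_inverse d_sigma_coeff(1,4)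
          d_tilde_sigma_coeff(1,4) s y y0)
    moreover have "\<forall>\<^sub>F x in nhds y. A_sigma A R \<sigma> s x $ i $ j = ?M x $ i $ j"
      using t1_space_nhds[OF y0] by (rule eventually_mono) (simp add: eq)
    ultimately show ?thesis by (simp add: isCont_cong)
  qed
qed

end

section \<open>Loss of ellipticity in the layer\<close>

lemma pml_form_eq_div_form:
  "pml_form A R \<sigma> s = div_form (A_sigma A R \<sigma> s) (\<lambda>x. s\<^sup>2 * (d_tilde_sigma R \<sigma> s x * d_sigma \<sigma> s x))"
  by (simp add: pml_form_def div_form_def fun_eq_iff mult.assoc)

text \<open>
  With \<open>s = S z\<close> the ratio is \<open>(z + \<tau>) / (z + 1)\<close>, and solving for \<open>z\<close> gives \<open>z = (q - \<tau>) / (1 - q)\<close>.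
  This has positive real part exactly if \<open>q\<close> lies in the open disc with diameter from \<open>\<tau>\<close> to \<open>1\<close>, that is
  if \<open>(1 + \<tau>) * Re q - (norm q)\<^sup>2 - \<tau> > 0\<close>. On the ray through \<open>p + \<i> \<delta>\<close>, the factor
  \<open>p / (2 * \<alpha>\<^sup>2)\<close> maximizes \<open>Re q - (norm q)\<^sup>2\<close>, and the maximum is \<open>p\<^sup>2 / (4 * \<alpha>\<^sup>2)\<close>.
\<close>

lemma complex_stretching_ratio:
  fixes \<tau> \<alpha> p \<delta> S :: real
  assumes "0 < p" "0 < \<delta>" "p\<^sup>2 + \<delta>\<^sup>2 = \<alpha>\<^sup>2" "0 \<le> \<tau>" "\<tau> < p\<^sup>2 / (4 * \<alpha>\<^sup>2)" "0 < S"
  defines "q \<equiv> complex_of_real (p / (2 * \<alpha>\<^sup>2)) * Complex p \<delta>"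
  shows "\<exists>s. Re s > 0 \<and> (1 + complex_of_real (\<tau> * S) / s) / (1 + complex_of_real S / s) = q"
proof -
  have a2: "\<alpha>\<^sup>2 > 0" using assms(1,3) by (metis add_pos_nonneg zero_le_power2 zero_less_power)
  define \<kappa> where "\<kappa> = p / (2 * \<alpha>\<^sup>2)"
  have k: "\<kappa> > 0" using assms a2 by (simp add: \<kappa>_def)
  have q: "Re q = \<kappa> * p" "Im q = \<kappa> * \<delta>" by (simp_all add: q_def \<kappa>_def)
  define w where "w = 1 - q"
  have w: "w \<noteq> 0" using k assms(2) q by (auto simp: w_def complex_eq_iff)
  define z where "z = (q - complex_of_real \<tau>) / w"
  have small: "p\<^sup>2 / (4 * \<alpha>\<^sup>2) \<le> 1 / 4"
    using a2 assms(3) by (simp add: divide_le_eq) (smt (verit) zero_le_power2)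
  have "(\<kappa> * p)\<^sup>2 + (\<kappa> * \<delta>)\<^sup>2 = \<kappa> * p / 2"
  proof -
    have "(\<kappa> * p)\<^sup>2 + (\<kappa> * \<delta>)\<^sup>2 = \<kappa> * (\<kappa> * \<alpha>\<^sup>2)" unfolding assms(3)[symmetric] by (simp add: power2_eq_square algebra_simps)
    also have "\<kappa> * \<alpha>\<^sup>2 = p / 2" using a2 by (simp add: \<kappa>_def)
    finally show ?thesis by simp
  qed
  moreover have "\<kappa> * p / 2 = p\<^sup>2 / (4 * \<alpha>\<^sup>2)" by (simp add: \<kappa>_def power2_eq_square)
  ultimately have main: "(1 + \<tau>) * Re q - ((Re q)\<^sup>2 + (Im q)\<^sup>2) - \<tau> > 0"
  proof -
    assume 1: "(\<kappa> * p)\<^sup>2 + (\<kappa> * \<delta>)\<^sup>2 = \<kappa> * p / 2" and 2: "\<kappa> * p / 2 = p\<^sup>2 / (4 * \<alpha>\<^sup>2)"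
    have "0 \<le> \<tau> * (\<kappa> * p)" using assms k by simp
    moreover have "\<tau> < \<kappa> * p / 2" using 2 assms(5) by simp
    ultimately show ?thesis unfolding q 1 by (simp only: distrib_right mult_1)
  qed
  have "Re ((q - complex_of_real \<tau>) * cnj w) > 0"
    using main by (simp add: w_def power2_eq_square algebra_simps)
  then have Rez: "Re z > 0"
    using w by (simp add: z_def Re_complex_div_gt_0)
  have z1: "(z + complex_of_real \<tau>) * w = q * (1 - complex_of_real \<tau>)" "(z + 1) * w = 1 - complex_of_real \<tau>"
    using w by (simp_all add: z_def field_simps) (simp_all add: w_def algebra_simps)
  have t1: "1 - complex_of_real \<tau> \<noteq> 0" using small assms(5) by (simp add: complex_eq_iff)
  have zne: "z + 1 \<noteq> 0" using z1(2) t1 by auto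
  have ratio: "(z + complex_of_real \<tau>) / (z + 1) = q"
  proof -
    have "(z + complex_of_real \<tau>) * w = q * (z + 1) * w" using z1 by (simp add: mult.assoc)
    then have "z + complex_of_real \<tau> = q * (z + 1)" using w by simp
    then show ?thesis using zne by simp
  qed
  define s where "s = complex_of_real S * z"
  have z0: "z \<noteq> 0" using Rez by auto
  have "1 + complex_of_real (\<tau> * S) / s = (z + complex_of_real \<tau>) / z" "1 + complex_of_real S / s = (z + 1) / z"
    using z0 assms(6) by (simp_all add: s_def field_simps)
  then have "(1 + complex_of_real (\<tau> * S) / s) / (1 + complex_of_real S / s) = q" using ratio z0 by simp
  moreover have "Re s > 0" using Rez assms(6) by (simp add: s_def)
  ultimately show ?thesis by blast
qed

text \<open>
  At the direction \<open>(1, -1) / sqrt 2\<close> the vector \<open>(1 + T, 1 - T)\<close> is \<open>sqrt 2\<close> times \<open>T e + f\<close> with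
  the radial vector \<open>e\<close> and the tangential vector \<open>f = (1, 1) / sqrt 2\<close>. In that basis the diagonal
  entries of \<open>A\<close> are \<open>\<alpha>\<close> and the off-diagonal ones are \<open>- p\<close>, and the quadratic form becomes
  \<open>2 / q\<close> times the polynomial in the hypothesis.
\<close>

lemma pml_matrix_null_direction:
  assumes c: "c\<^sup>2 = 1/2" "e\<^sup>2 = 1/2" "c * e = - (1/2)" and q: "q * q' = 1"
    and a: "a1 + a2 = 2 * \<alpha>" "a2 - a1 = 2 * p"
    and root: "\<alpha> * (q * T)\<^sup>2 - 2 * p * (q * T) + \<alpha> = 0"
  defines "M \<equiv> pml_matrix a1 a2 q q' c e"
  shows "M $ 1 $ 1 * (1 + T)\<^sup>2 + M $ 1 $ 2 * ((1 + T) * (1 - T)) +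
     (M $ 2 $ 1 * ((1 - T) * (1 + T)) + M $ 2 $ 2 * (1 - T)\<^sup>2) = 0"
proof -
  have c4: "c ^ 4 = 1/4" "e ^ 4 = 1/4"
    using power_mult[of c 2 2] power_mult[of e 2 2] by (simp_all add: c power_divide)
  have 1: "4 * M $ 1 $ 1 = a1 * (q + 2 + q') + a2 * (q - 2 + q')"
    "4 * M $ 2 $ 2 = a1 * (q - 2 + q') + a2 * (q + 2 + q')"
    "4 * M $ 1 $ 2 = - ((a1 + a2) * (q - q'))" "4 * M $ 2 $ 1 = - ((a1 + a2) * (q - q'))"
    by (simp_all add: M_def pml_matrix_def c c4 field_simps)
  have "4 * (M $ 1 $ 1 * (1 + T)\<^sup>2 + M $ 1 $ 2 * ((1 + T) * (1 - T)) +
     (M $ 2 $ 1 * ((1 - T) * (1 + T)) + M $ 2 $ 2 * (1 - T)\<^sup>2)) =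
     4 * (M $ 1 $ 1) * (1 + T)\<^sup>2 + 4 * (M $ 1 $ 2) * ((1 + T) * (1 - T)) +
     (4 * (M $ 2 $ 1) * ((1 - T) * (1 + T)) + 4 * (M $ 2 $ 2) * (1 - T)\<^sup>2)"
    by (simp add: algebra_simps)
  also have "\<dots> = 4 * ((a1 + a2) * (q * T\<^sup>2 + q') + 2 * (a1 - a2) * T)"
    unfolding 1 by (simp add: algebra_simps power2_eq_square)
  also have "\<dots> = 8 * (q' * (\<alpha> * (q * T)\<^sup>2 - 2 * p * (q * T) + \<alpha>))"
    using q a by algebra
  finally show ?thesis unfolding root mult_zero_right mult_eq_0_iff by (elim disjE) simp_all
qed

theorem theorem3p5:
  fixes A :: "real^2^2" and lmax lmin R :: real and \<sigma> :: "real \<Rightarrow> real"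
  assumes "transpose A = A"
    and "\<And>x. x \<noteq> 0 \<Longrightarrow> x \<bullet> (A *v x) > 0"
    and "matrix_inv A = vector [vector [lmax, 0], vector [0, lmin]]"
    and "lmax \<ge> lmin" and "lmin > 0"
    and "lmax \<noteq> lmin"
    and "R > 0"
    and "L_infinity_pos \<sigma>"
    and "\<And>r. 0 < r \<Longrightarrow> r < R \<Longrightarrow> \<sigma> r = 0"
    and "\<And>r. r > R \<Longrightarrow> \<sigma> r > 0"
    and "mono_on {R..} \<sigma>"
    and "continuous_on {R..} \<sigma>"
  shows "(\<exists>s0. Re s0 > 0
            \<and> is_riesz_rep (pml_form A R \<sigma> s0) (pml_op A R \<sigma> s0)
            \<and> \<not> fredholm (pml_op A R \<sigma> s0))
       \<and> essential_spectrum_Cplus (pml_op A R \<sigma>) \<noteq> {}"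
proof -
  interpret pml_profile R \<sigma> by (rule pml_profile.intro) fact+
  have l: "lmax > lmin" "lmax > 0" "lmin > 0" using assms(4-6) by auto
  define a1 a2 where "a1 = 1 / lmax" and "a2 = 1 / lmin"
  have A: "A = vector [vector [a1, 0], vector [0, a2]]"
    unfolding a1_def a2_def by (rule diag_of_matrix_inv_diag[OF assms(2,3)]) (use l in auto)
  have a: "0 < a1" "a1 < a2" using l by (simp_all add: a1_def a2_def frac_less2)
  \<comment> \<open>In the polar basis at direction (1, -1), both diagonal entries of A are alpha and the off-diagonal
    ones are -p, while delta^2 is the determinant of A.\<close>
  define \<alpha> p \<delta> where "\<alpha> = (a1 + a2) / 2" and "p = (a2 - a1) / 2" and "\<delta> = sqrt (a1 * a2)"
  have pos: "0 < \<alpha>" "0 < p" "0 < \<delta>" using a by (simp_all add: \<alpha>_def p_def \<delta>_def)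
  have pyth: "p\<^sup>2 + \<delta>\<^sup>2 = \<alpha>\<^sup>2" using a by (simp add: \<alpha>_def p_def \<delta>_def power2_eq_square field_simps)
  define c0 where "c0 = p\<^sup>2 / (4 * \<alpha>\<^sup>2)"
  have c0: "c0 > 0" using pos by (simp add: c0_def)
  \<comment> \<open>A radius just behind the start of the layer: (r - R) / r is less than c0, the bound on tau
    under which the ratio q is attained.\<close>
  define r where "r = R * (1 + c0)"
  have r: "r > R" "r > 0" using R_pos c0 by (simp_all add: r_def add_pos_pos)
  define \<tau> where "\<tau> = sigma_tilde R \<sigma> r / \<sigma> r"
  have S: "\<sigma> r > 0" using pos_outside r by simp
  have \<tau>: "0 \<le> \<tau>" "\<tau> < c0" "\<tau> * \<sigma> r = sigma_tilde R \<sigma> r"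
  proof -
    show "0 \<le> \<tau>" "\<tau> * \<sigma> r = sigma_tilde R \<sigma> r"
      using sigma_tilde_bounds(1)[of r] r S by (simp_all add: \<tau>_def)
    have "\<tau> \<le> (r - R) / r" using sigma_tilde_bounds(2)[of r] r S by (simp add: \<tau>_def divide_le_eq)
    also have "r - R = R * c0" by (simp add: r_def algebra_simps)
    also have "R * c0 / r = c0 / (1 + c0)" using R_pos by (simp add: r_def)
    also have "\<dots> < c0" using c0 by (simp add: field_simps)
    finally show "\<tau> < c0" .
  qed
  define q where "q = complex_of_real (p / (2 * \<alpha>\<^sup>2)) * Complex p \<delta>"
  obtain s where s: "Re s > 0"
    and ratio: "(1 + complex_of_real (sigma_tilde R \<sigma> r) / s) / (1 + complex_of_real (\<sigma> r) / s) = q"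
    using complex_stretching_ratio[OF pos(2,3) pyth \<tau>(1) \<tau>(2)[unfolded c0_def] S] unfolding q_def \<tau>(3) by blast
  define x0 :: "real^2" where "x0 = vector [r / sqrt 2, - r / sqrt 2]"
  have nx: "norm x0 = r"
  proof -
    have "(norm x0)\<^sup>2 = r\<^sup>2" unfolding norm_vec2_power2 by (simp add: x0_def power_divide)
    then show ?thesis using r by simp
  qed
  have x0: "x0 \<noteq> 0" using nx r by auto
  \<comment> \<open>This t makes q t equal to (p + i delta) / alpha, a root of alpha y^2 - 2 p y + alpha.\<close>
  define t where "t = 2 * \<alpha> / p"
  define \<xi> :: "real^2" where "\<xi> = vector [1 + t, 1 - t]"
  have xi: "\<xi> \<noteq> 0"
  proof
    assume "\<xi> = 0"
    then have "\<xi> $ 1 = 0" "\<xi> $ 2 = 0" by simp_all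
    then show False by (simp add: \<xi>_def)
  qed
  let ?A = "A_sigma A R \<sigma> s" and ?c = "\<lambda>x. s\<^sup>2 * (d_tilde_sigma R \<sigma> s x * d_sigma \<sigma> s x)"
  have A0: "?A x0 = pml_matrix (complex_of_real a1) (complex_of_real a2) q (inverse q)
      (complex_of_real (1 / sqrt 2)) (complex_of_real (- 1 / sqrt 2))"
  proof -
    have 1: "d_tilde_sigma R \<sigma> s x0 / d_sigma \<sigma> s x0 = q"
      using ratio by (simp add: d_tilde_sigma_def d_sigma_def nx)
    have 2: "d_sigma \<sigma> s x0 / d_tilde_sigma R \<sigma> s x0 = inverse q" unfolding 1[symmetric] by simp
    have 3: "x0 $ 1 / norm x0 = 1 / sqrt 2" "x0 $ 2 / norm x0 = - 1 / sqrt 2"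
      unfolding nx using r by (simp_all add: x0_def)
    show ?thesis
      unfolding A_sigma_polar[OF x0 A d_sigma_coeff(1)[OF s x0] d_tilde_sigma_coeff(1)[OF s x0]] 1 2 3 ..
  qed
  have q0: "q \<noteq> 0" using pos by (simp add: q_def complex_eq_iff)
  have symbol: "(\<Sum>i\<in>UNIV. \<Sum>j\<in>UNIV. ?A x0 $ i $ j * complex_of_real (\<xi> $ i * \<xi> $ j)) = 0"
  proof -
    have qt: "q * complex_of_real t = Complex p \<delta> / complex_of_real \<alpha>"
      using pos by (simp add: q_def t_def power2_eq_square field_simps)
    have "(Complex p \<delta>)\<^sup>2 - 2 * complex_of_real p * Complex p \<delta> + complex_of_real (\<alpha>\<^sup>2) = 0"
      unfolding pyth[symmetric] by (simp add: complex_eq_iff power2_eq_square)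
    then have root: "complex_of_real \<alpha> * (q * complex_of_real t)\<^sup>2 - 2 * complex_of_real p * (q * complex_of_real t) + complex_of_real \<alpha> = 0"
      unfolding qt using pos by (simp add: power2_eq_square field_simps)
    have h: "(complex_of_real (1 / sqrt 2))\<^sup>2 = 1/2" "(complex_of_real (- 1 / sqrt 2))\<^sup>2 = 1/2"
      "complex_of_real (1 / sqrt 2) * complex_of_real (- 1 / sqrt 2) = - (1/2)"
      by (simp_all only: of_real_power[symmetric] of_real_mult[symmetric]) (simp_all add: power_divide)
    have ap: "complex_of_real a1 + complex_of_real a2 = 2 * complex_of_real \<alpha>"
      "complex_of_real a2 - complex_of_real a1 = 2 * complex_of_real p"
      by (simp_all add: \<alpha>_def p_def)
    show ?thesis
      using pml_matrix_null_direction[OF h right_inverse[OF q0] ap root]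
      unfolding A0[symmetric] by (simp add: sum_2 \<xi>_def power2_eq_square)
  qed
  have bA: "bounded_coeff (\<lambda>x. ?A x $ i $ j)" for i j by (rule A_sigma_coeff(1)[OF s A])
  have bc: "bounded_coeff ?c"
    by (intro bounded_coeff_mult bounded_coeff_const d_sigma_coeff d_tilde_sigma_coeff s)
  obtain T where T: "is_riesz_rep (div_form ?A ?c) T" using div_form_has_riesz_rep[OF bA bc] by blast
  have op: "pml_op A R \<sigma> s = T"
    unfolding pml_op_def pml_form_eq_div_form by (rule riesz_rep_eqI[OF T])
  have nf: "\<not> fredholm T"
    by (rule nonelliptic_point_not_fredholm[OF bA bc A_sigma_coeff(2)[OF s A] xi symbol T]) (simp add: nx r)
  have "is_riesz_rep (pml_form A R \<sigma> s) (pml_op A R \<sigma> s)"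
    unfolding op pml_form_eq_div_form by (rule T)
  then show ?thesis
    using s nf unfolding essential_spectrum_Cplus_def op[symmetric] by blast
qed

end
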